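(* Let $m,M,\alpha,\beta,\sigma,\tau>0$, let $a\in H^1(0,1)$ satisfy $a(x)\ge a_0$ for all $x\in[0,1]$ for some constant $a_0>0$, and assume $\alpha<\beta$ and that $K$ satisfies $\alpha<K<2\beta-\alpha$. Let $\hat{\mathcal{A}}$ be the operator on $\hat{\mathcal{H}}$ defined in the context. Then there exist $C>0$ and $\omega>0$ such that for all $t>0$ $$\left\|e^{t\hat{\mathcal{A}}}\right\|_{\mathcal{L}(\hat{\mathcal{H}})}\le C e^{-\omega t}.$$
   Context: State space: $\mathcal{H}=H^1(0,1)\times L^2(0,1)\times L^2(0,1)\times\mathbb{R}^2$ (real-valued functions), equipped with the inner product $$\langle(y,z,u,\xi,\eta),(\tilde y,\tilde z,\tilde u,\tilde\xi,\tilde\eta)\rangle_{\mathcal{H}}=\int_0^1(a y_x\tilde y_x+z\tilde z)\,dx+K\tau\int_0^1u\tilde u\,dx+m\xi\tilde\xi+M\eta\tilde\eta+\varpi\,J(y,z,u,\xi,\eta)\,J(\tilde y,\tilde z,\tilde u,\tilde\xi,\tilde\eta),$$ where $$J(y,z,u,\xi,\eta)=\int_0^1(\sigma y+z)\,dx+m\xi+M\eta+(\beta-\alpha)y(0)+\tau\alpha\int_0^1u\,dx,$$ and $\varpi>0$ is a constant taken sufficiently small so that the induced norm is equivalent to the usual product norm of $\mathcal{H}$. Operator: $$\mathcal{D}(\mathcal{A})=\{(y,z,u,\xi,\eta)\in\mathcal{H}:\ y\in H^2(0,1),\ z,u\in H^1(0,1),\ \xi=u(0)=z(0),\ \eta=z(1)\},$$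 $$\mathcal{A}(y,z,u,\xi,\eta)=\Big(z,\ (ay_x)_x-\sigma z,\ -\frac{u_x}{\tau},\ \frac1m\big[(ay_x)(0)-\beta\xi+\alpha u(1)\big],\ -\frac{(ay_x)(1)}{M}\Big).$$ (This is the generator for the overhead crane system $y_{tt}-(ay_x)_x+\sigma y_t=0$ on $(0,1)$, $my_{tt}(0,t)-(ay_x)(0,t)=\alpha y_t(0,t-\tau)-\beta y_t(0,t)$, $My_{tt}(1,t)+(ay_x)(1,t)=0$, with state $(y,y_t,y_t(0,t-x\tau),y_t(0,t),y_t(1,t))$.) Restricted operator: $\hat{\mathcal{H}}=\{\Phi\in\mathcal{H}:\ J(\Phi)=0\}$, a closed subspace of $\mathcal{H}$ of co-dimension $1$ with the inherited norm; $\mathcal{D}(\hat{\mathcal{A}})=\mathcal{D}(\mathcal{A})\cap\hat{\mathcal{H}}$ and $\hat{\mathcal{A}}\Phi=\mathcal{A}\Phi$ for $\Phi\in\mathcal{D}(\hat{\mathcal{A}})$. The operator $\hat{\mathcal{A}}$ generates a $C_0$-semigroup of contractions $e^{t\hat{\mathcal{A}}}$ on $\hat{\mathcal{H}}$. $\mathcal{L}(\hat{\mathcal{H}})$ denotes the bounded linear operators on $\hat{\mathcal{H}}$ with the operator norm. *)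

theory Defs
  imports "HOL-Analysis.Analysis"
begin

section \<open>The space $L^2(0,1)$\<close>

abbreviation leb01 :: "real measure" where
  "leb01 \<equiv> lebesgue_on {0<..<1}"

definition sq_integrable :: "(real \<Rightarrow> real) \<Rightarrow> bool" where
  "sq_integrable f \<longleftrightarrow> f \<in> borel_measurable leb01 \<and> integrable leb01 (\<lambda>x. (f x)\<^sup>2)"

lemma sq_integrable_zero: "sq_integrable (\<lambda>x. 0)"
  by (simp add: sq_integrable_def)

lemma sq_integrable_times:
  assumes "sq_integrable f" "sq_integrable g"
  shows "integrable leb01 (\<lambda>x. f x * g x)"
proof (rule Bochner_Integration.integrable_bound)
  show "integrable leb01 (\<lambda>x. (f x)\<^sup>2 + (g x)\<^sup>2)"
    using assms by (auto simp: sq_integrable_def)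
  show "(\<lambda>x. f x * g x) \<in> borel_measurable leb01"
    using assms by (auto simp: sq_integrable_def)
  have "\<bar>f x * g x\<bar> \<le> (f x)\<^sup>2 + (g x)\<^sup>2" for x
  proof -
    have "2 * (\<bar>f x\<bar> * \<bar>g x\<bar>) \<le> \<bar>f x\<bar>\<^sup>2 + \<bar>g x\<bar>\<^sup>2"
      using sum_squares_bound[of "\<bar>f x\<bar>" "\<bar>g x\<bar>"] by (simp add: mult.assoc)
    moreover have "0 \<le> \<bar>f x\<bar> * \<bar>g x\<bar>" by simp
    ultimately show ?thesis by (simp only: abs_mult power2_abs)
  qed
  then show "AE x in leb01. norm (f x * g x) \<le> norm ((f x)\<^sup>2 + (g x)\<^sup>2)"
    by (intro AE_I2) simp
qed

lemma sq_integrable_add: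
  assumes "sq_integrable f" "sq_integrable g"
  shows "sq_integrable (\<lambda>x. f x + g x)"
  using assms sq_integrable_times[OF assms]
  by (auto simp: sq_integrable_def power2_sum mult.assoc)

lemma sq_integrable_scale:
  assumes "sq_integrable f"
  shows "sq_integrable (\<lambda>x. c * f x)"
  using assms by (auto simp: sq_integrable_def power_mult_distrib)

lemma sq_integrable_minus:
  assumes "sq_integrable f"
  shows "sq_integrable (\<lambda>x. - f x)"
  using assms by (auto simp: sq_integrable_def)

lemma sq_integrable_diff:
  assumes "sq_integrable f" "sq_integrable g"
  shows "sq_integrable (\<lambda>x. f x - g x)"
  using sq_integrable_add[OF assms(1) sq_integrable_minus[OF assms(2)]] by simp

definition l2_rel :: "(real \<Rightarrow> real) \<Rightarrow> (real \<Rightarrow> real) \<Rightarrow> bool" where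
  "l2_rel f g \<longleftrightarrow> sq_integrable f \<and> sq_integrable g \<and> (AE x in leb01. f x = g x)"

quotient_type l2 = "real \<Rightarrow> real" / partial: l2_rel
proof (rule part_equivpI)
  show "\<exists>f. l2_rel f f"
    using sq_integrable_zero by (auto simp: l2_rel_def)
  show "symp l2_rel"
    by (auto simp: symp_def l2_rel_def)
  show "transp l2_rel"
    by (auto simp: transp_def l2_rel_def)
qed

instantiation l2 :: real_inner
begin

lift_definition zero_l2 :: l2 is "\<lambda>x. 0"
  by (simp add: l2_rel_def sq_integrable_zero)

lift_definition plus_l2 :: "l2 \<Rightarrow> l2 \<Rightarrow> l2" is "\<lambda>f g x. f x + g x"
  by (auto simp: l2_rel_def intro: sq_integrable_add)

lift_definition minus_l2 :: "l2 \<Rightarrow> l2 \<Rightarrow> l2" is "\<lambda>f g x. f x - g x"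
  by (auto simp: l2_rel_def intro: sq_integrable_diff)

lift_definition uminus_l2 :: "l2 \<Rightarrow> l2" is "\<lambda>f x. - f x"
  by (auto simp: l2_rel_def intro: sq_integrable_minus)

lift_definition scaleR_l2 :: "real \<Rightarrow> l2 \<Rightarrow> l2" is "\<lambda>c f x. c * f x"
  by (auto simp: l2_rel_def intro: sq_integrable_scale)

lift_definition inner_l2 :: "l2 \<Rightarrow> l2 \<Rightarrow> real" is "\<lambda>f g. LINT x|leb01. f x * g x"
proof -
  fix f f' g g' assume *: "l2_rel f f'" "l2_rel g g'"
  show "(LINT x|leb01. f x * g x) = (LINT x|leb01. f' x * g' x)"
  proof (rule integral_cong_AE)
    show "AE x in leb01. f x * g x = f' x * g' x"
      using *[unfolded l2_rel_def] by (auto elim: AE_mp)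
  qed (use * in \<open>auto simp: l2_rel_def sq_integrable_def\<close>)
qed

definition norm_l2 :: "l2 \<Rightarrow> real" where
  "norm_l2 f = sqrt (f \<bullet> f)"

definition dist_l2 :: "l2 \<Rightarrow> l2 \<Rightarrow> real" where
  "dist_l2 f g = norm (f - g)"

definition sgn_l2 :: "l2 \<Rightarrow> l2" where
  "sgn_l2 f = inverse (norm f) *\<^sub>R f"

definition uniformity_l2 :: "(l2 \<times> l2) filter" where
  "uniformity_l2 = (INF e\<in>{0<..}. principal {(f, g). dist f g < e})"

definition open_l2 :: "l2 set \<Rightarrow> bool" where
  "open_l2 U \<longleftrightarrow> (\<forall>f\<in>U. eventually (\<lambda>(f', g). f' = f \<longrightarrow> g \<in> U) uniformity)"

instance
proof
  fix f g h :: l2 and c d :: real and U :: "l2 set"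
  show "f + g + h = f + (g + h)"
    by transfer (auto simp: l2_rel_def add.assoc intro!: sq_integrable_add)
  show "f + g = g + f"
    by transfer (auto simp: l2_rel_def add.commute intro!: sq_integrable_add)
  show "0 + f = f"
    by transfer (auto simp: l2_rel_def)
  show "- f + f = 0"
    by transfer (auto simp: l2_rel_def sq_integrable_zero)
  show "f - g = f + - g"
    by transfer (auto simp: l2_rel_def intro!: sq_integrable_diff)
  show "c *\<^sub>R (f + g) = c *\<^sub>R f + c *\<^sub>R g"
    by transfer (auto simp: l2_rel_def distrib_left
        intro!: sq_integrable_add sq_integrable_scale)
  show "(c + d) *\<^sub>R f = c *\<^sub>R f + d *\<^sub>R f"
    by transfer (auto simp: l2_rel_def distrib_right
        intro!: sq_integrable_add sq_integrable_scale)
  show "c *\<^sub>R d *\<^sub>R f = (c * d) *\<^sub>R f"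
    by transfer (auto simp: l2_rel_def mult.assoc intro!: sq_integrable_scale)
  show "1 *\<^sub>R f = f"
    by transfer (auto simp: l2_rel_def)
  show "f \<bullet> g = g \<bullet> f"
    by transfer (simp add: mult.commute)
  show "(f + g) \<bullet> h = f \<bullet> h + g \<bullet> h"
    by transfer (auto simp: l2_rel_def distrib_right sq_integrable_times)
  show "(c *\<^sub>R f) \<bullet> g = c * (f \<bullet> g)"
    by transfer (simp add: mult.assoc)
  show "0 \<le> f \<bullet> f"
    by transfer simp
  show "f \<bullet> f = 0 \<longleftrightarrow> f = 0"
  proof transfer
    fix f assume "l2_rel f f"
    then have f: "sq_integrable f" by (simp add: l2_rel_def)
    have "(LINT x|leb01. f x * f x) = 0 \<longleftrightarrow> (AE x in leb01. f x * f x = 0)"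
      by (rule integral_nonneg_eq_0_iff_AE) (auto intro: sq_integrable_times f)
    then show "(LINT x|leb01. f x * f x) = 0 \<longleftrightarrow> l2_rel f (\<lambda>x. 0)"
      using f by (simp add: l2_rel_def sq_integrable_zero)
  qed
qed (rule norm_l2_def dist_l2_def sgn_l2_def uniformity_l2_def open_l2_def)+

end

lift_definition l2_integral :: "l2 \<Rightarrow> real" is "\<lambda>f. LINT x|leb01. f x"
  by (intro integral_cong_AE) (auto simp: l2_rel_def sq_integrable_def)

text \<open>Pointwise product of classes. It is meaningful when the product of representatives is
  again square integrable, e.g. if one factor lies in $H^1(0,1)$ and hence is bounded.\<close>

definition l2_times :: "l2 \<Rightarrow> l2 \<Rightarrow> l2" (infixl "\<odot>" 70) where
  "f \<odot> g = abs_l2 (\<lambda>x. rep_l2 f x * rep_l2 g x)"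


section \<open>The Sobolev spaces $H^1(0,1)$ and $H^2(0,1)$\<close>

definition test_fun :: "(real \<Rightarrow> real) set" where
  "test_fun = {\<phi>. (\<forall>k x. (deriv ^^ k) \<phi> field_differentiable (at x)) \<and>
     (\<exists>S. compact S \<and> S \<subseteq> {0<..<1} \<and> (\<forall>x. x \<notin> S \<longrightarrow> \<phi> x = 0))}"

definition has_weak_deriv :: "l2 \<Rightarrow> l2 \<Rightarrow> bool" where
  "has_weak_deriv y g \<longleftrightarrow> (\<forall>\<phi>\<in>test_fun.
     (LINT x|leb01. rep_l2 y x * deriv \<phi> x) = - (LINT x|leb01. rep_l2 g x * \<phi> x))"

definition H1 :: "l2 set" where
  "H1 = {y. \<exists>g. has_weak_deriv y g}"

definition wderiv :: "l2 \<Rightarrow> l2" where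
  "wderiv y = (THE g. has_weak_deriv y g)"

definition H2 :: "l2 set" where
  "H2 = {y \<in> H1. wderiv y \<in> H1}"

definition H1_norm :: "l2 \<Rightarrow> real" where
  "H1_norm y = sqrt ((norm y)\<^sup>2 + (norm (wderiv y))\<^sup>2)"

text \<open>Point values on $[0,1]$ of an element of $H^1(0,1)$, taken from its continuous
  representative.\<close>

definition pval :: "l2 \<Rightarrow> real \<Rightarrow> real" where
  "pval y x = (THE c. \<exists>f. continuous_on {0..1} f \<and> (AE s in leb01. rep_l2 y s = f s) \<and> c = f x)"


section \<open>Strongly continuous semigroups on a normed subspace\<close>

text \<open>The norm of the state space depends on the parameters of the system, so it cannot be
  the type-class norm. The space is therefore given by a carrier \<open>X\<close> and a norm \<open>N\<close> on it,
  and only the values on \<open>X\<close> of operators on \<open>X\<close> are relevant.\<close>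

definition equivalent_norms_on :: "'a set \<Rightarrow> ('a \<Rightarrow> real) \<Rightarrow> ('a \<Rightarrow> real) \<Rightarrow> bool" where
  "equivalent_norms_on X N N' \<longleftrightarrow>
     (\<exists>c>0. \<exists>d>0. \<forall>x\<in>X. c * N' x \<le> N x \<and> N x \<le> d * N' x)"

definition bounded_operator_on ::
    "'a::real_vector set \<Rightarrow> ('a \<Rightarrow> real) \<Rightarrow> ('a \<Rightarrow> 'a) \<Rightarrow> bool" where
  "bounded_operator_on X N B \<longleftrightarrow>
     (\<forall>x\<in>X. B x \<in> X) \<and>
     (\<forall>x\<in>X. \<forall>y\<in>X. B (x + y) = B x + B y) \<and>
     (\<forall>c. \<forall>x\<in>X. B (c *\<^sub>R x) = c *\<^sub>R B x) \<and>
     (\<exists>C. \<forall>x\<in>X. N (B x) \<le> C * N x)"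

definition onorm_on :: "'a set \<Rightarrow> ('a \<Rightarrow> real) \<Rightarrow> ('a \<Rightarrow> 'a) \<Rightarrow> real" where
  "onorm_on X N B = (SUP x\<in>X. N (B x) / N x)"

definition C0_semigroup_on ::
    "'a::real_vector set \<Rightarrow> ('a \<Rightarrow> real) \<Rightarrow> (real \<Rightarrow> 'a \<Rightarrow> 'a) \<Rightarrow> bool" where
  "C0_semigroup_on X N T \<longleftrightarrow>
     (\<forall>t\<ge>0. bounded_operator_on X N (T t)) \<and>
     (\<forall>x\<in>X. T 0 x = x) \<and>
     (\<forall>s\<ge>0. \<forall>t\<ge>0. \<forall>x\<in>X. T (s + t) x = T s (T t x)) \<and>
     (\<forall>x\<in>X. ((\<lambda>t. N (T t x - x)) \<longlongrightarrow> 0) (at_right 0))"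

text \<open>The infinitesimal generator, as a graph.\<close>

definition generator_on ::
    "'a::real_vector set \<Rightarrow> ('a \<Rightarrow> real) \<Rightarrow> (real \<Rightarrow> 'a \<Rightarrow> 'a) \<Rightarrow> ('a \<times> 'a) set" where
  "generator_on X N T = {(x, y). x \<in> X \<and> y \<in> X \<and>
     ((\<lambda>h. N ((1 / h) *\<^sub>R (T h x - x) - y)) \<longlongrightarrow> 0) (at_right 0)}"

definition generates_contraction_semigroup ::
    "'a::real_vector set \<Rightarrow> ('a \<Rightarrow> real) \<Rightarrow> 'a set \<Rightarrow> ('a \<Rightarrow> 'a) \<Rightarrow> (real \<Rightarrow> 'a \<Rightarrow> 'a) \<Rightarrow> bool"
  where
  "generates_contraction_semigroup X N D A T \<longleftrightarrow>
     C0_semigroup_on X N T \<and>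
     (\<forall>t\<ge>0. \<forall>x\<in>X. N (T t x) \<le> N x) \<and>
     generator_on X N T = {(x, A x) |x. x \<in> D}"


section \<open>The overhead crane operator\<close>

type_synonym state = "l2 \<times> l2 \<times> l2 \<times> real \<times> real"

definition crane_space :: "state set" where
  "crane_space = {(y, z, u, \<xi>, \<eta>). y \<in> H1}"

definition product_norm :: "state \<Rightarrow> real" where
  "product_norm = (\<lambda>(y, z, u, \<xi>, \<eta>).
     sqrt ((H1_norm y)\<^sup>2 + (norm z)\<^sup>2 + (norm u)\<^sup>2 + \<xi>\<^sup>2 + \<eta>\<^sup>2))"

definition crane_J ::
    "real \<Rightarrow> real \<Rightarrow> real \<Rightarrow> real \<Rightarrow> real \<Rightarrow> real \<Rightarrow> state \<Rightarrow> real" where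
  "crane_J m M \<alpha> \<beta> \<sigma> \<tau> = (\<lambda>(y, z, u, \<xi>, \<eta>).
     l2_integral (\<sigma> *\<^sub>R y + z) + m * \<xi> + M * \<eta> + (\<beta> - \<alpha>) * pval y 0
       + \<tau> * \<alpha> * l2_integral u)"

definition crane_inner ::
    "real \<Rightarrow> real \<Rightarrow> real \<Rightarrow> real \<Rightarrow> real \<Rightarrow> real \<Rightarrow> real \<Rightarrow> real \<Rightarrow> l2 \<Rightarrow> state \<Rightarrow> state \<Rightarrow> real" where
  "crane_inner m M \<alpha> \<beta> \<sigma> \<tau> K varpi a = (\<lambda>(y, z, u, \<xi>, \<eta>) (y', z', u', \<xi>', \<eta>').
     (a \<odot> wderiv y) \<bullet> wderiv y' + z \<bullet> z' + K * \<tau> * (u \<bullet> u') + m * \<xi> * \<xi>' + M * \<eta> * \<eta>'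
       + varpi * crane_J m M \<alpha> \<beta> \<sigma> \<tau> (y, z, u, \<xi>, \<eta>) * crane_J m M \<alpha> \<beta> \<sigma> \<tau> (y', z', u', \<xi>', \<eta>'))"

definition crane_norm ::
    "real \<Rightarrow> real \<Rightarrow> real \<Rightarrow> real \<Rightarrow> real \<Rightarrow> real \<Rightarrow> real \<Rightarrow> real \<Rightarrow> l2 \<Rightarrow> state \<Rightarrow> real" where
  "crane_norm m M \<alpha> \<beta> \<sigma> \<tau> K varpi a \<Phi> = sqrt (crane_inner m M \<alpha> \<beta> \<sigma> \<tau> K varpi a \<Phi> \<Phi>)"

definition crane_dom :: "state set" where
  "crane_dom = {(y, z, u, \<xi>, \<eta>). y \<in> H2 \<and> z \<in> H1 \<and> u \<in> H1 \<and>
     \<xi> = pval u 0 \<and> \<xi> = pval z 0 \<and> \<eta> = pval z 1}"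

definition crane_op ::
    "real \<Rightarrow> real \<Rightarrow> real \<Rightarrow> real \<Rightarrow> real \<Rightarrow> real \<Rightarrow> l2 \<Rightarrow> state \<Rightarrow> state" where
  "crane_op m M \<alpha> \<beta> \<sigma> \<tau> a = (\<lambda>(y, z, u, \<xi>, \<eta>).
     (z,
      wderiv (a \<odot> wderiv y) - \<sigma> *\<^sub>R z,
      - (1 / \<tau>) *\<^sub>R wderiv u,
      (1 / m) * (pval (a \<odot> wderiv y) 0 - \<beta> * \<xi> + \<alpha> * pval u 1),
      - pval (a \<odot> wderiv y) 1 / M))"

definition crane_space0 ::
    "real \<Rightarrow> real \<Rightarrow> real \<Rightarrow> real \<Rightarrow> real \<Rightarrow> real \<Rightarrow> state set" where
  "crane_space0 m M \<alpha> \<beta> \<sigma> \<tau> = {\<Phi> \<in> crane_space. crane_J m M \<alpha> \<beta> \<sigma> \<tau> \<Phi> = 0}"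

definition crane_dom0 ::
    "real \<Rightarrow> real \<Rightarrow> real \<Rightarrow> real \<Rightarrow> real \<Rightarrow> real \<Rightarrow> state set" where
  "crane_dom0 m M \<alpha> \<beta> \<sigma> \<tau> = crane_dom \<inter> crane_space0 m M \<alpha> \<beta> \<sigma> \<tau>"

end

theory Submission
  imports Defs "HOL-Computational_Algebra.Polynomial"
begin

text \<open>
  The semigroup decays because the energy, half the squared norm of the state, can be corrected to
  a quadratic functional \<open>V\<close> that is equivalent to the squared norm and satisfies \<open>V' \<le> - 2\<omega>V\<close> along
  the orbits that start in the domain of the operator.

  Write \<open>(y, z, u, \<xi>, \<eta>)\<close> for the state and \<open>w = a y\<^sub>x\<close>. On the domain and for \<open>J = 0\<close>, integration by
  parts turns twice the derivative of the energy into
  \<open>- 2\<sigma>|z|\<^sup>2 - (2\<beta> - K)\<xi>\<^sup>2 + 2\<alpha>\<xi>u(1) - Ku(1)\<^sup>2\<close>. Since \<open>2\<alpha>\<xi>u(1) \<le> \<alpha>(\<xi>\<^sup>2 + u(1)\<^sup>2)\<close>, the condition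
  \<open>\<alpha> < K < 2\<beta> - \<alpha>\<close> is what makes this a negative multiple of \<open>P = |z|\<^sup>2 + \<xi>\<^sup>2 + u(1)\<^sup>2\<close>
  (\<open>energy_dissipation\<close>). Dissipation of \<open>y\<^sub>x\<close>, \<open>u\<close> and \<open>\<eta>\<close> comes from three correction terms
  (\<open>correction_identity\<close>, \<open>correction_dissipation\<close>):

  \<^item> \<open>\<tau> \<integral>(2 - x) u\<^sup>2\<close> has the derivative \<open>2\<xi>\<^sup>2 - u(1)\<^sup>2 - |u|\<^sup>2\<close>, because \<open>u\<close> is transported;

  \<^item> \<open>\<integral>z y + m \<xi> y(0) + M \<eta> y(1)\<close> produces \<open>- \<integral>a y\<^sub>x\<^sup>2\<close>, at the price of \<open>+ M\<eta>\<^sup>2\<close>;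

  \<^item> \<open>- (M\<eta> + \<integral>x z) \<integral>x\<^sup>k y\<^sub>x\<close> produces \<open>- M\<eta>\<^sup>2\<close>. In the derivative of the first factor the
    boundary values of \<open>w\<close> cancel and only \<open>- \<integral>w - \<sigma> \<integral>x z\<close> is left, while the second integral has
    the derivative \<open>\<eta> - k \<integral>x\<^bsup>k-1\<^esup> z\<close>. The remaining error \<open>\<integral>w \<integral>x\<^sup>k y\<^sub>x\<close> is at most a multiple of
    \<open>|x\<^sup>k| |y\<^sub>x|\<^sup>2\<close>, which is small for large \<open>k\<close>.

  As the damping acts in the whole interior, all of \<open>z\<close> is dissipated by the energy. The further cross
  terms contain \<open>z\<close>, \<open>\<xi>\<close> or \<open>u(1)\<close> and are absorbed by a large multiple of the energy. The constraint \<open>J = 0\<close> excludes the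
  equilibria \<open>y = const\<close>: for \<open>J = 0\<close> the equivalence of norms bounds the whole state, including \<open>y\<close>
  itself, by \<open>|y\<^sub>x|\<^sup>2 + |z|\<^sup>2 + |u|\<^sup>2 + \<xi>\<^sup>2 + \<eta>\<^sup>2\<close>.

  That such a corrected form implies exponential decay holds for contraction semigroups in general
  (\<open>contraction_semigroup_exponential_decay_perturbed\<close>). The passage from the domain to the
  whole space uses that the domain is dense (\<open>D0_dense\<close>).

  The calculus behind this rests on the fact that the elements of $H^1(0,1)$ are exactly the functions
  \<open>c + \<integral>\<^sub>0\<^sup>x g\<close> with \<open>g\<close> in $L^2(0,1)$ (\<open>has_weak_deriv_ac\<close> and \<open>has_weak_deriv_imp_ac\<close>), for which
  point values, products and integration by parts are explicit.
\<close>

section \<open>Representatives of classes in $L^2(0,1)$\<close>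

lemma sets_leb01 [simp]: "{0<..<1::real} \<in> sets lebesgue"
  by simp

lemma finite_measure_leb01: "finite_measure leb01"
  by (rule finite_measure_lebesgue_on) simp

lemma measure_leb01: "measure leb01 {0<..<1} = 1"
  by (simp add: measure_restrict_space)

lemma AE_leb01I: "(\<And>x. 0 < x \<Longrightarrow> x < 1 \<Longrightarrow> P x) \<Longrightarrow> AE x in leb01. P x"
  by (rule AE_I2) auto

lemma AE_leb01_not_in:
  assumes "negligible N" shows "AE x in leb01. x \<notin> N"
proof -
  have "AE x in lebesgue. x \<notin> N"
    using assms by (intro AE_not_in) (simp add: negligible_iff_null_sets)
  then show ?thesis
    by (simp add: AE_restrict_space_iff) (auto elim: AE_mp)
qed

lemma bounded_imp_sq_integrable:
  assumes "f \<in> borel_measurable leb01" "\<And>x. 0 < x \<Longrightarrow> x < 1 \<Longrightarrow> \<bar>f x\<bar> \<le> B"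
  shows "sq_integrable f"
  unfolding sq_integrable_def
proof
  show "integrable leb01 (\<lambda>x. (f x)\<^sup>2)"
  proof (rule finite_measure.integrable_const_bound[OF finite_measure_leb01, of _ "B\<^sup>2"])
    show "AE x in leb01. norm ((f x)\<^sup>2) \<le> B\<^sup>2"
    proof (rule AE_leb01I)
      fix x :: real assume "0 < x" "x < 1"
      then have "\<bar>f x\<bar>\<^sup>2 \<le> B\<^sup>2" using assms(2) by (intro power_mono) auto
      then show "norm ((f x)\<^sup>2) \<le> B\<^sup>2" by simp
    qed
  qed (use assms in measurable)
qed (rule assms)

lemma continuous_imp_measurable_leb01:
  fixes f :: "real \<Rightarrow> real"
  shows "continuous_on {0..1} f \<Longrightarrow> f \<in> borel_measurable leb01"
  by (rule continuous_imp_measurable_on_sets_lebesgue)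
    (auto elim: continuous_on_subset)

lemma continuous_bounded01:
  fixes f :: "real \<Rightarrow> real"
  assumes "continuous_on {0..1} f"
  obtains B where "\<And>x. 0 \<le> x \<Longrightarrow> x \<le> 1 \<Longrightarrow> \<bar>f x\<bar> \<le> B" "B > 0"
proof -
  have "bounded (f ` {0..1})"
    using assms by (intro compact_imp_bounded compact_continuous_image) auto
  then obtain B where "B > 0" "\<forall>y\<in>f ` {0..1}. norm y \<le> B"
    using bounded_pos by blast
  then show ?thesis by (intro that[of B]) auto
qed

lemma continuous_imp_sq_integrable:
  fixes f :: "real \<Rightarrow> real"
  assumes "continuous_on {0..1} f"
  shows "sq_integrable f"
proof -
  obtain B where "\<And>x. 0 \<le> x \<Longrightarrow> x \<le> 1 \<Longrightarrow> \<bar>f x\<bar> \<le> B" "B > 0"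
    using continuous_bounded01[OF assms] by metis
  then show ?thesis
    using continuous_imp_measurable_leb01[OF assms]
    by (intro bounded_imp_sq_integrable[of f B]) auto
qed

lemma sq_integrable_bounded_times:
  assumes f: "sq_integrable f" and g: "g \<in> borel_measurable leb01"
    and B: "\<And>x. 0 < x \<Longrightarrow> x < 1 \<Longrightarrow> \<bar>g x\<bar> \<le> B"
  shows "sq_integrable (\<lambda>x. f x * g x)"
  unfolding sq_integrable_def
proof
  have mf: "f \<in> borel_measurable leb01" using f by (simp add: sq_integrable_def)
  show "(\<lambda>x. f x * g x) \<in> borel_measurable leb01" using mf g by simp
  show "integrable leb01 (\<lambda>x. (f x * g x)\<^sup>2)"
  proof (rule Bochner_Integration.integrable_bound)
    show "integrable leb01 (\<lambda>x. B\<^sup>2 * (f x)\<^sup>2)" using f by (simp add: sq_integrable_def)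
    show "AE x in leb01. norm ((f x * g x)\<^sup>2) \<le> norm (B\<^sup>2 * (f x)\<^sup>2)"
    proof (rule AE_leb01I)
      fix x :: real assume "0 < x" "x < 1"
      then have "\<bar>g x\<bar>\<^sup>2 \<le> B\<^sup>2" using B by (intro power_mono) auto
      then show "norm ((f x * g x)\<^sup>2) \<le> norm (B\<^sup>2 * (f x)\<^sup>2)"
        using mult_right_mono[of "(g x)\<^sup>2" "B\<^sup>2" "(f x)\<^sup>2"] by (simp add: power_mult_distrib mult.commute)
    qed
  qed (use mf g in measurable)
qed

lemma sq_integrable_rep: "sq_integrable (rep_l2 y)"
  using Quotient_rep_reflp[OF Quotient_l2, of y] by (simp add: l2_rel_def)

lemma abs_rep_l2: "abs_l2 (rep_l2 y) = y"
  by (rule Quotient_abs_rep[OF Quotient_l2])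

lemma abs_l2_eqI:
  "sq_integrable f \<Longrightarrow> sq_integrable g \<Longrightarrow> AE x in leb01. f x = g x \<Longrightarrow> abs_l2 f = abs_l2 g"
  by (rule Quotient_rel_abs[OF Quotient_l2]) (simp add: l2_rel_def)

lemma rep_abs_l2:
  assumes "sq_integrable f"
  shows "AE x in leb01. rep_l2 (abs_l2 f) x = f x"
proof -
  have "l2_rel f f" using assms by (simp add: l2_rel_def)
  then have "l2_rel (rep_l2 (abs_l2 f)) f" by (rule Quotient_rep_abs[OF Quotient_l2])
  then show ?thesis by (simp add: l2_rel_def)
qed

lemma l2_eqI: "AE x in leb01. rep_l2 y x = rep_l2 z x \<Longrightarrow> y = z"
  using abs_l2_eqI[OF sq_integrable_rep sq_integrable_rep, of y z] by (simp add: abs_rep_l2)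

lemma l2_cases:
  obtains f where "y = abs_l2 f" "sq_integrable f"
  using abs_rep_l2 sq_integrable_rep by metis

lemma abs_l2_rel_iff: "sq_integrable f \<Longrightarrow> l2_rel f f"
  by (simp add: l2_rel_def)

lemma abs_l2_add: "sq_integrable f \<Longrightarrow> sq_integrable g \<Longrightarrow> abs_l2 f + abs_l2 g = abs_l2 (\<lambda>x. f x + g x)"
  by (intro plus_l2.abs_eq abs_l2_rel_iff)

lemma abs_l2_diff: "sq_integrable f \<Longrightarrow> sq_integrable g \<Longrightarrow> abs_l2 f - abs_l2 g = abs_l2 (\<lambda>x. f x - g x)"
  by (intro minus_l2.abs_eq abs_l2_rel_iff)

lemma abs_l2_scaleR: "sq_integrable f \<Longrightarrow> c *\<^sub>R abs_l2 f = abs_l2 (\<lambda>x. c * f x)"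
  by (intro scaleR_l2.abs_eq abs_l2_rel_iff)

lemma inner_abs_l2: "sq_integrable f \<Longrightarrow> sq_integrable g \<Longrightarrow> abs_l2 f \<bullet> abs_l2 g = (LINT x|leb01. f x * g x)"
  by (intro inner_l2.abs_eq abs_l2_rel_iff)

lemma inner_rep_l2: "y \<bullet> z = (LINT x|leb01. rep_l2 y x * rep_l2 z x)"
  using inner_abs_l2[OF sq_integrable_rep sq_integrable_rep, of y z] by (simp add: abs_rep_l2)

lemma inner_rep_abs_l2:
  "sq_integrable f \<Longrightarrow> y \<bullet> abs_l2 f = (LINT x|leb01. rep_l2 y x * f x)"
  using inner_abs_l2[OF sq_integrable_rep, of f y] by (simp add: abs_rep_l2)

lemma norm_abs_l2_sq: "sq_integrable f \<Longrightarrow> (norm (abs_l2 f))\<^sup>2 = (LINT x|leb01. (f x)\<^sup>2)"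
  unfolding power2_norm_eq_inner by (simp add: inner_abs_l2 power2_eq_square[symmetric])

lemma norm_abs_l2_le:
  assumes f: "sq_integrable f" and B: "\<And>x. 0 < x \<Longrightarrow> x < 1 \<Longrightarrow> \<bar>f x\<bar> \<le> B"
  shows "norm (abs_l2 f) \<le> B"
proof -
  have "0 \<le> \<bar>f (1/2)\<bar>" "\<bar>f (1/2)\<bar> \<le> B" using B by auto
  then have B0: "B \<ge> 0" by linarith
  have "(norm (abs_l2 f))\<^sup>2 \<le> (LINT x|leb01. B\<^sup>2)"
    unfolding norm_abs_l2_sq[OF f]
  proof (rule integral_mono_AE)
    show "integrable leb01 (\<lambda>x. (f x)\<^sup>2)" using f by (simp add: sq_integrable_def)
    show "integrable leb01 (\<lambda>x. B\<^sup>2)" using finite_measure.integrable_const[OF finite_measure_leb01] .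
    show "AE x in leb01. (f x)\<^sup>2 \<le> B\<^sup>2"
      using B by (intro AE_leb01I) (metis abs_ge_zero power2_abs power_mono)
  qed
  also have "\<dots> = B\<^sup>2" by (simp add: measure_leb01)
  finally show ?thesis using B0 by (rule power2_le_imp_le)
qed

definition l2_const :: "real \<Rightarrow> l2" where
  "l2_const c = abs_l2 (\<lambda>x. c)"

lemma sq_integrable_const [simp]: "sq_integrable (\<lambda>x. c)"
  by (rule continuous_imp_sq_integrable) simp

lemma l2_integral_eq_inner: "l2_integral y = y \<bullet> l2_const 1"
proof (cases y rule: l2_cases)
  case (1 f)
  then have "l2_integral y = (LINT x|leb01. f x)"
    by (simp add: l2_integral.abs_eq abs_l2_rel_iff)
  then show ?thesis using 1 by (simp add: l2_const_def inner_abs_l2)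
qed

section \<open>Density of the polynomials in $L^2(0,1)$\<close>

text \<open>Dominated convergence for the squared difference: with a square integrable bound of the
  differences, pointwise convergence becomes convergence in norm. Density of the continuous
  functions, bump functions tending to indicators and the decay of powers are all instances.\<close>

lemma l2_tendsto_dominated:
  assumes f: "sq_integrable f" and F: "\<And>n. sq_integrable (F n)" and w: "sq_integrable w"
    and lim: "AE x in leb01. (\<lambda>n. F n x) \<longlonglongrightarrow> f x"
    and dom: "\<And>n. AE x in leb01. \<bar>F n x - f x\<bar> \<le> w x"
  shows "(\<lambda>n. abs_l2 (F n)) \<longlonglongrightarrow> abs_l2 f"
proof -
  have "(\<lambda>n. LINT x|leb01. (F n x - f x)\<^sup>2) \<longlonglongrightarrow> (LINT x|leb01. 0)"
  proof (rule integral_dominated_convergence)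
    show "integrable leb01 (\<lambda>x. (w x)\<^sup>2)" using w by (simp add: sq_integrable_def)
    show "AE x in leb01. (\<lambda>n. (F n x - f x)\<^sup>2) \<longlonglongrightarrow> 0"
      using lim
    proof eventually_elim
      case (elim x)
      then have "(\<lambda>n. F n x - f x) \<longlonglongrightarrow> f x - f x" by (intro tendsto_diff) auto
      then show ?case using tendsto_power[of _ 0 sequentially 2] by simp
    qed
    show "AE x in leb01. norm ((F n x - f x)\<^sup>2) \<le> (w x)\<^sup>2" for n
      using dom[of n] by eventually_elim (metis abs_ge_zero norm_power power_mono real_norm_def)
  qed (use sq_integrable_diff[OF F f] in \<open>auto simp: sq_integrable_def\<close>)
  then have "(\<lambda>n. (norm (abs_l2 (F n) - abs_l2 f))\<^sup>2) \<longlonglongrightarrow> 0"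
    by (simp add: abs_l2_diff F f norm_abs_l2_sq sq_integrable_diff)
  then have "(\<lambda>n. sqrt ((norm (abs_l2 (F n) - abs_l2 f))\<^sup>2)) \<longlonglongrightarrow> sqrt 0"
    by (rule tendsto_real_sqrt)
  then show ?thesis by (simp add: LIM_zero_cancel tendsto_norm_zero_iff)
qed

text \<open>A Lebesgue measurable function is a pointwise limit of continuous functions outside a null
  set. Clamping these to the bound \<open>B\<close> of the function keeps them continuous and makes the
  convergence dominated.\<close>

lemma bounded_in_closure_continuous:
  assumes f: "f \<in> borel_measurable leb01" and B: "\<And>x. \<bar>f x\<bar> \<le> B"
  shows "abs_l2 f \<in> closure {abs_l2 p |p. continuous_on UNIV p}"
proof -
  have "f measurable_on {0<..<1}"
    using f measurable_on_iff_borel_measurable[OF sets_leb01] by blast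
  then obtain N g where N: "negligible N" and g: "\<And>n. continuous_on UNIV (g n)"
    and lim: "\<And>x. x \<notin> N \<Longrightarrow> (\<lambda>n. g n x) \<longlonglongrightarrow> (if x \<in> {0<..<1} then f x else 0)"
    unfolding measurable_on_def by (metis (no_types))
  define h where "h n x = max (-B) (min B (g n x))" for n x
  have h: "continuous_on UNIV (h n)" for n
    unfolding h_def using g by (intro continuous_intros) auto
  have B0: "B \<ge> 0" using B[of 0] by linarith
  have sqf: "sq_integrable f" using f B by (rule bounded_imp_sq_integrable)
  have sqh: "sq_integrable (h n)" for n
    by (rule continuous_imp_sq_integrable, rule continuous_on_subset[OF h]) simp
  have AEN: "AE x in leb01. x \<notin> N" by (rule AE_leb01_not_in[OF N])
  have "(\<lambda>n. abs_l2 (h n)) \<longlonglongrightarrow> abs_l2 f"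
  proof (rule l2_tendsto_dominated[OF sqf sqh, of "\<lambda>x. 2 * B"])
    show "AE x in leb01. (\<lambda>n. h n x) \<longlonglongrightarrow> f x"
      using AEN AE_space
    proof eventually_elim
      case (elim x)
      then have "(\<lambda>n. g n x) \<longlonglongrightarrow> f x" using lim[of x] by auto
      then have "(\<lambda>n. h n x) \<longlonglongrightarrow> max (-B) (min B (f x))"
        unfolding h_def by (intro tendsto_max tendsto_min tendsto_const)
      also have "max (-B) (min B (f x)) = f x" using B[of x] by (auto simp: max_def min_def)
      finally show ?case .
    qed
    show "AE x in leb01. \<bar>h n x - f x\<bar> \<le> 2 * B" for n
    proof (rule AE_I2)
      fix x show "\<bar>h n x - f x\<bar> \<le> 2 * B" using B[of x] B0 by (auto simp: h_def max_def min_def)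
    qed
  qed simp
  then show ?thesis
    unfolding closure_sequential using h by (intro exI[of _ "\<lambda>n. abs_l2 (h n)"]) auto
qed

text \<open>Truncation reduces the claim to bounded functions.\<close>

lemma continuous_dense_l2: "closure {abs_l2 p |p. continuous_on UNIV p} = (UNIV :: l2 set)"
proof -
  have "y \<in> closure {abs_l2 p |p. continuous_on UNIV p}" for y
  proof (cases y rule: l2_cases)
    case (1 f)
    define F where "F n x = max (- real n) (min (real n) (f x))" for n :: nat and x
    have mf: "f \<in> borel_measurable leb01" using 1 by (simp add: sq_integrable_def)
    have mF: "F n \<in> borel_measurable leb01" for n
      unfolding F_def using mf by measurable
    have BF: "\<bar>F n x\<bar> \<le> real n" for n x by (auto simp: F_def max_def min_def)
    have "(\<lambda>n. abs_l2 (F n)) \<longlonglongrightarrow> abs_l2 f"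
    proof (rule l2_tendsto_dominated[of _ _ "\<lambda>x. \<bar>f x\<bar>"])
      show "AE x in leb01. (\<lambda>n. F n x) \<longlonglongrightarrow> f x"
      proof (rule AE_I2)
        fix x
        have "\<forall>\<^sub>F n in sequentially. F n x = f x"
          using eventually_ge_at_top[of "nat \<lceil>\<bar>f x\<bar>\<rceil>"]
        proof eventually_elim
          case (elim n)
          then have "\<bar>f x\<bar> \<le> real n" by linarith
          then show ?case by (auto simp: F_def max_def min_def)
        qed
        then show "(\<lambda>n. F n x) \<longlonglongrightarrow> f x" by (rule tendsto_eventually)
      qed
      show "AE x in leb01. \<bar>F n x - f x\<bar> \<le> \<bar>f x\<bar>" for n
        by (rule AE_I2) (auto simp: F_def max_def min_def)
      show "sq_integrable (F n)" for n using mF BF by (rule bounded_imp_sq_integrable)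
      show "sq_integrable (\<lambda>x. \<bar>f x\<bar>)" using 1 mf by (simp add: sq_integrable_def borel_measurable_abs)
    qed (rule 1)
    then have "y \<in> closure (closure {abs_l2 p |p. continuous_on UNIV p})"
      unfolding closure_sequential[of y] using bounded_in_closure_continuous[OF mF BF] 1
      by (intro exI[of _ "\<lambda>n. abs_l2 (F n)"]) auto
    then show ?thesis by simp
  qed
  then show ?thesis by blast
qed

lemma polynomial_dense_l2: "closure {abs_l2 p |p. real_polynomial_function p} = (UNIV :: l2 set)"
proof -
  have "abs_l2 f \<in> closure {abs_l2 p |p. real_polynomial_function p}" if "continuous_on UNIV f" for f
  proof (unfold closure_approachable, intro allI impI)
    fix e :: real assume e: "e > 0"
    have cf: "continuous_on {0..1} f" using that by (rule continuous_on_subset) simp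
    then obtain p where p: "real_polynomial_function p" "\<And>x. x \<in> {0..1} \<Longrightarrow> \<bar>f x - p x\<bar> < e/2"
      using Stone_Weierstrass_real_polynomial_function[of "{0..1::real}" f "e/2"] e by auto
    have cp: "continuous_on {0..1} p"
      using p(1) by (simp add: continuous_on_polymonial_function real_polynomial_function_eq)
    have "norm (abs_l2 p - abs_l2 f) \<le> e/2"
      unfolding abs_l2_diff[OF continuous_imp_sq_integrable[OF cp] continuous_imp_sq_integrable[OF cf]]
    proof (rule norm_abs_l2_le)
      fix x :: real assume "0 < x" "x < 1"
      then show "\<bar>p x - f x\<bar> \<le> e/2" using p(2)[of x] by (auto simp: abs_minus_commute)
    qed (intro continuous_imp_sq_integrable continuous_intros cp cf)
    then show "\<exists>y\<in>{abs_l2 p |p. real_polynomial_function p}. dist y (abs_l2 f) < e"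
      using e p(1) by (intro bexI[of _ "abs_l2 p"]) (auto simp: dist_norm)
  qed
  then have "closure {abs_l2 p |p. continuous_on UNIV p} \<subseteq> closure {abs_l2 p |p. real_polynomial_function p}"
    by (intro closure_minimal) auto
  then show ?thesis unfolding continuous_dense_l2 by blast
qed

section \<open>Primitives of square integrable functions\<close>

text \<open>The indefinite integral is an inner product with an indicator function. This makes it linear
  and continuous in the integrand by construction, and the continuity in the end point is that
  of the curve \<open>l2_step\<close> in $L^2(0,1)$.\<close>

definition l2_step :: "real \<Rightarrow> l2" where
  "l2_step x = abs_l2 (indicator {..x})"

definition prim :: "l2 \<Rightarrow> real \<Rightarrow> real" where
  "prim g x = g \<bullet> l2_step x"

lemma measurable_indicator_atMost [measurable]: "(indicator {..x} :: real \<Rightarrow> real) \<in> borel_measurable leb01"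
  by (rule measurable_restrict_space1, rule borel_measurable_indicator) simp

lemma sq_integrable_indicator: "sq_integrable (indicator {..x})"
  by (rule bounded_imp_sq_integrable[of _ 1]) (auto simp: indicator_def)

lemma norm_l2_step_le: "norm (l2_step x) \<le> 1"
  unfolding l2_step_def by (rule norm_abs_l2_le[OF sq_integrable_indicator]) (auto simp: indicator_def)

lemma abs_prim_le: "\<bar>prim g x\<bar> \<le> norm g"
proof -
  have "\<bar>prim g x\<bar> \<le> norm g * norm (l2_step x)"
    unfolding prim_def by (rule Cauchy_Schwarz_ineq2)
  also have "\<dots> \<le> norm g" using norm_l2_step_le[of x] by (simp add: mult_left_le)
  finally show ?thesis .
qed

lemma prim_add: "prim (g + h) x = prim g x + prim h x"
  and prim_diff: "prim (g - h) x = prim g x - prim h x"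
  and prim_scaleR: "prim (c *\<^sub>R g) x = c * prim g x"
  by (simp_all add: prim_def inner_simps)

lemma prim_zero: "prim 0 x = 0"
  by (simp add: prim_def)

lemma l2_step_0: "l2_step 0 = 0"
proof -
  have "l2_step 0 = abs_l2 (\<lambda>x. 0)"
    unfolding l2_step_def
    by (rule abs_l2_eqI[OF sq_integrable_indicator sq_integrable_zero], rule AE_leb01I) auto
  then show ?thesis by (simp add: zero_l2_def)
qed

lemma prim_at_0 [simp]: "prim g 0 = 0"
  by (simp add: prim_def l2_step_0)

lemma l2_step_1: "l2_step 1 = l2_const 1"
  unfolding l2_step_def l2_const_def
  by (rule abs_l2_eqI[OF sq_integrable_indicator sq_integrable_const], rule AE_leb01I) auto

lemma prim_at_1: "prim g 1 = g \<bullet> l2_const 1"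
  by (simp add: prim_def l2_step_1)

text \<open>The fundamental theorem of calculus for the gauge integral, restated for the Lebesgue integral
  on the open unit interval. It is the only place where the two integrals meet.\<close>

lemma integral_leb01_antiderivative:
  assumes F: "\<And>x. 0 \<le> x \<Longrightarrow> x \<le> 1 \<Longrightarrow> (F has_real_derivative f x) (at x within {0..1})"
    and f: "continuous_on {0..1} f" and x: "0 \<le> x" "x \<le> 1"
  shows "(LINT s|leb01. f s * indicator {..x} s) = F x - F 0"
proof -
  have "integrable leb01 (\<lambda>s. f s * indicator {..x} s)"
    by (rule sq_integrable_times[OF continuous_imp_sq_integrable[OF f] sq_integrable_indicator])
  then have 1: "((\<lambda>s. f s * indicator {..x} s) has_integral (LINT s|leb01. f s * indicator {..x} s)) {0<..<1}"
    by (rule has_integral_integral_lebesgue_on) simp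
  have "(f has_integral (F x - F 0)) {0..x}"
  proof (rule fundamental_theorem_of_calculus)
    fix s assume "s \<in> {0..x}"
    then have "(F has_real_derivative f s) (at s within {0..1})" using F x by auto
    then show "(F has_vector_derivative f s) (at s within {0..x})"
      unfolding has_real_derivative_iff_has_vector_derivative
      by (rule has_vector_derivative_within_subset) (use x in auto)
  qed (use x in auto)
  then have "((\<lambda>s. if s \<in> {0..x} then f s else 0) has_integral (F x - F 0)) {0..1}"
    using x by (subst has_integral_restrict) auto
  moreover have "(if s \<in> {0..x} then f s else 0) = f s * indicator {..x} s" if "s \<in> {0..1}" for s
    using that by (auto simp: indicator_def)
  ultimately have "((\<lambda>s. f s * indicator {..x} s) has_integral (F x - F 0)) {0..1}"
    by (rule has_integral_eq[rotated]) simp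
  then have "((\<lambda>s. f s * indicator {..x} s) has_integral (F x - F 0)) {0<..<1}"
    by (simp add: has_integral_Icc_iff_Ioo)
  then show ?thesis using 1 has_integral_unique by blast
qed

lemma prim_abs_l2_antiderivative:
  assumes "\<And>x. 0 \<le> x \<Longrightarrow> x \<le> 1 \<Longrightarrow> (F has_real_derivative f x) (at x within {0..1})"
    and "continuous_on {0..1} f" and "0 \<le> x" "x \<le> 1"
  shows "prim (abs_l2 f) x = F x - F 0"
  unfolding prim_def l2_step_def
    inner_abs_l2[OF continuous_imp_sq_integrable[OF assms(2)] sq_integrable_indicator]
  using assms by (rule integral_leb01_antiderivative)

lemma norm_l2_step_diff_sq:
  assumes "0 \<le> s" "s \<le> t" "t \<le> 1"
  shows "(norm (l2_step t - l2_step s))\<^sup>2 = t - s"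
proof -
  have I: "(LINT r|leb01. indicator {..x} r) = x" if "0 \<le> x" "x \<le> 1" for x :: real
    using integral_leb01_antiderivative[of "\<lambda>x. x" "\<lambda>x. 1" x] that by (auto intro!: derivative_eq_intros)
  have int: "integrable leb01 (indicator {..x} :: real \<Rightarrow> real)" for x
    using sq_integrable_times[OF sq_integrable_indicator sq_integrable_const, of x 1] by simp
  have "(norm (l2_step t - l2_step s))\<^sup>2 = (LINT r|leb01. (indicator {..t} r - indicator {..s} r)\<^sup>2)"
    unfolding l2_step_def abs_l2_diff[OF sq_integrable_indicator sq_integrable_indicator]
    by (rule norm_abs_l2_sq) (intro sq_integrable_diff sq_integrable_indicator)
  also have "\<dots> = (LINT r|leb01. indicator {..t} r - indicator {..s} r)"
    using assms by (intro Bochner_Integration.integral_cong) (auto simp: indicator_def)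
  also have "\<dots> = t - s" using I[of t] I[of s] assms int by simp
  finally show ?thesis .
qed

lemma continuous_on_l2_step: "continuous_on {0..1} l2_step"
proof -
  have le: "dist (l2_step s) (l2_step t) \<le> sqrt \<bar>s - t\<bar>" if "s \<in> {0..1}" "t \<in> {0..1}" for s t
  proof -
    have "(norm (l2_step s - l2_step t))\<^sup>2 = \<bar>s - t\<bar>"
    proof (cases "s \<le> t")
      case True
      then show ?thesis using norm_l2_step_diff_sq[of s t] that by (simp add: norm_minus_commute)
    next
      case False
      then show ?thesis using norm_l2_step_diff_sq[of t s] that by simp
    qed
    then show ?thesis unfolding dist_norm by (intro real_le_rsqrt) simp
  qed
  show ?thesis
    unfolding continuous_on_iff
  proof (intro ballI allI impI)
    fix s e :: real assume s: "s \<in> {0..1}" and e: "e > 0"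
    show "\<exists>d>0. \<forall>t\<in>{0..1}. dist t s < d \<longrightarrow> dist (l2_step t) (l2_step s) < e"
    proof (intro exI[of _ "e\<^sup>2"] conjI ballI impI)
      fix t :: real assume t: "t \<in> {0..1}" "dist t s < e\<^sup>2"
      have "dist (l2_step t) (l2_step s) \<le> sqrt \<bar>t - s\<bar>" using le s t by simp
      also have "\<dots> < e" using t e by (intro real_less_lsqrt) (auto simp: dist_real_def)
      finally show "dist (l2_step t) (l2_step s) < e" .
    qed (use e in simp)
  qed
qed

lemma continuous_on_prim: "continuous_on {0..1} (prim g)"
  unfolding prim_def[abs_def] by (intro continuous_intros continuous_on_l2_step)

lemma sq_integrable_prim: "sq_integrable (prim g)"
  by (rule continuous_imp_sq_integrable[OF continuous_on_prim])

lemma measurable_prim [measurable]: "prim g \<in> borel_measurable leb01"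
  using sq_integrable_prim by (simp add: sq_integrable_def)

section \<open>Multiplication by a bounded class\<close>

text \<open>The pointwise product of two classes is only meaningful if it is square integrable again;
  an essential bound of the first factor guarantees this.\<close>

definition ess_bounded :: "l2 \<Rightarrow> real \<Rightarrow> bool" where
  "ess_bounded f B \<longleftrightarrow> (AE x in leb01. \<bar>rep_l2 f x\<bar> \<le> B)"

lemma measurable_rep_l2 [measurable]: "rep_l2 f \<in> borel_measurable leb01"
  using sq_integrable_rep by (simp add: sq_integrable_def)

lemma rep_l2_add: "AE x in leb01. rep_l2 (f + g) x = rep_l2 f x + rep_l2 g x"
  using rep_abs_l2[OF sq_integrable_add[OF sq_integrable_rep sq_integrable_rep], of f g]
  by (simp add: abs_l2_add[OF sq_integrable_rep sq_integrable_rep, symmetric] abs_rep_l2)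

lemma rep_l2_scaleR: "AE x in leb01. rep_l2 (c *\<^sub>R f) x = c * rep_l2 f x"
  using rep_abs_l2[OF sq_integrable_scale[OF sq_integrable_rep], of c f]
  by (simp add: abs_l2_scaleR[OF sq_integrable_rep, symmetric] abs_rep_l2)

lemma ess_bounded_imp_sq_integrable_times:
  assumes "ess_bounded f B"
  shows "sq_integrable (\<lambda>x. rep_l2 f x * rep_l2 g x)"
  unfolding sq_integrable_def
proof
  show "integrable leb01 (\<lambda>x. (rep_l2 f x * rep_l2 g x)\<^sup>2)"
  proof (rule Bochner_Integration.integrable_bound)
    show "integrable leb01 (\<lambda>x. B\<^sup>2 * (rep_l2 g x)\<^sup>2)"
      using sq_integrable_rep[of g] by (simp add: sq_integrable_def)
    show "AE x in leb01. norm ((rep_l2 f x * rep_l2 g x)\<^sup>2) \<le> norm (B\<^sup>2 * (rep_l2 g x)\<^sup>2)"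
      using assms unfolding ess_bounded_def
    proof eventually_elim
      case (elim x)
      then have "\<bar>rep_l2 f x\<bar>\<^sup>2 \<le> B\<^sup>2" by (intro power_mono) auto
      then have "(rep_l2 f x)\<^sup>2 * (rep_l2 g x)\<^sup>2 \<le> B\<^sup>2 * (rep_l2 g x)\<^sup>2"
        by (intro mult_right_mono) auto
      then show ?case by (simp add: power_mult_distrib)
    qed
  qed measurable
qed measurable

lemma rep_l2_times:
  "ess_bounded f B \<Longrightarrow> AE x in leb01. rep_l2 (f \<odot> g) x = rep_l2 f x * rep_l2 g x"
  unfolding l2_times_def by (rule rep_abs_l2, rule ess_bounded_imp_sq_integrable_times)

lemma inner_l2_times:
  "ess_bounded f B \<Longrightarrow> (f \<odot> g) \<bullet> h = (LINT x|leb01. rep_l2 f x * rep_l2 g x * rep_l2 h x)"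
  unfolding l2_times_def
  by (subst inner_commute)
    (simp add: inner_rep_abs_l2 ess_bounded_imp_sq_integrable_times mult.commute)

lemma l2_times_selfadjoint: "ess_bounded f B \<Longrightarrow> (f \<odot> g) \<bullet> h = (f \<odot> h) \<bullet> g"
  by (simp add: inner_l2_times ac_simps)

lemma l2_times_add_right:
  assumes "ess_bounded f B" shows "f \<odot> (g + h) = f \<odot> g + f \<odot> h"
proof (rule l2_eqI)
  show "AE x in leb01. rep_l2 (f \<odot> (g + h)) x = rep_l2 (f \<odot> g + f \<odot> h) x"
    using rep_l2_times[OF assms, of "g+h"] rep_l2_times[OF assms, of g] rep_l2_times[OF assms, of h]
      rep_l2_add[of g h] rep_l2_add[of "f \<odot> g" "f \<odot> h"]
    by eventually_elim (simp add: distrib_left)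
qed

lemma l2_times_scaleR_right:
  assumes "ess_bounded f B" shows "f \<odot> (c *\<^sub>R g) = c *\<^sub>R (f \<odot> g)"
proof (rule l2_eqI)
  show "AE x in leb01. rep_l2 (f \<odot> (c *\<^sub>R g)) x = rep_l2 (c *\<^sub>R (f \<odot> g)) x"
    using rep_l2_times[OF assms, of "c *\<^sub>R g"] rep_l2_times[OF assms, of g]
      rep_l2_scaleR[of c g] rep_l2_scaleR[of c "f \<odot> g"]
    by eventually_elim simp
qed

lemma norm_l2_times_le:
  assumes "ess_bounded f B" "B \<ge> 0"
  shows "norm (f \<odot> g) \<le> B * norm g"
proof (rule power2_le_imp_le)
  have "(norm (f \<odot> g))\<^sup>2 = (LINT x|leb01. (rep_l2 f x * rep_l2 g x)\<^sup>2)"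
    unfolding l2_times_def by (rule norm_abs_l2_sq[OF ess_bounded_imp_sq_integrable_times[OF assms(1)]])
  also have "\<dots> \<le> (LINT x|leb01. B\<^sup>2 * (rep_l2 g x)\<^sup>2)"
  proof (rule integral_mono_AE)
    show "integrable leb01 (\<lambda>x. (rep_l2 f x * rep_l2 g x)\<^sup>2)"
      using ess_bounded_imp_sq_integrable_times[OF assms(1)] by (simp add: sq_integrable_def)
    show "integrable leb01 (\<lambda>x. B\<^sup>2 * (rep_l2 g x)\<^sup>2)"
      using sq_integrable_rep[of g] by (simp add: sq_integrable_def)
    show "AE x in leb01. (rep_l2 f x * rep_l2 g x)\<^sup>2 \<le> B\<^sup>2 * (rep_l2 g x)\<^sup>2"
      using assms(1) unfolding ess_bounded_def
    proof eventually_elim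
      case (elim x)
      then have "\<bar>rep_l2 f x\<bar>\<^sup>2 \<le> B\<^sup>2" by (intro power_mono) auto
      then have "(rep_l2 f x)\<^sup>2 * (rep_l2 g x)\<^sup>2 \<le> B\<^sup>2 * (rep_l2 g x)\<^sup>2"
        by (intro mult_right_mono) auto
      then show ?case by (simp add: power_mult_distrib)
    qed
  qed
  also have "\<dots> = B\<^sup>2 * (norm g)\<^sup>2"
    using norm_abs_l2_sq[OF sq_integrable_rep[of g]] by (simp add: abs_rep_l2)
  finally show "(norm (f \<odot> g))\<^sup>2 \<le> (B * norm g)\<^sup>2" by (simp add: power_mult_distrib)
qed (use assms in simp)

text \<open>For the stiffness \<open>a \<ge> a\<^sub>0\<close> this is the lower bound of the elastic energy.\<close>

lemma l2_times_coercive: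
  assumes "ess_bounded f B" "AE x in leb01. b \<le> rep_l2 f x"
  shows "b * (norm g)\<^sup>2 \<le> (f \<odot> g) \<bullet> g"
proof -
  have "b * (norm g)\<^sup>2 = (LINT x|leb01. b * (rep_l2 g x)\<^sup>2)"
    using norm_abs_l2_sq[OF sq_integrable_rep[of g]] by (simp add: abs_rep_l2)
  also have "\<dots> \<le> (LINT x|leb01. rep_l2 f x * rep_l2 g x * rep_l2 g x)"
  proof (rule integral_mono_AE)
    show "integrable leb01 (\<lambda>x. b * (rep_l2 g x)\<^sup>2)"
      using sq_integrable_rep[of g] by (simp add: sq_integrable_def)
    show "integrable leb01 (\<lambda>x. rep_l2 f x * rep_l2 g x * rep_l2 g x)"
      by (rule sq_integrable_times[OF ess_bounded_imp_sq_integrable_times[OF assms(1)] sq_integrable_rep])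
    show "AE x in leb01. b * (rep_l2 g x)\<^sup>2 \<le> rep_l2 f x * rep_l2 g x * rep_l2 g x"
      using assms(2) by eventually_elim (simp add: power2_eq_square mult.assoc mult_right_mono)
  qed
  finally show ?thesis by (simp add: inner_l2_times[OF assms(1)])
qed

section \<open>Absolutely continuous functions and the product rule\<close>

text \<open>The absolutely continuous function with value \<open>c\<close> at \<open>0\<close> and derivative \<open>g\<close>, as a class.\<close>

definition ac :: "real \<Rightarrow> l2 \<Rightarrow> l2" where
  "ac c g = abs_l2 (\<lambda>x. c + prim g x)"

lemma sq_integrable_ac: "sq_integrable (\<lambda>x. c + prim g x)"
  by (intro sq_integrable_add sq_integrable_const sq_integrable_prim)

lemma rep_ac: "AE x in leb01. rep_l2 (ac c g) x = c + prim g x"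
  unfolding ac_def by (rule rep_abs_l2[OF sq_integrable_ac])

lemma ac_add: "ac c g + ac d h = ac (c + d) (g + h)"
  unfolding ac_def by (simp add: abs_l2_add[OF sq_integrable_ac sq_integrable_ac] prim_add algebra_simps)

lemma ac_scaleR: "k *\<^sub>R ac c g = ac (k * c) (k *\<^sub>R g)"
  unfolding ac_def by (simp add: abs_l2_scaleR[OF sq_integrable_ac] prim_scaleR algebra_simps)

lemma ac_diff: "ac c g - ac d h = ac (c - d) (g - h)"
  unfolding ac_def by (simp add: abs_l2_diff[OF sq_integrable_ac sq_integrable_ac] prim_diff algebra_simps)

lemma ac_const: "ac c 0 = l2_const c"
  by (simp add: ac_def l2_const_def prim_zero)

lemma norm_ac_le: "norm (ac c g) \<le> \<bar>c\<bar> + norm g"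
  unfolding ac_def
  by (rule norm_abs_l2_le[OF sq_integrable_ac]) (use abs_prim_le[of g] in \<open>auto intro: order_trans[OF abs_triangle_ineq]\<close>)

lemma ess_bounded_ac: "ess_bounded (ac c g) (\<bar>c\<bar> + norm g)"
  unfolding ess_bounded_def using rep_ac[of c g]
proof eventually_elim
  case (elim x)
  then show ?case using abs_prim_le[of g x] abs_triangle_ineq[of c "prim g x"] by simp
qed

text \<open>The primitive of \<open>g\<close>, cut off at \<open>x\<close>: the second factor of \<open>\<integral>\<^sub>0\<^sup>x h(s) G(s) ds\<close> when this is
  written as an inner product with \<open>h\<close>.\<close>

definition cut_prim :: "real \<Rightarrow> l2 \<Rightarrow> l2" where
  "cut_prim x g = abs_l2 (\<lambda>s. prim g s * indicator {..x} s)"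

lemma sq_integrable_cut_prim: "sq_integrable (\<lambda>s. prim g s * indicator {..x} s)"
  by (rule sq_integrable_bounded_times[OF sq_integrable_prim measurable_indicator_atMost, of _ 1])
    (auto simp: indicator_def)

lemma bounded_linear_cut_prim: "bounded_linear (cut_prim x)"
proof (rule bounded_linear_intro[where K=1])
  fix g h :: l2 and c :: real
  show "cut_prim x (g + h) = cut_prim x g + cut_prim x h"
    unfolding cut_prim_def
    by (simp add: abs_l2_add[OF sq_integrable_cut_prim sq_integrable_cut_prim] prim_add distrib_right)
  show "cut_prim x (c *\<^sub>R g) = c *\<^sub>R cut_prim x g"
    unfolding cut_prim_def
    by (simp add: abs_l2_scaleR[OF sq_integrable_cut_prim] prim_scaleR mult.assoc)
  show "norm (cut_prim x g) \<le> norm g * 1"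
    unfolding cut_prim_def
    by (rule norm_abs_l2_le[OF sq_integrable_cut_prim]) (use abs_prim_le[of g] in \<open>auto simp: indicator_def\<close>)
qed

text \<open>For continuous integrands the primitives are continuously differentiable, and the product rule
  is the classical one.\<close>

lemma prim_times_prim_continuous:
  assumes p: "continuous_on UNIV p" and q: "continuous_on UNIV q" and x: "0 \<le> x" "x \<le> 1"
  shows "prim (abs_l2 p) x * prim (abs_l2 q) x
    = abs_l2 p \<bullet> cut_prim x (abs_l2 q) + abs_l2 q \<bullet> cut_prim x (abs_l2 p)"
proof -
  have p': "continuous_on {0..1} p" and q': "continuous_on {0..1} q"
    using p q by (auto elim: continuous_on_subset)
  obtain P where P0: "\<And>s. s \<in> {0..1} \<Longrightarrow> (P has_vector_derivative p s) (at s within {0..1})"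
    using antiderivative_continuous[OF p'] by blast
  obtain Q where Q0: "\<And>s. s \<in> {0..1} \<Longrightarrow> (Q has_vector_derivative q s) (at s within {0..1})"
    using antiderivative_continuous[OF q'] by blast
  have P: "(P has_real_derivative p s) (at s within {0..1})"
    and Q: "(Q has_real_derivative q s) (at s within {0..1})" if "0 \<le> s" "s \<le> 1" for s
    using P0[of s] Q0[of s] that by (auto simp: has_real_derivative_iff_has_vector_derivative)
  have pP: "prim (abs_l2 p) s = P s - P 0" and qQ: "prim (abs_l2 q) s = Q s - Q 0" if "0 \<le> s" "s \<le> 1" for s
    using prim_abs_l2_antiderivative[OF P p'] prim_abs_l2_antiderivative[OF Q q'] that by auto
  have cP: "continuous_on {0..1} P" and cQ: "continuous_on {0..1} Q"
    using P Q by (auto intro!: DERIV_continuous_on)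
  let ?r = "\<lambda>s. p s * (Q s - Q 0) + q s * (P s - P 0)"
  have cr: "continuous_on {0..1} ?r" by (intro continuous_intros p' q' cP cQ)
  have "(LINT s|leb01. ?r s * indicator {..x} s) = (P x - P 0) * (Q x - Q 0) - (P 0 - P 0) * (Q 0 - Q 0)"
    by (rule integral_leb01_antiderivative[OF _ cr x]) (auto intro!: derivative_eq_intros P Q)
  moreover have "(LINT s|leb01. ?r s * indicator {..x} s)
     = (LINT s|leb01. p s * (prim (abs_l2 q) s * indicator {..x} s) + q s * (prim (abs_l2 p) s * indicator {..x} s))"
    by (intro Bochner_Integration.integral_cong) (auto simp: pP qQ algebra_simps)
  moreover have "\<dots> = abs_l2 p \<bullet> cut_prim x (abs_l2 q) + abs_l2 q \<bullet> cut_prim x (abs_l2 p)"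
    unfolding cut_prim_def
    by (simp add: inner_abs_l2 continuous_imp_sq_integrable p' q' sq_integrable_cut_prim sq_integrable_times)
  ultimately show ?thesis using x by (simp add: pP qQ)
qed

lemma l2_eq_on_continuous:
  fixes F G :: "l2 \<Rightarrow> real"
  assumes "continuous_on UNIV F" "continuous_on UNIV G"
    and "\<And>p. continuous_on UNIV p \<Longrightarrow> F (abs_l2 p) = G (abs_l2 p)"
  shows "F g = G g"
proof -
  have "closed {g. F g = G g}" using assms by (intro closed_Collect_eq)
  then have "closure {abs_l2 p |p. continuous_on UNIV p} \<subseteq> {g. F g = G g}"
    using assms(3) by (intro closure_minimal) auto
  then show ?thesis unfolding continuous_dense_l2 by auto
qed

text \<open>Both sides are continuous in each of the integrands, so density of the continuous functions
  extends the classical rule, one argument at a time. Thus integration by parts is available although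
  primitives of $L^2$ functions need not be differentiable everywhere.\<close>

lemma prim_times_prim:
  assumes x: "0 \<le> x" "x \<le> 1"
  shows "prim g x * prim h x = g \<bullet> cut_prim x h + h \<bullet> cut_prim x g"
proof -
  have c: "continuous_on UNIV (cut_prim x)"
    using bounded_linear_cut_prim by (rule linear_continuous_on)
  have cp: "continuous_on UNIV (\<lambda>g. prim g x)"
    unfolding prim_def by (intro continuous_intros)
  have 1: "prim (abs_l2 p) x * prim h x = abs_l2 p \<bullet> cut_prim x h + h \<bullet> cut_prim x (abs_l2 p)"
    if "continuous_on UNIV p" for p
    by (rule l2_eq_on_continuous[where g=h])
      (intro continuous_intros c cp prim_times_prim_continuous that x)+
  show ?thesis
    by (rule l2_eq_on_continuous[where g=g]) (intro continuous_intros c cp 1)+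
qed

lemma prim_ac_times:
  assumes x: "0 \<le> x" "x \<le> 1"
  shows "prim (ac c g \<odot> h) x = c * prim h x + h \<bullet> cut_prim x g"
proof -
  have "prim (ac c g \<odot> h) x = (LINT s|leb01. rep_l2 (ac c g \<odot> h) s * indicator {..x} s)"
    unfolding prim_def l2_step_def by (rule inner_rep_abs_l2[OF sq_integrable_indicator])
  also have "\<dots> = (LINT s|leb01. c * (rep_l2 h s * indicator {..x} s) + rep_l2 h s * (prim g s * indicator {..x} s))"
  proof (rule integral_cong_AE)
    show "AE s in leb01. rep_l2 (ac c g \<odot> h) s * indicator {..x} s
      = c * (rep_l2 h s * indicator {..x} s) + rep_l2 h s * (prim g s * indicator {..x} s)"
      using rep_l2_times[OF ess_bounded_ac[of c g], of h] rep_ac[of c g]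
      by eventually_elim (simp add: algebra_simps)
  qed (intro borel_measurable_add borel_measurable_times borel_measurable_const measurable_rep_l2
      measurable_indicator_atMost measurable_prim)+
  also have "\<dots> = c * prim h x + h \<bullet> cut_prim x g"
  proof -
    have 1: "prim h x = (LINT s|leb01. rep_l2 h s * indicator {..x} s)"
      unfolding prim_def l2_step_def by (rule inner_rep_abs_l2[OF sq_integrable_indicator])
    have 2: "h \<bullet> cut_prim x g = (LINT s|leb01. rep_l2 h s * (prim g s * indicator {..x} s))"
      unfolding cut_prim_def by (rule inner_rep_abs_l2[OF sq_integrable_cut_prim])
    show ?thesis unfolding 1 2
      by (simp add: sq_integrable_times sq_integrable_rep sq_integrable_indicator sq_integrable_cut_prim)
  qed
  finally show ?thesis .
qed

lemma prim_product:
  assumes x: "0 \<le> x" "x \<le> 1"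
  shows "(c + prim g x) * (d + prim h x) = c * d + prim (ac c g \<odot> h + ac d h \<odot> g) x"
  using prim_times_prim[OF x, of g h] by (simp add: prim_add prim_ac_times[OF x] algebra_simps)

text \<open>The product rule in the form that shows products of absolutely continuous functions with square
  integrable derivatives to be of the same kind.\<close>

lemma ac_times_ac: "ac c g \<odot> ac d h = ac (c * d) (ac c g \<odot> h + ac d h \<odot> g)"
proof (rule l2_eqI)
  show "AE x in leb01. rep_l2 (ac c g \<odot> ac d h) x = rep_l2 (ac (c * d) (ac c g \<odot> h + ac d h \<odot> g)) x"
    using rep_l2_times[OF ess_bounded_ac[of c g], of "ac d h"] rep_ac[of c g] rep_ac[of d h]
      rep_ac[of "c * d" "ac c g \<odot> h + ac d h \<odot> g"] AE_space
    by eventually_elim (simp add: prim_product)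
qed

lemma l2_times_const_1: "ess_bounded f B \<Longrightarrow> (f \<odot> g) \<bullet> l2_const 1 = f \<bullet> g"
  unfolding l2_const_def
  by (simp add: inner_rep_l2[of f g] inner_rep_abs_l2, rule integral_cong_AE) (auto dest: rep_l2_times)

lemma integration_by_parts_l2:
  "ac c g \<bullet> h + ac d h \<bullet> g = (c + prim g 1) * (d + prim h 1) - c * d"
  using prim_product[of 1 c g d h]
  by (simp add: prim_at_1 inner_add_left l2_times_const_1[OF ess_bounded_ac])

section \<open>Smooth bump functions\<close>

text \<open>A class of functions of the form \<open>p / t\<^sup>n exp(- c / t)\<close>, extended by zero to where the
  polynomial \<open>t\<close> is not positive. It contains the bump functions and is closed under
  differentiation, which yields all derivatives at once.\<close>

definition flat_exp :: "real poly \<Rightarrow> real \<Rightarrow> real poly \<Rightarrow> nat \<Rightarrow> real \<Rightarrow> real" where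
  "flat_exp t c p n x = (if poly t x > 0 then poly p x / poly t x ^ n * exp (- c / poly t x) else 0)"

text \<open>The exponential beats every negative power of \<open>u\<close>, with a factor \<open>u\<^sup>2\<close> to spare. The factor
  makes the derivative of \<open>flat_exp\<close> vanish at the zeros of \<open>t\<close>.\<close>

lemma exp_neg_inverse_le:
  assumes u: "u > 0" and c: "(c::real) > 0"
  shows "exp (- c / u) / u ^ n \<le> ((n + 2) / c) ^ (n + 2) * u\<^sup>2"
proof -
  let ?N = "n + 2"
  have "(c / u / ?N) ^ ?N \<le> (1 + c / u / ?N) ^ ?N"
    using u c by (intro power_mono) auto
  also have "\<dots> \<le> exp (c / u)"
  proof (rule exp_ge_one_plus_x_over_n_power_n)
    have "0 \<le> c / u" using u c by simp
    then show "- real ?N \<le> c / u" by linarith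
  qed simp
  finally have "inverse (exp (c / u)) \<le> inverse ((c / u / ?N) ^ ?N)"
    using u c by (intro le_imp_inverse_le) auto
  also have "inverse ((c / u / ?N) ^ ?N) = (?N / c) ^ ?N * u ^ ?N"
  proof -
    have "inverse (c / u / ?N) = ?N / c * u" using u c by simp
    then show ?thesis by (metis power_inverse power_mult_distrib)
  qed
  finally have le: "inverse (exp (c / u)) \<le> (?N / c) ^ ?N * u ^ ?N" .
  have e: "exp (- c / u) = inverse (exp (c / u))" by (metis exp_minus minus_divide_left)
  have p: "u ^ ?N = u\<^sup>2 * u ^ n" by (simp only: power_add mult.commute)
  show ?thesis using le u unfolding e p by (simp only: divide_le_eq zero_less_power mult.assoc) simp
qed

text \<open>The numerator of the derivative is written over the common denominator \<open>t\<^bsup>n+2\<^esup>\<close>. At a zero of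
  \<open>t\<close> the function is bounded by a multiple of \<open>t\<^sup>2\<close>, hence its derivative is zero there, whatever
  the multiplicity of the zero.\<close>

lemma DERIV_flat_exp:
  assumes c: "c > 0"
  shows "(flat_exp t c p n has_real_derivative
    flat_exp t c (pderiv p * t * t - smult (real n) (p * pderiv t * t) + smult c (p * pderiv t)) (n + 2) x) (at x)"
    (is "(_ has_real_derivative flat_exp t c ?q _ x) _")
proof -
  have cont: "isCont (poly t) x" by simp
  consider (pos) "poly t x > 0" | (neg) "poly t x < 0" | (zero) "poly t x = 0" by linarith
  then show ?thesis
  proof cases
    case pos
    let ?f = "\<lambda>x. poly p x / poly t x ^ n * exp (- c / poly t x)"
    have "(?f has_real_derivative flat_exp t c ?q (n + 2) x) (at x)"
      using pos
      by (auto intro!: derivative_eq_intros simp: flat_exp_def)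
        (cases n; simp add: field_simps power2_eq_square)
    moreover have "\<forall>\<^sub>F y in nhds x. poly t y > 0"
      using cont pos by (metis continuous_at_open eventually_nhds_in_open greaterThan_iff isContD
          order_tendstoD(1) tendsto_at_iff_tendsto_nhds)
    then have "\<forall>\<^sub>F y in nhds x. flat_exp t c p n y = ?f y"
      by eventually_elim (simp add: flat_exp_def)
    ultimately show ?thesis using DERIV_cong_ev[OF refl _ refl, of "flat_exp t c p n" ?f] by blast
  next
    case neg
    have "\<forall>\<^sub>F y in nhds x. poly t y < 0"
      using cont neg by (metis isContD order_tendstoD(2) tendsto_at_iff_tendsto_nhds)
    then have "\<forall>\<^sub>F y in nhds x. flat_exp t c p n y = 0"
      by eventually_elim (simp add: flat_exp_def)
    then have "(flat_exp t c p n has_real_derivative 0) (at x)"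
      using DERIV_cong_ev[OF refl _ refl, of "flat_exp t c p n" "\<lambda>_. 0"] by simp
    then show ?thesis using neg by (simp add: flat_exp_def)
  next
    case zero
    define C where "C = ((n + 2) / c) ^ (n + 2)"
    have bnd: "\<bar>flat_exp t c p n y\<bar> \<le> C * \<bar>poly p y\<bar> * (poly t y)\<^sup>2" for y
    proof (cases "poly t y > 0")
      case True
      have "\<bar>flat_exp t c p n y\<bar> = \<bar>poly p y\<bar> * (exp (- c / poly t y) / poly t y ^ n)"
        using True by (simp add: flat_exp_def abs_mult)
      also have "\<dots> \<le> \<bar>poly p y\<bar> * (C * (poly t y)\<^sup>2)"
        unfolding C_def by (intro mult_left_mono exp_neg_inverse_le True c) simp
      finally show ?thesis by (simp add: ac_simps)
    next
      case False
      have "C \<ge> 0" using c by (simp add: C_def)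
      then show ?thesis using False by (simp add: flat_exp_def)
    qed
    have "(poly t has_real_derivative poly (pderiv t) x) (at x)" by (rule poly_DERIV)
    then have "((\<lambda>y. (poly t y - poly t x) / (y - x)) \<longlongrightarrow> poly (pderiv t) x) (at x)"
      by (simp add: has_field_derivative_iff)
    then have q: "((\<lambda>y. poly t y / (y - x)) \<longlongrightarrow> poly (pderiv t) x) (at x)" using zero by simp
    have "((\<lambda>y. C * \<bar>poly p y\<bar> * \<bar>poly t y\<bar> * \<bar>poly t y / (y - x)\<bar>) \<longlongrightarrow>
        C * \<bar>poly p x\<bar> * \<bar>poly t x\<bar> * \<bar>poly (pderiv t) x\<bar>) (at x)"
      by (intro tendsto_mult tendsto_const tendsto_rabs q) (auto intro!: isContD)
    then have "((\<lambda>y. C * \<bar>poly p y\<bar> * \<bar>poly t y\<bar> * \<bar>poly t y / (y - x)\<bar>) \<longlongrightarrow> 0) (at x)"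
      using zero by simp
    then have "((\<lambda>y. (flat_exp t c p n y - flat_exp t c p n x) / (y - x)) \<longlongrightarrow> 0) (at x)"
    proof (rule Lim_null_comparison[rotated])
      show "\<forall>\<^sub>F y in at x. norm ((flat_exp t c p n y - flat_exp t c p n x) / (y - x))
          \<le> C * \<bar>poly p y\<bar> * \<bar>poly t y\<bar> * \<bar>poly t y / (y - x)\<bar>"
      proof (rule always_eventually, rule allI)
        fix y
        have "\<bar>flat_exp t c p n y / (y - x)\<bar> \<le> C * \<bar>poly p y\<bar> * (poly t y)\<^sup>2 / \<bar>y - x\<bar>"
          unfolding abs_divide using bnd by (intro divide_right_mono) auto
        also have "\<dots> = C * \<bar>poly p y\<bar> * \<bar>poly t y\<bar> * \<bar>poly t y / (y - x)\<bar>"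
          by (simp add: power2_eq_square abs_divide flip: abs_mult)
        finally show "norm ((flat_exp t c p n y - flat_exp t c p n x) / (y - x))
          \<le> C * \<bar>poly p y\<bar> * \<bar>poly t y\<bar> * \<bar>poly t y / (y - x)\<bar>"
          using zero by (simp add: flat_exp_def)
      qed
    qed
    then show ?thesis using zero by (simp add: has_field_derivative_iff flat_exp_def)
  qed
qed

lemma differentiable_all_orders_coinduct:
  assumes "f \<in> C" and "\<And>f x. f \<in> C \<Longrightarrow> f field_differentiable (at x)" and "\<And>f. f \<in> C \<Longrightarrow> deriv f \<in> C"
  shows "(deriv ^^ k) f field_differentiable (at (x::real))"
proof -
  have "(deriv ^^ k) f \<in> C" by (induction k) (use assms in auto)
  then show ?thesis by (rule assms(2))
qed

text \<open>Linear combinations are included because the du Bois-Reymond argument subtracts a multiple of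
  one bump from another.\<close>

lemma smooth_flat_exp_combination:
  assumes "c > 0" "c' > 0"
  shows "(deriv ^^ k) (\<lambda>x. flat_exp t c p n x + d * flat_exp t' c' p' n' x) field_differentiable (at x)"
proof (rule differentiable_all_orders_coinduct)
  define C where "C = {\<lambda>x. flat_exp t c p n x + d * flat_exp t' c' p' n' x |p n p' n'. True}"
  show "(\<lambda>x. flat_exp t c p n x + d * flat_exp t' c' p' n' x) \<in> C"
    by (auto simp: C_def)
  have D: "\<exists>f'\<in>C. \<forall>x. (f has_real_derivative f' x) (at x)" if f: "f \<in> C" for f
  proof -
    from f obtain p n p' n' where f: "f = (\<lambda>x. flat_exp t c p n x + d * flat_exp t' c' p' n' x)"
      unfolding C_def by blast
    let ?q = "pderiv p * t * t - smult (real n) (p * pderiv t * t) + smult c (p * pderiv t)"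
    let ?q' = "pderiv p' * t' * t' - smult (real n') (p' * pderiv t' * t') + smult c' (p' * pderiv t')"
    show ?thesis
    proof
      show "(\<lambda>x. flat_exp t c ?q (n + 2) x + d * flat_exp t' c' ?q' (n' + 2) x) \<in> C"
        by (auto simp: C_def)
      show "\<forall>x. (f has_real_derivative flat_exp t c ?q (n + 2) x + d * flat_exp t' c' ?q' (n' + 2) x) (at x)"
        unfolding f by (intro allI DERIV_add DERIV_cmult DERIV_flat_exp assms)
    qed
  qed
  show "f field_differentiable (at x)" if "f \<in> C" for f x
    using D[OF that] by (auto simp: field_differentiable_def)
  show "deriv f \<in> C" if "f \<in> C" for f
  proof -
    obtain f' where f': "f' \<in> C" "\<And>x. (f has_real_derivative f' x) (at x)" using D[OF \<open>f \<in> C\<close>] by blast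
    then have "deriv f = f'" by (intro ext DERIV_imp_deriv)
    then show ?thesis using f' by simp
  qed
qed

definition bump :: "real \<Rightarrow> real \<Rightarrow> real \<Rightarrow> real \<Rightarrow> real" where
  "bump a b c = flat_exp [:- a * b, a + b, -1:] c 1 0"

lemma bump_eq: "bump a b c x = (if (x - a) * (b - x) > 0 then exp (- c / ((x - a) * (b - x))) else 0)"
proof -
  have "poly [:- a * b, a + b, -1:] x = (x - a) * (b - x)" by (simp add: algebra_simps)
  then show ?thesis by (simp add: bump_def flat_exp_def)
qed

lemma bump_bounds: "c > 0 \<Longrightarrow> 0 \<le> bump a b c x \<and> bump a b c x \<le> 1"
  by (simp add: bump_eq)

lemma bump_outside:
  assumes "a < b" "x \<le> a \<or> b \<le> x" shows "bump a b c x = 0"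
proof -
  have "(x - a) * (b - x) \<le> 0" using assms by (auto simp: mult_le_0_iff)
  then show ?thesis by (simp add: bump_eq)
qed

lemma smooth_bump_combination:
  "c > 0 \<Longrightarrow> c' > 0 \<Longrightarrow> (deriv ^^ k) (\<lambda>x. bump a b c x + d * bump a' b' c' x) field_differentiable (at x)"
  unfolding bump_def by (rule smooth_flat_exp_combination)

lemma continuous_bump:
  assumes "c > 0" shows "continuous_on S (bump a b c)"
proof -
  have "(bump a b c) field_differentiable (at x)" for x
    using smooth_bump_combination[OF assms assms, of 0 a b 0 a b x] by simp
  then show ?thesis
    by (intro continuous_at_imp_continuous_on ballI field_differentiable_imp_continuous_at)
qed

lemma sq_integrable_bump: "c > 0 \<Longrightarrow> sq_integrable (bump a b c)"
  by (intro continuous_imp_sq_integrable continuous_bump)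

lemma bump_in_test_fun:
  assumes "0 < a" "a < b" "b < 1" "c > 0"
  shows "bump a b c \<in> test_fun"
  unfolding test_fun_def
proof (intro CollectI conjI exI[of _ "{a..b}"] allI impI)
  show "(deriv ^^ k) (bump a b c) field_differentiable (at x)" for k x
    using smooth_bump_combination[OF assms(4,4), of k a b 0 a b x] by simp
  show "bump a b c x = 0" if "x \<notin> {a..b}" for x
    using bump_outside[OF assms(2), of x c] that by auto
qed (use assms in auto)

lemma continuous_AE_eq_imp_eq:
  fixes f g :: "real \<Rightarrow> real"
  assumes f: "continuous_on {0..1} f" and g: "continuous_on {0..1} g"
    and eq: "AE x in leb01. f x = g x" and x: "x \<in> {0..1}"
  shows "f x = g x"
proof -
  have ci: "continuous_on {0<..<1} (\<lambda>x. f x - g x)"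
    by (intro continuous_intros continuous_on_subset[OF f] continuous_on_subset[OF g]) auto
  have "AE x in lebesgue. x \<in> {0<..<1} \<longrightarrow> f x = g x"
    using eq by (simp add: AE_restrict_space_iff)
  then have "negligible {x. \<not> (x \<in> {0<..<1} \<longrightarrow> f x = g x)}"
    unfolding eventually_ae_filter_negligible by (auto elim: negligible_subset)
  moreover have "{x. \<not> (x \<in> {0<..<1} \<longrightarrow> f x = g x)} = {0<..<1} \<inter> (\<lambda>x. f x - g x) -` (- {0})"
    by auto
  moreover have "open ({0<..<1} \<inter> (\<lambda>x. f x - g x) -` (- {0}))"
    by (rule continuous_open_preimage[OF ci]) auto
  ultimately have "{x. \<not> (x \<in> {0<..<1} \<longrightarrow> f x = g x)} = {}"
    using open_not_negligible by metis
  then have "f x - g x = 0" if "x \<in> {0<..<1}" for x using that by auto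
  then have "f x - g x = 0"
    using continuous_constant_on_closure[of "{0<..<1}" "\<lambda>x. f x - g x" 0 x] x
    by (simp add: continuous_on_diff f g)
  then show ?thesis by simp
qed

text \<open>As \<open>c\<close> tends to \<open>0\<close>, the bumps tend to the indicator function of the interval and stay below
  \<open>1\<close>. Hence a class that is orthogonal to all bumps is orthogonal to the indicator functions of
  all intervals.\<close>

lemma bump_tendsto_step:
  assumes ab: "a < b"
  shows "(\<lambda>n. abs_l2 (bump a b (1 / Suc n))) \<longlonglongrightarrow> l2_step b - l2_step a"
  unfolding l2_step_def abs_l2_diff[OF sq_integrable_indicator sq_integrable_indicator]
proof (rule l2_tendsto_dominated[of _ _ "\<lambda>x. 1"])
  show "AE x in leb01. (\<lambda>n. bump a b (1 / Suc n) x) \<longlonglongrightarrow> indicator {..b} x - indicator {..a} x"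
    using AE_leb01_not_in[of "{b}"]
  proof (rule AE_mp, simp, intro AE_leb01I impI)
    fix x :: real assume "x \<notin> {b}"
    show "(\<lambda>n. bump a b (1 / Suc n) x) \<longlonglongrightarrow> indicator {..b} x - indicator {..a} x"
    proof (cases "a < x \<and> x < b")
      case True
      then have pos: "(x - a) * (b - x) > 0" by simp
      have "(\<lambda>n. 1 / real (Suc n)) \<longlonglongrightarrow> 0" by (rule LIMSEQ_Suc[OF lim_1_over_n])
      then have "(\<lambda>n. exp (- (1 / real (Suc n)) / ((x - a) * (b - x)))) \<longlonglongrightarrow> exp (- 0 / ((x - a) * (b - x)))"
        by (intro tendsto_intros) (use pos in auto)
      then show ?thesis using pos True by (simp add: bump_eq indicator_def)
    next
      case False
      then have "x \<le> a \<or> b \<le> x" by auto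
      then have "bump a b c x = 0" for c by (rule bump_outside[OF ab])
      then show ?thesis using False ab \<open>x \<notin> {b}\<close> by (auto simp: indicator_def)
    qed
  qed
  show "AE x in leb01. \<bar>bump a b (1 / Suc n) x - (indicator {..b} x - indicator {..a} x)\<bar> \<le> 1" for n
  proof (rule AE_leb01I)
    fix x :: real
    have "0 \<le> bump a b (1 / Suc n) x \<and> bump a b (1 / Suc n) x \<le> 1" by (rule bump_bounds) simp
    then show "\<bar>bump a b (1 / Suc n) x - (indicator {..b} x - indicator {..a} x)\<bar> \<le> 1"
      using ab by (auto simp: indicator_def)
  qed
  show "sq_integrable (bump a b (1 / Suc n))" for n by (rule sq_integrable_bump) simp
  show "sq_integrable (\<lambda>x. indicator {..b} x - indicator {..a} x)"
    by (intro sq_integrable_diff sq_integrable_indicator)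
qed simp

lemma antiderivative_eq_ac:
  assumes "\<And>x. 0 \<le> x \<Longrightarrow> x \<le> 1 \<Longrightarrow> (F has_real_derivative f x) (at x within {0..1})"
    and "continuous_on {0..1} f"
  shows "abs_l2 F = ac (F 0) (abs_l2 f)"
proof -
  have "continuous_on {0..1} F" using assms(1) by (auto intro!: DERIV_continuous_on)
  then have F: "sq_integrable F" by (rule continuous_imp_sq_integrable)
  show ?thesis
    unfolding ac_def
  proof (rule abs_l2_eqI[OF F sq_integrable_ac], rule AE_leb01I)
    fix x :: real assume "0 < x" "x < 1"
    then show "F x = F 0 + prim (abs_l2 f) x"
      using prim_abs_l2_antiderivative[OF assms, of x] by simp
  qed
qed

lemma polynomial_eq_ac:
  assumes "real_polynomial_function p"
  shows "\<exists>g. abs_l2 p = ac (p 0) g"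
proof -
  obtain p' where p': "real_polynomial_function p'" "\<And>x. (p has_real_derivative p' x) (at x)"
    using has_real_derivative_polynomial_function[OF assms] by blast
  have "continuous_on {0..1} p'"
    using p'(1) by (simp add: continuous_on_polymonial_function real_polynomial_function_eq)
  then have "abs_l2 p = ac (p 0) (abs_l2 p')"
    using p'(2) by (intro antiderivative_eq_ac) (auto intro: has_field_derivative_at_within)
  then show ?thesis ..
qed

text \<open>Integration by parts against a primitive shows that \<open>z\<close> is orthogonal to all polynomials.\<close>

lemma prim_zero_imp_zero:
  assumes "\<And>x. 0 \<le> x \<Longrightarrow> x \<le> 1 \<Longrightarrow> prim z x = 0"
  shows "z = 0"
proof -
  have ac0: "ac 0 z = 0"
  proof -
    have "ac 0 z = ac 0 0"
      unfolding ac_def by (rule abs_l2_eqI[OF sq_integrable_ac sq_integrable_ac], rule AE_leb01I)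
        (simp add: assms prim_zero)
    then show ?thesis by (simp add: ac_const l2_const_def flip: zero_l2_def)
  qed
  have "ac d h \<bullet> z = 0" for d h
    using integration_by_parts_l2[of 0 z h d] ac0 assms[of 1] by simp
  then have "abs_l2 p \<bullet> z = 0" if "real_polynomial_function p" for p
    using polynomial_eq_ac[OF that] by auto
  moreover have "closed {g. g \<bullet> z = 0}" by (intro closed_Collect_eq continuous_intros)
  ultimately have "closure {abs_l2 p |p. real_polynomial_function p} \<subseteq> {g. g \<bullet> z = 0}"
    by (intro closure_minimal) auto
  then have "z \<in> {g. g \<bullet> z = 0}" unfolding polynomial_dense_l2 by blast
  then show ?thesis by simp
qed

lemma orthogonal_to_bumps_imp_zero:
  assumes "\<And>a b c. 0 < a \<Longrightarrow> a < b \<Longrightarrow> b < 1 \<Longrightarrow> 0 < c \<Longrightarrow> z \<bullet> abs_l2 (bump a b c) = 0"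
  shows "z = 0"
proof -
  have eq: "prim z b = prim z a" if "0 < a" "a < b" "b < 1" for a b
  proof -
    have "(\<lambda>n. z \<bullet> abs_l2 (bump a b (1 / Suc n))) \<longlonglongrightarrow> z \<bullet> (l2_step b - l2_step a)"
      by (intro tendsto_intros bump_tendsto_step that)
    moreover have "z \<bullet> abs_l2 (bump a b (1 / Suc n)) = 0" for n
      using assms that by simp
    ultimately have "z \<bullet> (l2_step b - l2_step a) = 0"
      by (simp add: LIMSEQ_const_iff)
    then show ?thesis by (simp add: prim_def inner_diff_right)
  qed
  have mid: "prim z x = prim z (1/2)" if "x \<in> {0<..<1}" for x
  proof (cases x "1/2 :: real" rule: linorder_cases)
    case equal
    then show ?thesis by (rule arg_cong)
  qed (use eq[of x "1/2"] eq[of "1/2" x] that in auto)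
  have *: "prim z x = prim z (1/2)" if "x \<in> {0..1}" for x
  proof (rule continuous_constant_on_closure[of "{0<..<1}" "prim z" "prim z (1/2)" x])
    show "continuous_on (closure {0<..<1}) (prim z)" using continuous_on_prim[of z] by simp
    show "x \<in> closure {0<..<1}" using that by simp
  qed (rule mid)
  have "prim z x = 0" if "0 \<le> x" "x \<le> 1" for x
    using *[of 0] *[of x] that by simp
  then show ?thesis by (rule prim_zero_imp_zero)
qed

section \<open>The Sobolev space $H^1(0,1)$ consists of the primitives\<close>

lemma test_fun_derivs:
  assumes "\<phi> \<in> test_fun"
  shows "\<And>x. (\<phi> has_real_derivative deriv \<phi> x) (at x)" "continuous_on S (deriv \<phi>)" "continuous_on S \<phi>"
    "\<phi> 0 = 0" "\<phi> 1 = 0"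
proof -
  have k: "(deriv ^^ k) \<phi> field_differentiable (at x)" for k x
    using assms by (simp add: test_fun_def)
  show D: "(\<phi> has_real_derivative deriv \<phi> x) (at x)" for x
    using k[of 0 x] by (simp add: DERIV_deriv_iff_field_differentiable)
  show "continuous_on S (deriv \<phi>)"
    using k[of 1] by (intro continuous_at_imp_continuous_on ballI field_differentiable_imp_continuous_at) auto
  show "continuous_on S \<phi>"
    using k[of 0] by (intro continuous_at_imp_continuous_on ballI field_differentiable_imp_continuous_at) auto
  obtain S where S: "S \<subseteq> {0<..<1}" "\<And>x. x \<notin> S \<Longrightarrow> \<phi> x = 0"
    using assms unfolding test_fun_def by blast
  show "\<phi> 0 = 0" by (rule S(2)) (use S(1) in auto)
  show "\<phi> 1 = 0" by (rule S(2)) (use S(1) in auto)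
qed

lemma has_weak_deriv_iff:
  "has_weak_deriv y g \<longleftrightarrow> (\<forall>\<phi>\<in>test_fun. y \<bullet> abs_l2 (deriv \<phi>) = - (g \<bullet> abs_l2 \<phi>))"
  unfolding has_weak_deriv_def
  by (intro ball_cong refl)
    (simp add: inner_rep_abs_l2 continuous_imp_sq_integrable test_fun_derivs)

lemma has_weak_deriv_ac: "has_weak_deriv (ac c g) g"
  unfolding has_weak_deriv_iff
proof
  fix \<phi> assume \<phi>: "\<phi> \<in> test_fun"
  have d: "(\<phi> has_real_derivative deriv \<phi> x) (at x within {0..1})" for x
    using test_fun_derivs(1)[OF \<phi>] by (rule has_field_derivative_at_within)
  have eq: "abs_l2 \<phi> = ac 0 (abs_l2 (deriv \<phi>))"
    using antiderivative_eq_ac[OF d test_fun_derivs(2)[OF \<phi>]] test_fun_derivs(4)[OF \<phi>] by simp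
  have zero: "prim (abs_l2 (deriv \<phi>)) 1 = 0"
    using prim_abs_l2_antiderivative[OF d test_fun_derivs(2)[OF \<phi>], of 1] test_fun_derivs(4,5)[OF \<phi>] by simp
  have "ac c g \<bullet> abs_l2 (deriv \<phi>) + abs_l2 \<phi> \<bullet> g = 0"
    unfolding eq integration_by_parts_l2 zero by simp
  then show "ac c g \<bullet> abs_l2 (deriv \<phi>) = - (g \<bullet> abs_l2 \<phi>)"
    unfolding inner_commute[of g] by linarith
qed

lemma weak_deriv_unique:
  assumes "has_weak_deriv y g" "has_weak_deriv y h"
  shows "g = h"
proof -
  have "(g - h) \<bullet> abs_l2 (bump a b c) = 0" if "0 < a" "a < b" "b < 1" "0 < c" for a b c
    using assms bump_in_test_fun[OF that] by (simp add: has_weak_deriv_iff inner_diff_left)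
  then have "g - h = 0" by (rule orthogonal_to_bumps_imp_zero)
  then show ?thesis by simp
qed

text \<open>The antiderivative that starts at \<open>0\<close> returns to \<open>0\<close> because the mean vanishes, so it has
  compact support again.\<close>

lemma mean_zero_is_derivative_of_test_fun:
  assumes smooth: "\<And>k x. (deriv ^^ k) \<theta> field_differentiable (at x)"
    and a: "0 < a" "a < b" "b < 1" and supp: "\<And>x. x \<le> a \<or> b \<le> x \<Longrightarrow> \<theta> x = 0"
    and mean: "abs_l2 \<theta> \<bullet> l2_const 1 = 0"
  shows "\<exists>\<phi>\<in>test_fun. deriv \<phi> = \<theta>"
proof -
  have cont: "continuous_on {0..1} \<theta>"
    using smooth[of 0] by (intro continuous_at_imp_continuous_on ballI field_differentiable_imp_continuous_at) simp
  obtain P where P0: "\<And>x. x \<in> {0..1} \<Longrightarrow> (P has_vector_derivative \<theta> x) (at x within {0..1})"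
    using antiderivative_continuous[OF cont] by blast
  then have P: "(P has_real_derivative \<theta> x) (at x within {0..1})" if "0 \<le> x" "x \<le> 1" for x
    using that by (simp add: has_real_derivative_iff_has_vector_derivative)
  have P1: "P 1 = P 0"
    using prim_abs_l2_antiderivative[OF P cont, of 1] mean by (simp add: prim_at_1)
  have Pconst: "\<exists>c. \<forall>x\<in>S. P x = c" if S: "convex S" "S \<subseteq> {0..1}" "\<And>x. x \<in> S \<Longrightarrow> x \<le> a \<or> b \<le> x" for S
  proof (rule has_field_derivative_zero_constant)
    fix x assume x: "x \<in> S"
    then have "(P has_real_derivative \<theta> x) (at x within {0..1})" using P[of x] S(2) by auto
    then have "(P has_real_derivative \<theta> x) (at x within S)" by (rule DERIV_subset) (rule S(2))
    then show "(P has_real_derivative 0) (at x within S)" using supp S(3)[OF x] by simp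
  qed (rule S)
  have Pa: "P x = P 0" if "0 \<le> x" "x \<le> a" for x
  proof -
    obtain c where "\<forall>x\<in>{0..a}. P x = c" using Pconst[of "{0..a}"] a by auto
    then show ?thesis using that a by simp
  qed
  have Pb: "P x = P 0" if "b \<le> x" "x \<le> 1" for x
  proof -
    obtain c where "\<forall>x\<in>{b..1}. P x = c" using Pconst[of "{b..1}"] a by auto
    then show ?thesis using that a P1 by simp
  qed
  define \<phi> where "\<phi> x = (if 0 < x \<and> x < 1 then P x - P 0 else 0)" for x
  have D: "(\<phi> has_real_derivative \<theta> x) (at x)" for x
  proof -
    consider "0 < x" "x < 1" | "x < a \<or> b < x" using a by linarith
    then show ?thesis
    proof cases
      case 1
      then have "at x within {0..1} = at x" by (intro at_within_interior) auto
      then have "(P has_real_derivative \<theta> x) (at x)" using P[of x] 1 by simp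
      then have "((\<lambda>x. P x - P 0) has_real_derivative \<theta> x) (at x)" by (auto intro!: derivative_eq_intros)
      moreover have "\<forall>\<^sub>F y in nhds x. y \<in> {0<..<1}"
        using 1 by (intro eventually_nhds_in_open) auto
      then have "\<forall>\<^sub>F y in nhds x. \<phi> y = P y - P 0"
        by eventually_elim (simp add: \<phi>_def)
      ultimately show ?thesis
        using DERIV_cong_ev[OF refl _ refl, of \<phi> "\<lambda>x. P x - P 0" x] by blast
    next
      case 2
      have "\<forall>\<^sub>F y in nhds x. y \<in> {..<a} \<union> {b<..}"
        using 2 by (intro eventually_nhds_in_open) auto
      then have "\<forall>\<^sub>F y in nhds x. \<phi> y = 0"
        by eventually_elim (auto simp: \<phi>_def intro: Pa Pb)
      then have "(\<phi> has_real_derivative 0) (at x)"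
        using DERIV_cong_ev[OF refl _ refl, of \<phi> "\<lambda>_. 0" x] by simp
      then show ?thesis using supp[of x] 2 by auto
    qed
  qed
  have d: "deriv \<phi> = \<theta>" using D by (intro ext DERIV_imp_deriv)
  have "\<phi> \<in> test_fun"
    unfolding test_fun_def
  proof (intro CollectI conjI exI[of _ "{a..b}"] allI impI)
    show "(deriv ^^ k) \<phi> field_differentiable (at x)" for k x
    proof (cases k)
      case 0
      then show ?thesis using D by (auto simp: field_differentiable_def)
    next
      case (Suc j)
      then show ?thesis using smooth[of j x] d by (simp add: funpow_Suc_right del: funpow.simps)
    qed
    show "\<phi> x = 0" if "x \<notin> {a..b}" for x using that by (auto simp: \<phi>_def intro: Pa Pb)
  qed (use a in auto)
  then show ?thesis using d by blast
qed

text \<open>The lemma of du Bois-Reymond. With a fixed bump \<open>\<psi>\<close> of positive mean, every bump becomes the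
  derivative of a test function after a multiple of \<open>\<psi>\<close> is subtracted. Hence \<open>y\<close> pairs with every bump
  as the constant \<open>k\<close> does that is determined by \<open>\<psi>\<close>.\<close>

lemma weak_deriv_zero_imp_const:
  assumes "has_weak_deriv y 0"
  shows "\<exists>k. y = l2_const k"
proof -
  define \<psi> where "\<psi> = bump (1/4) (3/4) 1"
  define I where "I = abs_l2 \<psi> \<bullet> l2_const 1"
  have "I \<noteq> 0"
  proof
    assume I0: "I = 0"
    have "I = (LINT x|leb01. \<psi> x)"
      unfolding I_def \<psi>_def l2_const_def
      by (simp add: inner_abs_l2 sq_integrable_bump)
    then have "AE x in leb01. \<psi> x = 0"
      using I0 integral_nonneg_eq_0_iff_AE[of leb01 \<psi>] bump_bounds[of 1 "1/4" "3/4"]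
        sq_integrable_times[OF sq_integrable_bump sq_integrable_const, of 1 "1/4" "3/4" 1]
      by (simp add: \<psi>_def)
    then have "\<psi> (1/2) = 0"
      using continuous_AE_eq_imp_eq[of \<psi> "\<lambda>_. 0" "1/2"] by (simp add: \<psi>_def continuous_bump)
    then show False by (simp add: \<psi>_def bump_eq)
  qed
  define k where "k = (y \<bullet> abs_l2 \<psi>) / I"
  have "(y - l2_const k) \<bullet> abs_l2 (bump a b c) = 0" if a: "0 < a" "a < b" "b < 1" and c: "0 < c" for a b c
  proof -
    define J where "J = abs_l2 (bump a b c) \<bullet> l2_const 1"
    define \<theta> where "\<theta> x = bump a b c x + (- J / I) * \<psi> x" for x
    have abs: "abs_l2 \<theta> = abs_l2 (bump a b c) + (- J / I) *\<^sub>R abs_l2 \<psi>"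
      unfolding \<theta>_def[abs_def] \<psi>_def abs_l2_scaleR[OF sq_integrable_bump[OF zero_less_one]]
        abs_l2_add[OF sq_integrable_bump[OF c] sq_integrable_scale[OF sq_integrable_bump[OF zero_less_one]]]
      by (rule refl)
    have "\<exists>\<phi>\<in>test_fun. deriv \<phi> = \<theta>"
    proof (rule mean_zero_is_derivative_of_test_fun[of _ "min a (1/4)" "max b (3/4)"])
      show "(deriv ^^ k) \<theta> field_differentiable (at x)" for k x
        unfolding \<theta>_def \<psi>_def using c by (intro smooth_bump_combination) auto
      show "\<theta> x = 0" if "x \<le> min a (1/4) \<or> max b (3/4) \<le> x" for x
        using bump_outside[of a b x c] bump_outside[of "1/4" "3/4" x 1] a that by (auto simp: \<theta>_def \<psi>_def)
      show "abs_l2 \<theta> \<bullet> l2_const 1 = 0"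
        using \<open>I \<noteq> 0\<close> unfolding abs by (simp add: inner_simps flip: J_def I_def)
    qed (use a in auto)
    then have "y \<bullet> abs_l2 \<theta> = 0" using assms by (auto simp: has_weak_deriv_iff)
    then have "y \<bullet> abs_l2 (bump a b c) = k * J"
      unfolding abs by (simp add: inner_simps k_def)
    moreover have "l2_const k = k *\<^sub>R l2_const 1"
      by (simp add: l2_const_def abs_l2_scaleR)
    ultimately show ?thesis
      by (simp add: inner_diff_left J_def inner_commute[of "l2_const 1"])
  qed
  then have "y - l2_const k = 0" by (rule orthogonal_to_bumps_imp_zero)
  then show ?thesis by auto
qed

lemma has_weak_deriv_imp_ac:
  assumes "has_weak_deriv y g"
  shows "\<exists>c. y = ac c g"
proof -
  have "has_weak_deriv (y - ac 0 g) 0"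
    using assms has_weak_deriv_ac[of 0 g] by (simp add: has_weak_deriv_iff inner_diff_left)
  then obtain k where "y - ac 0 g = l2_const k" using weak_deriv_zero_imp_const by blast
  then have "y = ac k 0 + ac 0 g" by (simp add: ac_const diff_eq_eq)
  then show ?thesis by (auto simp: ac_add)
qed

lemma wderiv_ac [simp]: "wderiv (ac c g) = g"
  unfolding wderiv_def using has_weak_deriv_ac weak_deriv_unique by (intro the_equality) blast+

lemma ac_in_H1 [simp]: "ac c g \<in> H1"
  unfolding H1_def using has_weak_deriv_ac by blast

lemma pval_ac [simp]:
  assumes "0 \<le> x" "x \<le> 1"
  shows "pval (ac c g) x = c + prim g x"
  unfolding pval_def
proof (rule the_equality)
  have C: "continuous_on {0..1} (\<lambda>x. c + prim g x)" by (intro continuous_intros continuous_on_prim)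
  show "\<exists>f. continuous_on {0..1} f \<and> (AE s in leb01. rep_l2 (ac c g) s = f s) \<and> c + prim g x = f x"
    using C rep_ac[of c g] by blast
  fix d assume "\<exists>f. continuous_on {0..1} f \<and> (AE s in leb01. rep_l2 (ac c g) s = f s) \<and> d = f x"
  then obtain f where f: "continuous_on {0..1} f" "AE s in leb01. rep_l2 (ac c g) s = f s" "d = f x" by blast
  have "AE s in leb01. f s = c + prim g s" using f(2) rep_ac[of c g] by eventually_elim simp
  then have "f x = c + prim g x" by (rule continuous_AE_eq_imp_eq[OF f(1) C]) (use assms in simp)
  then show "d = c + prim g x" using f(3) by simp
qed

lemma H1_cases:
  assumes "y \<in> H1" obtains c g where "y = ac c g"
proof -
  obtain g where "has_weak_deriv y g" using assms unfolding H1_def by blast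
  then show ?thesis using has_weak_deriv_imp_ac that by blast
qed

lemma H1_eq_ac:
  assumes "y \<in> H1" shows "y = ac (pval y 0) (wderiv y)"
  using assms
proof (cases rule: H1_cases)
  case (1 c g)
  then show ?thesis by simp
qed

section \<open>Exponential decay of contraction semigroups from a quadratic Lyapunov functional\<close>

text \<open>A discrete form of Gronwall's inequality. The error of a step of length \<open>h\<close> is \<open>o(h)\<close> uniformly
  along the orbit, so \<open>n\<close> steps of length \<open>t / n\<close> accumulate an error that vanishes in the limit, while
  \<open>(1 - kt/n)\<^sup>n \<le> exp(- kt)\<close>.\<close>

lemma euler_steps_imp_exp_decay:
  fixes q :: "real \<Rightarrow> real"
  assumes step: "\<And>t h. 0 \<le> t \<Longrightarrow> 0 < h \<Longrightarrow> q (t + h) \<le> (1 - k * h) * q t + h * E h"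
    and E: "(E \<longlongrightarrow> 0) (at_right 0)" and E0: "\<And>h. 0 < h \<Longrightarrow> 0 \<le> E h"
    and q0: "0 \<le> q 0" and k: "0 \<le> k" and t: "0 < t"
  shows "q t \<le> exp (- k * t) * q 0"
proof -
  have iter: "q (real n * h) \<le> (1 - k * h) ^ n * q 0 + real n * h * E h"
    if h: "0 < h" "k * h \<le> 1" for n h
  proof (induction n)
    case (Suc n)
    have "q (real (Suc n) * h) = q (real n * h + h)" by (simp add: algebra_simps)
    also have "\<dots> \<le> (1 - k * h) * q (real n * h) + h * E h" using h by (intro step) auto
    also have "\<dots> \<le> (1 - k * h) * ((1 - k * h) ^ n * q 0 + real n * h * E h) + h * E h"
      using Suc h by (intro add_right_mono mult_left_mono) auto
    also have "\<dots> = (1 - k * h) ^ Suc n * q 0 + (1 - k * h) * (real n * h * E h) + h * E h"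
      by (simp add: algebra_simps)
    also have "\<dots> \<le> (1 - k * h) ^ Suc n * q 0 + real n * h * E h + h * E h"
      using h E0[of h] k by (intro add_mono mult_left_le_one_le order_refl) auto
    finally show ?case by (simp add: algebra_simps)
  qed simp
  have "q t \<le> exp (- k * t) * q 0 + t * E (t / real (Suc n))" if n: "k * t \<le> real (Suc n)" for n
  proof -
    let ?h = "t / real (Suc n)"
    have h: "0 < ?h" "k * ?h \<le> 1" using t n by (auto simp: field_simps)
    have "(1 - k * ?h) ^ Suc n = (1 - k * t / real (Suc n)) ^ Suc n" by simp
    also have "\<dots> \<le> exp (- (k * t))"
      using n by (intro exp_ge_one_minus_x_over_n_power_n) auto
    finally have "(1 - k * ?h) ^ Suc n * q 0 \<le> exp (- k * t) * q 0"
      using q0 by (intro mult_right_mono) auto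
    moreover have "real (Suc n) * ?h = t" by simp
    ultimately show ?thesis using iter[OF h, of "Suc n"] by simp
  qed
  note le = this
  have ev: "\<forall>\<^sub>F n in sequentially. q t \<le> exp (- k * t) * q 0 + t * E (t / real (Suc n))"
    using eventually_ge_at_top[of "nat \<lceil>k * t\<rceil>"]
  proof eventually_elim
    case (elim n)
    then have "k * t \<le> real (Suc n)" by linarith
    then show ?case by (rule le)
  qed
  have "filterlim (\<lambda>n. t / real (Suc n)) (at_right 0) sequentially"
    unfolding filterlim_at
  proof
    show "(\<lambda>n. t / real (Suc n)) \<longlonglongrightarrow> 0"
      using tendsto_mult_right_zero[OF LIMSEQ_Suc[OF lim_1_over_n], of t] by simp
    show "\<forall>\<^sub>F n in sequentially. t / real (Suc n) \<in> {0<..} \<and> t / real (Suc n) \<noteq> 0"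
      using t by (intro always_eventually) (auto simp del: of_nat_Suc)
  qed
  then have "(\<lambda>n. E (t / real (Suc n))) \<longlonglongrightarrow> 0" by (rule filterlim_compose[OF E])
  then have "(\<lambda>n. exp (- k * t) * q 0 + t * E (t / real (Suc n))) \<longlonglongrightarrow> exp (- k * t) * q 0 + t * 0"
    by (intro tendsto_intros)
  then show ?thesis using tendsto_lowerbound[OF _ ev] by simp
qed

text \<open>The norm \<open>N\<close> of the space \<open>X\<close> is equivalent to the norm pulled back along a map \<open>e\<close>, linear on
  \<open>X\<close>, into a normed space on which the Lyapunov form \<open>b\<close> lives; boundedness and bilinearity of \<open>b\<close> can then
  be checked for a fixed norm.

  The generator only gives the right derivative of an orbit at time \<open>0\<close>. Since
  \<open>T (s + h) x - T s x - h A (T s x) = T s (T h x - x - h A x)\<close> and \<open>T s\<close> is a contraction, the remainder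
  is \<open>o(h)\<close> uniformly in \<open>s\<close>, and Euler steps give the decay of the form along the orbit. The orbits from \<open>D\<close> suffice, as \<open>D\<close> is dense and the semigroup is bounded.\<close>

theorem contraction_semigroup_exponential_decay:
  fixes X D :: "'a::real_vector set" and e :: "'a \<Rightarrow> 'b::real_normed_vector"
    and b :: "'b \<Rightarrow> 'b \<Rightarrow> real"
  assumes gen: "generates_contraction_semigroup X N D A T"
    and X: "subspace X"
    and e_add: "\<And>x y. x \<in> X \<Longrightarrow> y \<in> X \<Longrightarrow> e (x + y) = e x + e y"
    and e_scale: "\<And>c x. x \<in> X \<Longrightarrow> e (c *\<^sub>R x) = c *\<^sub>R e x"
    and equiv: "equivalent_norms_on X N (\<lambda>x. norm (e x))"
    and bil: "bounded_bilinear b"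
    and coercive: "\<And>x. x \<in> X \<Longrightarrow> k * (norm (e x))\<^sup>2 \<le> b (e x) (e x)" and k: "k > 0"
    and dissipative: "\<And>x. x \<in> D \<Longrightarrow> b (e x) (e (A x)) + b (e (A x)) (e x) \<le> - 2 * w * b (e x) (e x)"
    and w: "w > 0"
    and dense: "\<And>x \<epsilon>. x \<in> X \<Longrightarrow> \<epsilon> > 0 \<Longrightarrow> \<exists>y\<in>D. norm (e (x - y)) < \<epsilon>"
  shows "\<exists>C>0. \<exists>\<omega>>0. \<forall>t>0. onorm_on X N (T t) \<le> C * exp (- \<omega> * t)"
proof -
  define p where "p x = norm (e x)" for x
  define B where "B x y = b (e x) (e y)" for x y
  interpret b: bounded_bilinear b by (rule bil)
  obtain C where C: "0 \<le> C" and C_bound: "\<And>v v'. norm (b v v') \<le> norm v * norm v' * C"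
    using b.nonneg_bounded by blast
  have B_add_left: "B (x + y) z = B x z + B y z" if "x \<in> X" "y \<in> X" "z \<in> X" for x y z
    using that by (simp add: B_def e_add b.add_left)
  have B_add_right: "B x (y + z) = B x y + B x z" if "x \<in> X" "y \<in> X" "z \<in> X" for x y z
    using that by (simp add: B_def e_add b.add_right)
  have B_scale_left: "B (c *\<^sub>R x) y = c * B x y" if "x \<in> X" for c x y
    using that by (simp add: B_def e_scale b.scaleR_left)
  have B_scale_right: "B x (c *\<^sub>R y) = c * B x y" if "y \<in> X" for c x y
    using that by (simp add: B_def e_scale b.scaleR_right)
  have B_bound: "\<bar>B x y\<bar> \<le> C * p x * p y" for x y
    using C_bound[of "e x" "e y"] by (simp add: B_def p_def mult.commute mult.left_commute)
  have sub: "0 \<in> X" "\<And>x y. x \<in> X \<Longrightarrow> y \<in> X \<Longrightarrow> x + y \<in> X" "\<And>c x. x \<in> X \<Longrightarrow> c *\<^sub>R x \<in> X"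
    "\<And>x y. x \<in> X \<Longrightarrow> y \<in> X \<Longrightarrow> x - y \<in> X"
    using X subspace_diff[OF X] by (auto simp: subspace_def)
  have e_diff: "e (x - y) = e x - e y" if "x \<in> X" "y \<in> X" for x y
    using e_add[of x "(-1) *\<^sub>R y"] e_scale[of y "-1"] sub(3)[of y "-1"] that by simp
  have p0: "0 \<le> p x" for x by (simp add: p_def)
  have p_scale: "p (c *\<^sub>R x) = \<bar>c\<bar> * p x" if "x \<in> X" for c x
    using e_scale[OF that] by (simp add: p_def)
  obtain c d where c: "c > 0" and d: "d > 0"
    and cN: "\<And>x. x \<in> X \<Longrightarrow> c * p x \<le> N x" and Nd: "\<And>x. x \<in> X \<Longrightarrow> N x \<le> d * p x"
    using equiv unfolding equivalent_norms_on_def p_def by blast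
  define K where "K = d / c"
  have K: "K > 0" using c d by (simp add: K_def)
  have T_op: "bounded_operator_on X N (T t)" if "t \<ge> 0" for t
    using gen that by (auto simp: generates_contraction_semigroup_def C0_semigroup_on_def)
  have T_X: "T t x \<in> X" if "t \<ge> 0" "x \<in> X" for t x
    using T_op[OF that(1)] that by (auto simp: bounded_operator_on_def)
  have T_add: "T t (x + y) = T t x + T t y" if "t \<ge> 0" "x \<in> X" "y \<in> X" for t x y
    using T_op[OF that(1)] that by (auto simp: bounded_operator_on_def)
  have T_scale: "T t (k *\<^sub>R x) = k *\<^sub>R T t x" if "t \<ge> 0" "x \<in> X" for t x k
    using T_op[OF that(1)] that by (auto simp: bounded_operator_on_def)
  have T_diff: "T t (x - y) = T t x - T t y" if "t \<ge> 0" "x \<in> X" "y \<in> X" for t x y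
    using T_add[of t x "(-1) *\<^sub>R y"] T_scale[of t y "-1"] sub(3)[of y "-1"] that by simp
  have T_0: "T 0 x = x" if "x \<in> X" for x
    using gen that by (auto simp: generates_contraction_semigroup_def C0_semigroup_on_def)
  have T_semi: "T (s + t) x = T s (T t x)" if "s \<ge> 0" "t \<ge> 0" "x \<in> X" for s t x
    using gen that by (auto simp: generates_contraction_semigroup_def C0_semigroup_on_def)
  have T_contr: "N (T t x) \<le> N x" if "t \<ge> 0" "x \<in> X" for t x
    using gen that by (auto simp: generates_contraction_semigroup_def)
  have T_p: "p (T t x) \<le> K * p x" if "t \<ge> 0" "x \<in> X" for t x
  proof -
    have "c * p (T t x) \<le> d * p x"
      using cN[OF T_X[OF that]] T_contr[OF that] Nd[OF that(2)] by linarith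
    then show ?thesis using c by (simp add: K_def field_simps)
  qed
  have graph: "generator_on X N T = {(x, A x) |x. x \<in> D}"
    using gen by (simp add: generates_contraction_semigroup_def)
  have D: "x \<in> X \<and> A x \<in> X \<and> ((\<lambda>h. N ((1 / h) *\<^sub>R (T h x - x) - A x)) \<longlongrightarrow> 0) (at_right 0)" if "x \<in> D" for x
  proof -
    have "(x, A x) \<in> generator_on X N T" unfolding graph using that by blast
    then show ?thesis by (simp add: generator_on_def)
  qed
  \<comment> \<open>The orbit of a point of the domain stays in the domain, and \<open>A\<close> commutes with the semigroup.\<close>
  have T_D: "T t x \<in> D \<and> A (T t x) = T t (A x)" if t: "t \<ge> 0" and x: "x \<in> D" for t x
  proof -
    have xX: "x \<in> X" "A x \<in> X" using D[OF x] by auto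
    have lim: "((\<lambda>h. N ((1 / h) *\<^sub>R (T h x - x) - A x)) \<longlongrightarrow> 0) (at_right 0)" using D[OF x] by blast
    have "((\<lambda>h. N ((1 / h) *\<^sub>R (T h (T t x) - T t x) - T t (A x))) \<longlongrightarrow> 0) (at_right 0)"
    proof (rule Lim_null_comparison[OF _ lim])
      show "\<forall>\<^sub>F h in at_right 0. norm (N ((1 / h) *\<^sub>R (T h (T t x) - T t x) - T t (A x)))
          \<le> N ((1 / h) *\<^sub>R (T h x - x) - A x)"
        using eventually_at_right_less[of 0]
      proof eventually_elim
        case (elim h)
        let ?y = "(1 / h) *\<^sub>R (T h x - x) - A x"
        have ThX: "T h x \<in> X" using T_X[of h x] elim xX by simp
        have yX: "?y \<in> X" using ThX xX sub by simp
        have comm: "T h (T t x) = T t (T h x)"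
          using T_semi[of h t x] T_semi[of t h x] elim t xX by (simp add: add.commute)
        have "(1 / h) *\<^sub>R (T h (T t x) - T t x) - T t (A x) = T t ?y"
          using ThX xX sub t by (simp add: comm T_diff T_scale)
        moreover have "0 \<le> N (T t ?y)"
          using cN[OF T_X[OF t yX]] c p0[of "T t ?y"] by (meson mult_nonneg_nonneg order_trans less_imp_le)
        ultimately show ?case using T_contr[OF t yX] by simp
      qed
    qed
    then have "(T t x, T t (A x)) \<in> generator_on X N T"
      using T_X[OF t] xX by (simp add: generator_on_def)
    then show ?thesis unfolding graph by auto
  qed
  have decay_D: "B (T t x) (T t x) \<le> exp (- (2 * w) * t) * B x x" if x: "x \<in> D" and t: "0 < t" for x t
  proof -
    have xX: "x \<in> X" "A x \<in> X" using D[OF x] by auto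
    \<comment> \<open>\<open>h * \<rho> h\<close> bounds the remainder of a step of length \<open>h\<close> anywhere on the orbit; \<open>V\<close> and \<open>W\<close> bound
      the orbits of \<open>x\<close> and \<open>A x\<close>.\<close>
    define \<rho> where "\<rho> h = K * p ((1 / h) *\<^sub>R (T h x - x) - A x)" for h
    define V where "V = K * p x"
    define W where "W = K * p (A x)"
    define E where "E h = h * C * W\<^sup>2 + 2 * C * V * \<rho> h + 2 * h * C * W * \<rho> h + h * C * (\<rho> h)\<^sup>2" for h
    have \<rho>0: "0 \<le> \<rho> h" for h using K p0 by (simp add: \<rho>_def)
    have VW0: "0 \<le> V" "0 \<le> W" using K p0 by (auto simp: V_def W_def)
    have \<rho>_lim: "(\<rho> \<longlongrightarrow> 0) (at_right 0)"
    proof -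
      have "((\<lambda>h. K / c * N ((1 / h) *\<^sub>R (T h x - x) - A x)) \<longlongrightarrow> 0) (at_right 0)"
        using tendsto_mult_right_zero D[OF x] by blast
      then show ?thesis
      proof (rule Lim_null_comparison[rotated])
        show "\<forall>\<^sub>F h in at_right 0. norm (\<rho> h) \<le> K / c * N ((1 / h) *\<^sub>R (T h x - x) - A x)"
          using eventually_at_right_less[of 0]
        proof eventually_elim
          case (elim h)
          then have "(1 / h) *\<^sub>R (T h x - x) - A x \<in> X" using xX sub T_X[of h x] by simp
          from mult_left_mono[OF cN[OF this], of "K / c"] show ?case
            using K c \<rho>0[of h] by (simp add: \<rho>_def)
        qed
      qed
    qed
    have E_lim: "(E \<longlongrightarrow> 0) (at_right 0)"
    proof -
      have "((\<lambda>h. h) \<longlongrightarrow> 0) (at_right (0::real))" by (rule tendsto_ident_at)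
      then have "(E \<longlongrightarrow> 0 * C * W\<^sup>2 + 2 * C * V * 0 + 2 * 0 * C * W * 0 + 0 * C * 0\<^sup>2) (at_right 0)"
        unfolding E_def[abs_def] by (intro tendsto_intros \<rho>_lim)
      then show ?thesis by simp
    qed
    have E0: "0 \<le> E h" if "0 < h" for h
      unfolding E_def using \<rho>0[of h] VW0 C that by (intro add_nonneg_nonneg mult_nonneg_nonneg) auto
    have step: "B (T (s + h) x) (T (s + h) x) \<le> (1 - 2 * w * h) * B (T s x) (T s x) + h * E h"
      if s: "0 \<le> s" and h: "0 < h" for s h
    proof -
      define v where "v = T s x"
      define u where "u = T s (A x)"
      define y where "y = (1 / h) *\<^sub>R (T h x - x) - A x"
      define r where "r = T s y"
      have ThX: "T h x \<in> X" using T_X[of h x] h xX by simp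
      have yX: "y \<in> X" unfolding y_def using xX sub ThX by simp
      have vX: "v \<in> X" "u \<in> X" "r \<in> X" unfolding v_def u_def r_def using T_X s xX yX by auto
      have pv: "p v \<le> V" "p u \<le> W" "p r \<le> \<rho> h"
        unfolding v_def u_def r_def V_def W_def \<rho>_def y_def[symmetric] using T_p s xX yX by auto
      have "T h x = x + h *\<^sub>R (A x + y)" using h by (simp add: y_def)
      then have Tsh: "T (s + h) x = v + h *\<^sub>R (u + r)"
        using T_semi[of s h x] s h xX yX sub by (simp add: T_add T_scale v_def u_def r_def)
      have "B (T (s + h) x) (T (s + h) x) = B v v + h * (B v u + B u v)
         + h * (B v r + B r v) + h * h * (B u u + B u r + B r u + B r r)"
        unfolding Tsh using vX sub
        by (simp add: B_add_left B_add_right B_scale_left B_scale_right algebra_simps)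
      also have "\<dots> \<le> B v v + h * (- 2 * w * B v v)
         + h * (C * V * \<rho> h + C * V * \<rho> h) + h * h * (C * W\<^sup>2 + C * W * \<rho> h + C * W * \<rho> h + C * (\<rho> h)\<^sup>2)"
      proof -
        have diss: "B v u + B u v \<le> - 2 * w * B v v"
          using dissipative[of "T s x"] T_D[OF s x] by (simp add: v_def u_def B_def)
        have bnd: "B y z \<le> C * a * a'" if "y \<in> X" "z \<in> X" "p y \<le> a" "p z \<le> a'" for y z a a'
        proof -
          have "B y z \<le> C * p y * p z" using B_bound[of y z] by linarith
          also have "\<dots> \<le> C * a * a'"
            using C that p0[of y] p0[of z] order_trans[OF p0 that(3)] by (intro mult_mono mult_nonneg_nonneg) auto
          finally show ?thesis .
        qed
        show ?thesis
          using diss bnd[OF vX(1,3) pv(1,3)] bnd[OF vX(3,1) pv(3,1)] bnd[OF vX(2,2) pv(2,2)]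
            bnd[OF vX(2,3) pv(2,3)] bnd[OF vX(3,2) pv(3,2)] bnd[OF vX(3,3) pv(3,3)] h
          by (intro add_mono mult_left_mono) (auto simp: power2_eq_square ac_simps)
      qed
      also have "\<dots> = (1 - 2 * w * h) * B v v + h * E h"
        by (simp add: E_def algebra_simps power2_eq_square)
      finally show ?thesis by (simp add: v_def)
    qed
    have "B (T t x) (T t x) \<le> exp (- (2 * w) * t) * B (T 0 x) (T 0 x)"
    proof (rule euler_steps_imp_exp_decay[OF step E_lim E0 _ _ t])
      have "0 \<le> k * (norm (e (T 0 x)))\<^sup>2" using k by simp
      then show "0 \<le> B (T 0 x) (T 0 x)" using coercive[of "T 0 x"] T_X[of 0 x] xX
        unfolding B_def by linarith
    qed (use w in auto)
    then show ?thesis using T_0 xX by simp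
  qed
  define G where "G = sqrt (C / k)"
  have G: "0 \<le> G" using C k by (simp add: G_def)
  have decay_p: "p (T t x) \<le> G * exp (- w * t) * p x" if x: "x \<in> D" and t: "0 < t" for x t
  proof (rule power2_le_imp_le)
    have xX: "x \<in> X" using D[OF x] by auto
    have "k * (p (T t x))\<^sup>2 \<le> B (T t x) (T t x)"
      unfolding p_def B_def using t xX by (intro coercive T_X) auto
    also have "\<dots> \<le> exp (- (2 * w) * t) * B x x" by (rule decay_D[OF x t])
    also have "\<dots> \<le> exp (- (2 * w) * t) * (C * (p x)\<^sup>2)"
      using B_bound[of x x] by (intro mult_left_mono) (auto simp: power2_eq_square mult.assoc)
    finally have "(p (T t x))\<^sup>2 \<le> C / k * exp (- (2 * w) * t) * (p x)\<^sup>2"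
      using k by (simp add: field_simps)
    also have "\<dots> = (G * exp (- w * t) * p x)\<^sup>2"
      using C k by (simp add: G_def power_mult_distrib exp_double[symmetric] mult.assoc flip: exp_of_nat_mult)
    finally show "(p (T t x))\<^sup>2 \<le> (G * exp (- w * t) * p x)\<^sup>2" .
  qed (use G p0 in simp)
  have decay_X: "p (T t x) \<le> G * exp (- w * t) * p x" if x: "x \<in> X" and t: "0 < t" for x t
  proof (rule field_le_epsilon)
    fix \<epsilon> :: real assume \<epsilon>: "\<epsilon> > 0"
    let ?g = "G * exp (- w * t)"
    have g: "0 \<le> ?g" using G by simp
    obtain y where y: "y \<in> D" and "p (x - y) < \<epsilon> / (K + ?g)"
      using dense[OF x, of "\<epsilon> / (K + ?g)"] \<epsilon> K g unfolding p_def by (meson add_pos_nonneg divide_pos_pos)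
    then have py: "(K + ?g) * p (x - y) \<le> \<epsilon>" using K g by (simp add: pos_less_divide_eq mult.commute add_pos_nonneg)
    have yX: "y \<in> X" using D[OF y] by blast
    have "p (T t x) \<le> p (T t (x - y)) + p (T t y)"
      using norm_triangle_ineq[of "e (T t (x - y))" "e (T t y)"] x yX t
      by (simp add: p_def T_diff e_diff T_X)
    also have "\<dots> \<le> K * p (x - y) + ?g * p y"
      using t x yX sub y by (intro add_mono T_p decay_p) auto
    also have "p y \<le> p x + p (x - y)"
      using norm_triangle_ineq3[of "e x" "e y"] x yX by (simp add: p_def e_diff)
    finally have "p (T t x) \<le> K * p (x - y) + ?g * (p x + p (x - y))"
      using g by (auto simp: mult_left_mono)
    then show "p (T t x) \<le> ?g * p x + \<epsilon>" using py by (simp add: algebra_simps)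
  qed
  have "onorm_on X N (T t) \<le> (K * G + 1) * exp (- w * t)" if t: "t > 0" for t
    unfolding onorm_on_def
  proof (rule cSUP_least)
    show "X \<noteq> {}" using sub by blast
    fix x assume x: "x \<in> X"
    have "N (T t x) \<le> d * (G * exp (- w * t) * p x)"
      using Nd[OF T_X[of t x]] decay_X[OF x t] t x d by (meson less_imp_le mult_left_mono order_trans)
    also have "\<dots> = K * G * exp (- w * t) * (c * p x)" using c by (simp add: K_def)
    also have "\<dots> \<le> K * G * exp (- w * t) * N x"
      using cN[OF x] K G by (intro mult_left_mono) auto
    also have "\<dots> \<le> (K * G + 1) * exp (- w * t) * N x"
      using order_trans[OF mult_nonneg_nonneg[OF less_imp_le[OF c] p0] cN[OF x]]
      by (intro mult_right_mono) auto
    finally have le: "N (T t x) \<le> (K * G + 1) * exp (- w * t) * N x" .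
    show "N (T t x) / N x \<le> (K * G + 1) * exp (- w * t)"
    proof (cases "N x = 0")
      case True
      then show ?thesis using K G by simp
    next
      case False
      then have "N x > 0" using order_trans[OF mult_nonneg_nonneg[OF less_imp_le[OF c] p0] cN[OF x]] by simp
      then show ?thesis using le by (simp add: pos_divide_le_eq)
    qed
  qed
  moreover have "K * G + 1 > 0" using mult_nonneg_nonneg[OF less_imp_le[OF K] G] by linarith
  ultimately show ?thesis using w by blast
qed

lemma bounded_bilinear_add:
  fixes b b' :: "'a::real_normed_vector \<Rightarrow> 'b::real_normed_vector \<Rightarrow> 'c::real_normed_vector"
  assumes "bounded_bilinear b" "bounded_bilinear b'"
  shows "bounded_bilinear (\<lambda>v w. b v w + b' v w)"
proof -
  interpret b: bounded_bilinear b by fact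
  interpret b': bounded_bilinear b' by fact
  obtain C C' where C: "\<And>v w. norm (b v w) \<le> norm v * norm w * C" "\<And>v w. norm (b' v w) \<le> norm v * norm w * C'"
    using b.bounded b'.bounded by blast
  show ?thesis
  proof
    have "norm (b v w + b' v w) \<le> norm v * norm w * (C + C')" for v w
      using norm_triangle_le[OF add_mono[OF C]] by (simp add: distrib_left)
    then show "\<exists>K. \<forall>v w. norm (b v w + b' v w) \<le> norm v * norm w * K" by blast
  qed (simp_all add: b.add_left b.add_right b'.add_left b'.add_right b.scaleR_left b.scaleR_right
      b'.scaleR_left b'.scaleR_right scaleR_add_right)
qed

lemma bounded_bilinear_cmult:
  fixes b :: "'a::real_normed_vector \<Rightarrow> 'b::real_normed_vector \<Rightarrow> real"
  assumes "bounded_bilinear b"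
  shows "bounded_bilinear (\<lambda>v w. c * b v w)"
proof -
  interpret b: bounded_bilinear b by fact
  obtain C where C: "\<And>v w. norm (b v w) \<le> norm v * norm w * C"
    using b.bounded by blast
  show ?thesis
  proof
    have "norm (c * b v w) \<le> norm v * norm w * (\<bar>c\<bar> * C)" for v w
      using mult_left_mono[OF C[of v w], of "\<bar>c\<bar>"] by (simp add: abs_mult ac_simps)
    then show "\<exists>K. \<forall>v w. norm (c * b v w) \<le> norm v * norm w * K" by blast
  qed (simp_all add: b.add_left b.add_right b.scaleR_left b.scaleR_right distrib_left)
qed

text \<open>The form \<open>b\<^sub>0\<close> is the energy: coercive, but dissipating only a part \<open>P\<close> of the state. The form
  \<open>b\<^sub>1\<close> has no sign, but its derivative controls the whole state up to a multiple of \<open>P\<close>. For large \<open>L\<close>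
  the form \<open>L b\<^sub>0 + b\<^sub>1\<close> inherits coercivity from \<open>b\<^sub>0\<close>, and its derivative is negative because the surplus
  of \<open>P\<close> is dominated by the dissipation of \<open>L b\<^sub>0\<close>.\<close>

theorem contraction_semigroup_exponential_decay_perturbed:
  fixes X D :: "'a::real_vector set" and e :: "'a \<Rightarrow> 'b::real_normed_vector"
    and b\<^sub>0 b\<^sub>1 :: "'b \<Rightarrow> 'b \<Rightarrow> real"
  assumes gen: "generates_contraction_semigroup X N D A T"
    and X: "subspace X"
    and e_add: "\<And>x y. x \<in> X \<Longrightarrow> y \<in> X \<Longrightarrow> e (x + y) = e x + e y"
    and e_scale: "\<And>c x. x \<in> X \<Longrightarrow> e (c *\<^sub>R x) = c *\<^sub>R e x"
    and equiv: "equivalent_norms_on X N (\<lambda>x. norm (e x))"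
    and DX: "D \<subseteq> X"
    and bil0: "bounded_bilinear b\<^sub>0" and bil1: "bounded_bilinear b\<^sub>1"
    and coercive: "\<And>x. x \<in> X \<Longrightarrow> k * (norm (e x))\<^sup>2 \<le> b\<^sub>0 (e x) (e x)" and k: "k > 0"
    and diss0: "\<And>x. x \<in> D \<Longrightarrow> b\<^sub>0 (e x) (e (A x)) + b\<^sub>0 (e (A x)) (e x) \<le> - \<kappa>\<^sub>0 * P x"
    and diss1: "\<And>x. x \<in> D \<Longrightarrow> b\<^sub>1 (e x) (e (A x)) + b\<^sub>1 (e (A x)) (e x)
        \<le> - \<kappa>\<^sub>1 * (norm (e x))\<^sup>2 + R * P x"
    and P: "\<And>x. x \<in> D \<Longrightarrow> 0 \<le> P x" and \<kappa>: "\<kappa>\<^sub>0 > 0" "\<kappa>\<^sub>1 > 0"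
    and dense: "\<And>x \<epsilon>. x \<in> X \<Longrightarrow> \<epsilon> > 0 \<Longrightarrow> \<exists>y\<in>D. norm (e (x - y)) < \<epsilon>"
  shows "\<exists>C>0. \<exists>\<omega>>0. \<forall>t>0. onorm_on X N (T t) \<le> C * exp (- \<omega> * t)"
proof -
  interpret b1: bounded_bilinear b\<^sub>1 by (rule bil1)
  obtain C1 where C1: "0 \<le> C1" "\<And>v v'. norm (b\<^sub>1 v v') \<le> norm v * norm v' * C1"
    using b1.nonneg_bounded by blast
  \<comment> \<open>The first summand makes the form coercive, the second absorbs \<open>R * P x\<close>.\<close>
  define L where "L = (C1 + 1) / k + \<bar>R\<bar> / \<kappa>\<^sub>0"
  have L_k: "C1 + 1 \<le> L * k"
  proof -
    have "0 \<le> \<bar>R\<bar> / \<kappa>\<^sub>0 * k" using k \<kappa> by simp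
    moreover have "(C1 + 1) / k * k = C1 + 1" using k by simp
    ultimately show ?thesis unfolding L_def distrib_right by linarith
  qed
  have L_R: "R \<le> L * \<kappa>\<^sub>0"
  proof -
    have "0 \<le> (C1 + 1) / k * \<kappa>\<^sub>0" using k \<kappa> C1 by simp
    moreover have "\<bar>R\<bar> / \<kappa>\<^sub>0 * \<kappa>\<^sub>0 = \<bar>R\<bar>" using \<kappa> by simp
    ultimately show ?thesis unfolding L_def distrib_right by linarith
  qed
  have L0: "L > 0"
  proof -
    have "(C1 + 1) / k > 0" "\<bar>R\<bar> / \<kappa>\<^sub>0 \<ge> 0" using k \<kappa> C1 by (simp_all add: add_nonneg_pos)
    then show ?thesis unfolding L_def by linarith
  qed
  define b where "b v v' = L * b\<^sub>0 v v' + b\<^sub>1 v v'" for v v'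
  have bil: "bounded_bilinear b"
    unfolding b_def[abs_def] by (intro bounded_bilinear_add bounded_bilinear_cmult bil0 bil1)
  obtain C where C: "0 \<le> C" "\<And>v v'. norm (b v v') \<le> norm v * norm v' * C"
    using bounded_bilinear.nonneg_bounded[OF bil] by blast
  define S where "S = C + 1"
  have den: "S > 0" using C by (simp add: S_def add_nonneg_pos)
  define w where "w = \<kappa>\<^sub>1 / (2 * S)"
  have w: "w > 0" using \<kappa> den by (simp add: w_def)
  show ?thesis
  proof (rule contraction_semigroup_exponential_decay[OF gen X e_add e_scale equiv bil _ zero_less_one _ w dense])
    show "1 * (norm (e x))\<^sup>2 \<le> b (e x) (e x)" if x: "x \<in> X" for x
    proof -
      have "L * (k * (norm (e x))\<^sup>2) \<le> L * b\<^sub>0 (e x) (e x)"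
        using coercive[OF x] L0 by (intro mult_left_mono) auto
      moreover have "- (C1 * (norm (e x))\<^sup>2) \<le> b\<^sub>1 (e x) (e x)"
        using C1(2)[of "e x" "e x"] by (simp add: power2_eq_square mult.commute abs_le_iff)
      moreover have "(C1 + 1) * (norm (e x))\<^sup>2 \<le> L * k * (norm (e x))\<^sup>2"
        using L_k by (intro mult_right_mono) auto
      ultimately show ?thesis unfolding b_def by (simp add: algebra_simps)
    qed
    show "b (e x) (e (A x)) + b (e (A x)) (e x) \<le> - 2 * w * b (e x) (e x)" if x: "x \<in> D" for x
    proof -
      have "b (e x) (e (A x)) + b (e (A x)) (e x)
        = L * (b\<^sub>0 (e x) (e (A x)) + b\<^sub>0 (e (A x)) (e x)) + (b\<^sub>1 (e x) (e (A x)) + b\<^sub>1 (e (A x)) (e x))"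
        by (simp add: b_def algebra_simps)
      also have "\<dots> \<le> L * (- \<kappa>\<^sub>0 * P x) + (- \<kappa>\<^sub>1 * (norm (e x))\<^sup>2 + R * P x)"
        using add_mono[OF mult_left_mono[OF diss0[OF x] less_imp_le[OF L0]] diss1[OF x]] .
      also have "\<dots> \<le> - \<kappa>\<^sub>1 * (norm (e x))\<^sup>2"
        using mult_right_mono[OF L_R P[OF x]] by (simp add: algebra_simps)
      also have "\<dots> \<le> - 2 * w * b (e x) (e x)"
      proof -
        have "b (e x) (e x) \<le> S * (norm (e x))\<^sup>2"
        proof -
          have "b (e x) (e x) \<le> (norm (e x))\<^sup>2 * C"
            using C(2)[of "e x" "e x"] by (simp add: power2_eq_square)
          then show ?thesis by (simp add: S_def algebra_simps add_increasing)
        qed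
        then have "2 * w * b (e x) (e x) \<le> 2 * w * (S * (norm (e x))\<^sup>2)"
          using w by (intro mult_left_mono) auto
        also have "\<dots> = \<kappa>\<^sub>1 * (norm (e x))\<^sup>2" using den by (simp add: w_def)
        finally show ?thesis by simp
      qed
      finally show ?thesis .
    qed
  qed
qed

section \<open>Linearity and boundary values in $H^1(0,1)$\<close>

lemma H1_add: "y \<in> H1 \<Longrightarrow> z \<in> H1 \<Longrightarrow> y + z \<in> H1"
  and wderiv_add: "y \<in> H1 \<Longrightarrow> z \<in> H1 \<Longrightarrow> wderiv (y + z) = wderiv y + wderiv z"
  and pval_add: "y \<in> H1 \<Longrightarrow> z \<in> H1 \<Longrightarrow> 0 \<le> x \<Longrightarrow> x \<le> 1 \<Longrightarrow> pval (y + z) x = pval y x + pval z x"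
  by (auto elim!: H1_cases simp: ac_add prim_add)

lemma H1_scaleR: "y \<in> H1 \<Longrightarrow> c *\<^sub>R y \<in> H1"
  and wderiv_scaleR: "y \<in> H1 \<Longrightarrow> wderiv (c *\<^sub>R y) = c *\<^sub>R wderiv y"
  and pval_scaleR: "y \<in> H1 \<Longrightarrow> 0 \<le> x \<Longrightarrow> x \<le> 1 \<Longrightarrow> pval (c *\<^sub>R y) x = c * pval y x"
  by (auto elim!: H1_cases simp: ac_scaleR prim_scaleR algebra_simps)

lemma l2_const_eq_ac: "l2_const c = ac c 0"
  by (simp add: ac_const)

lemma norm_l2_const_1: "norm (l2_const 1) \<le> 1"
  unfolding l2_const_def by (rule norm_abs_l2_le) auto

lemma prim_l2_const:
  assumes "0 \<le> x" "x \<le> 1" shows "prim (l2_const 1) x = x"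
  using prim_abs_l2_antiderivative[of "\<lambda>x. x" "\<lambda>_. 1" x] assms
  by (simp add: l2_const_def)

definition l2_pow :: "nat \<Rightarrow> l2" where
  "l2_pow n = abs_l2 (\<lambda>x. x ^ n)"

lemma l2_pow_0: "l2_pow 0 = l2_const 1"
  by (simp add: l2_pow_def l2_const_def)

lemma sq_integrable_power: "sq_integrable (\<lambda>x. x ^ n)"
  by (intro continuous_imp_sq_integrable continuous_intros)

lemma norm_l2_pow_le: "norm (l2_pow n) \<le> 1"
  unfolding l2_pow_def
  by (rule norm_abs_l2_le[OF sq_integrable_power]) (simp add: power_le_one)

lemma l2_pow_Suc_eq_ac: "l2_pow (Suc n) = ac 0 (real (Suc n) *\<^sub>R l2_pow n)"
proof -
  have "abs_l2 (\<lambda>x. x ^ Suc n) = ac (0 ^ Suc n) (abs_l2 (\<lambda>x. real (Suc n) * x ^ n))"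
    by (rule antiderivative_eq_ac)
      (auto intro!: derivative_eq_intros continuous_intros simp del: power_Suc)
  then show ?thesis by (simp add: l2_pow_def abs_l2_scaleR[OF sq_integrable_power] del: of_nat_Suc)
qed

lemma prim_l2_pow_at_1: "prim (real (Suc n) *\<^sub>R l2_pow n) 1 = 1"
proof -
  have "prim (abs_l2 (\<lambda>x. real (Suc n) * x ^ n)) 1 = 1 ^ Suc n - 0 ^ Suc n"
    by (rule prim_abs_l2_antiderivative)
      (auto intro!: derivative_eq_intros continuous_intros simp del: power_Suc)
  then show ?thesis by (simp add: l2_pow_def abs_l2_scaleR[OF sq_integrable_power] del: of_nat_Suc)
qed

lemma l2_pow_tendsto_0: "l2_pow \<longlonglongrightarrow> 0"
proof -
  have "(\<lambda>n. abs_l2 (\<lambda>x. x ^ n)) \<longlonglongrightarrow> abs_l2 (\<lambda>x. 0)"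
  proof (rule l2_tendsto_dominated[of _ _ "\<lambda>_. 1"])
    show "AE x in leb01. (\<lambda>n. x ^ n) \<longlonglongrightarrow> 0"
      by (rule AE_leb01I) (simp add: LIMSEQ_realpow_zero)
    show "AE x in leb01. \<bar>x ^ n - 0\<bar> \<le> 1" for n
      by (rule AE_leb01I) (simp add: power_le_one)
  qed (auto intro: sq_integrable_power)
  then show ?thesis by (simp add: l2_pow_def[abs_def] flip: zero_l2_def)
qed

lemma reflected_power_tendsto_0: "(\<lambda>n. abs_l2 (\<lambda>x. (1 - x) ^ n)) \<longlonglongrightarrow> 0"
proof -
  have "(\<lambda>n. abs_l2 (\<lambda>x. (1 - x) ^ n)) \<longlonglongrightarrow> abs_l2 (\<lambda>x. 0)"
  proof (rule l2_tendsto_dominated[of _ _ "\<lambda>_. 1"])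
    show "AE x in leb01. (\<lambda>n. (1 - x) ^ n) \<longlonglongrightarrow> 0"
      by (rule AE_leb01I) (simp add: LIMSEQ_realpow_zero)
    show "AE x in leb01. \<bar>(1 - x) ^ n - 0\<bar> \<le> 1" for n
      by (rule AE_leb01I) (simp add: power_le_one)
    show "sq_integrable (\<lambda>x. (1 - x) ^ n)" for n
      by (intro continuous_imp_sq_integrable continuous_intros)
  qed auto
  then show ?thesis by (simp flip: zero_l2_def)
qed

lemma l2_pow_Suc_H1: "l2_pow (Suc n) \<in> H1" "pval (l2_pow (Suc n)) 0 = 0" "pval (l2_pow (Suc n)) 1 = 1"
  by (simp_all add: l2_pow_Suc_eq_ac prim_l2_pow_at_1 del: of_nat_Suc)

lemma reflected_power_H1:
  fixes n :: nat
  defines "r \<equiv> abs_l2 (\<lambda>x. (1 - x) ^ Suc n)"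
  shows "r \<in> H1" "pval r 0 = 1" "pval r 1 = 0"
proof -
  let ?f = "\<lambda>x. - (real (Suc n) * (1 - x) ^ n)"
  have D: "((\<lambda>x. (1 - x) ^ Suc n) has_real_derivative ?f x) (at x within {0..1})" for x
    by (auto intro!: derivative_eq_intros simp del: power_Suc)
  have f: "continuous_on {0..1} ?f" by (intro continuous_intros)
  have "r = ac 1 (abs_l2 ?f)" using antiderivative_eq_ac[OF D f] by (simp add: r_def)
  moreover have "prim (abs_l2 ?f) 1 = -1" using prim_abs_l2_antiderivative[OF D f, of 1] by simp
  ultimately show "r \<in> H1" "pval r 0 = 1" "pval r 1 = 0" by simp_all
qed

text \<open>The $L^2$ norm does not see boundary values: a polynomial close to \<open>f\<close> is corrected by multiples of
  \<open>(1 - x)\<^sup>n\<close> and \<open>x\<^sup>n\<close>, which have the values \<open>1\<close> and \<open>0\<close> at the ends and tend to zero in norm.\<close>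

lemma H1_dense_with_boundary_values:
  assumes "\<epsilon> > 0"
  shows "\<exists>z\<in>H1. pval z 0 = p \<and> pval z 1 = q \<and> norm (f - z) < \<epsilon>"
proof -
  have "f \<in> closure {abs_l2 p |p. real_polynomial_function p}" by (simp add: polynomial_dense_l2)
  then obtain P where P: "real_polynomial_function P" "dist (abs_l2 P) f < \<epsilon> / 2"
    using assms unfolding closure_approachable by (auto dest: spec[of _ "\<epsilon> / 2"])
  obtain g where g: "abs_l2 P = ac (P 0) g" using polynomial_eq_ac[OF P(1)] by blast
  define y where "y = abs_l2 P"
  have y: "y \<in> H1" by (simp add: y_def g)
  define h where "h n = (p - pval y 0) *\<^sub>R abs_l2 (\<lambda>x. (1 - x) ^ Suc n) + (q - pval y 1) *\<^sub>R l2_pow (Suc n)" for n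
  have "h \<longlonglongrightarrow> (p - pval y 0) *\<^sub>R 0 + (q - pval y 1) *\<^sub>R 0"
    unfolding h_def[abs_def]
    by (intro tendsto_intros LIMSEQ_Suc[OF reflected_power_tendsto_0] LIMSEQ_Suc[OF l2_pow_tendsto_0])
  then have "h \<longlonglongrightarrow> 0" by simp
  then obtain n where n: "norm (h n) < \<epsilon> / 2"
    using assms by (metis LIMSEQ_D diff_zero half_gt_zero order_refl)
  have hH: "h n \<in> H1" and h0: "pval (h n) 0 = p - pval y 0" and h1: "pval (h n) 1 = q - pval y 1"
    unfolding h_def
    by (simp_all add: H1_add H1_scaleR pval_add pval_scaleR l2_pow_Suc_H1 reflected_power_H1 del: power_Suc)
  show ?thesis
  proof (intro bexI[of _ "y + h n"] conjI)
    have "norm (f - (y + h n)) \<le> norm (f - y) + norm (h n)"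
      using norm_triangle_ineq4[of "f - y" "h n"] by (simp add: algebra_simps)
    also have "\<dots> < \<epsilon>" using P(2) n by (simp add: y_def dist_norm norm_minus_commute)
    finally show "norm (f - (y + h n)) < \<epsilon>" .
  qed (use y hH h0 h1 in \<open>simp_all add: H1_add pval_add\<close>)
qed

lemma H1_times: "f \<in> H1 \<Longrightarrow> g \<in> H1 \<Longrightarrow> f \<odot> g \<in> H1"
  by (auto elim!: H1_cases simp: ac_times_ac)

lemma H1_ess_bounded:
  assumes "f \<in> H1" obtains B where "ess_bounded f B" "B \<ge> 0"
  using assms
proof (cases rule: H1_cases)
  case (1 c g)
  then show ?thesis using ess_bounded_ac[of c g] that by simp
qed

lemma H1_integration_by_parts:
  assumes "f \<in> H1" "g \<in> H1"
  shows "f \<bullet> wderiv g + wderiv f \<bullet> g = pval f 1 * pval g 1 - pval f 0 * pval g 0"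
proof -
  obtain c h d k where "f = ac c h" "g = ac d k" using assms by (metis H1_cases)
  then show ?thesis using integration_by_parts_l2[of c h k d] by (simp add: inner_commute)
qed

lemma l2_times_const_right:
  assumes "ess_bounded f B"
  shows "f \<odot> l2_const c = c *\<^sub>R f"
proof (rule l2_eqI)
  show "AE x in leb01. rep_l2 (f \<odot> l2_const c) x = rep_l2 (c *\<^sub>R f) x"
    using rep_l2_times[OF assms, of "l2_const c"] rep_l2_scaleR[of c f] rep_abs_l2[OF sq_integrable_const[of c]]
    unfolding l2_const_def by eventually_elim simp
qed

text \<open>The weight \<open>2 - x\<close> for the transported component \<open>u\<close>. It is positive and decreasing, so the
  weighted square of \<open>u\<close> loses mass as \<open>u\<close> moves from \<open>0\<close> to \<open>1\<close>; its end values \<open>2\<close> and \<open>1\<close> appear as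
  the boundary terms.\<close>

definition l2_weight :: l2 where
  "l2_weight = ac 2 (l2_const (-1))"

lemma l2_weight_identity:
  assumes "u \<in> H1"
  shows "2 * ((l2_weight \<odot> u) \<bullet> wderiv u) = (norm u)\<^sup>2 + (pval u 1)\<^sup>2 - 2 * (pval u 0)\<^sup>2"
proof -
  obtain d g where u: "u = ac d g" using H1_cases[OF assms] .
  let ?W = "l2_weight"
  have bW: "ess_bounded ?W (\<bar>2\<bar> + norm (l2_const (-1)))" unfolding l2_weight_def by (rule ess_bounded_ac)
  have bu: "ess_bounded u (\<bar>d\<bar> + norm g)" unfolding u by (rule ess_bounded_ac)
  have m1: "l2_const (-1) = - l2_const 1" by (simp add: l2_const_def abs_l2_scaleR[of "\<lambda>_. 1" "-1", simplified, symmetric])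
  have Wu: "?W \<odot> u = ac (2 * d) (?W \<odot> g + u \<odot> l2_const (-1))"
    unfolding l2_weight_def u by (rule ac_times_ac)
  have H: "?W \<odot> u \<in> H1" unfolding Wu by simp
  have dW: "wderiv (?W \<odot> u) = ?W \<odot> g - u"
    unfolding Wu by (simp add: l2_times_const_right[OF bu])
  have pu: "pval u 0 = d" "pval u 1 = d + prim g 1" by (simp_all add: u)
  have p0: "pval (?W \<odot> u) 0 = 2 * pval u 0" unfolding Wu pu by simp
  have p1: "pval (?W \<odot> u) 1 = pval u 1"
  proof -
    have "(2 + prim (l2_const (-1)) 1) * (d + prim g 1) = 2 * d + prim (?W \<odot> g + u \<odot> l2_const (-1)) 1"
      unfolding l2_weight_def u by (rule prim_product) auto
    moreover have "prim (l2_const (-1)) 1 = -1"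
      using prim_scaleR[of "-1" "l2_const 1" 1] by (simp add: m1 prim_l2_const)
    ultimately show ?thesis unfolding Wu pu by simp
  qed
  have wu: "wderiv u = g" unfolding u by simp
  have "(?W \<odot> u) \<bullet> wderiv u + wderiv (?W \<odot> u) \<bullet> u = pval u 1 * pval u 1 - 2 * pval u 0 * pval u 0"
    using H1_integration_by_parts[OF H assms] unfolding p0 p1 .
  moreover have "(?W \<odot> g) \<bullet> u = (?W \<odot> u) \<bullet> g" by (rule l2_times_selfadjoint[OF bW])
  ultimately show ?thesis
    unfolding dW wu power2_norm_eq_inner by (simp add: inner_diff_left power2_eq_square)
qed

lemma bounded_linear_l2_times:
  assumes "ess_bounded f B" "B \<ge> 0"
  shows "bounded_linear (\<lambda>g. f \<odot> g)"
  by (rule bounded_linear_intro[where K=B])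
    (use norm_l2_times_le[OF assms] in \<open>simp_all add: l2_times_add_right[OF assms(1)]
      l2_times_scaleR_right[OF assms(1)] mult.commute\<close>)

section \<open>The crane state space as a subspace of a fixed inner product space\<close>

type_synonym coord_space = "l2 \<times> l2 \<times> l2 \<times> l2 \<times> real \<times> real"

text \<open>On the product of four copies of $L^2(0,1)$ and two of the real line, the product norm of the state
  space becomes the norm of the type, once the weak derivative of \<open>y\<close> is recorded as a component.\<close>

definition coords :: "state \<Rightarrow> coord_space" where
  "coords = (\<lambda>(y, z, u, \<xi>, \<eta>). (y, wderiv y, z, u, \<xi>, \<eta>))"

lemma norm_coords: "norm (coords \<Phi>) = product_norm \<Phi>"
  by (cases \<Phi>) (simp add: coords_def product_norm_def norm_Pair H1_norm_def ac_simps)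

lemma norm_coords_sq:
  "(norm (coords (y, z, u, \<xi>, \<eta>)))\<^sup>2
    = (norm y)\<^sup>2 + (norm (wderiv y))\<^sup>2 + (norm z)\<^sup>2 + (norm u)\<^sup>2 + \<xi>\<^sup>2 + \<eta>\<^sup>2"
  by (simp add: coords_def norm_Pair)

lemma coords_add: "\<Phi> \<in> crane_space \<Longrightarrow> \<Psi> \<in> crane_space \<Longrightarrow> coords (\<Phi> + \<Psi>) = coords \<Phi> + coords \<Psi>"
  by (cases \<Phi>; cases \<Psi>) (simp add: coords_def crane_space_def wderiv_add)

lemma coords_scaleR: "\<Phi> \<in> crane_space \<Longrightarrow> coords (c *\<^sub>R \<Phi>) = c *\<^sub>R coords \<Phi>"
  by (cases \<Phi>) (simp add: coords_def crane_space_def wderiv_scaleR)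

lemma subspace_crane_space: "subspace crane_space"
  using H1_scaleR[of "l2_const 0" 0]
  by (auto simp: subspace_def crane_space_def H1_add H1_scaleR zero_prod_def l2_const_eq_ac)

abbreviation "y_of v \<equiv> fst (v::coord_space)"
abbreviation "dy_of v \<equiv> fst (snd (v::coord_space))"
abbreviation "z_of v \<equiv> fst (snd (snd (v::coord_space)))"
abbreviation "u_of v \<equiv> fst (snd (snd (snd (v::coord_space))))"
abbreviation "xi_of v \<equiv> fst (snd (snd (snd (snd (v::coord_space)))))"
abbreviation "eta_of v \<equiv> snd (snd (snd (snd (snd (v::coord_space)))))"

text \<open>The end values of \<open>y\<close> as bounded functionals of \<open>y\<close> and \<open>y\<^sub>x\<close>, defined on the whole coordinate
  space: integration by parts against \<open>1 - x\<close> and \<open>x\<close>.\<close>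

definition left_value :: "coord_space \<Rightarrow> real" where
  "left_value v = y_of v \<bullet> l2_const 1 - dy_of v \<bullet> (l2_const 1 - l2_pow 1)"

definition right_value :: "coord_space \<Rightarrow> real" where
  "right_value v = y_of v \<bullet> l2_const 1 + dy_of v \<bullet> l2_pow 1"

lemma end_values:
  assumes "y \<in> H1"
  shows "pval y 0 = left_value (coords (y, z, u, \<xi>, \<eta>))" "pval y 1 = right_value (coords (y, z, u, \<xi>, \<eta>))"
proof -
  obtain c g where y: "y = ac c g" using assms by (rule H1_cases)
  have x: "l2_pow (Suc 0) = ac 0 (l2_const 1)" using l2_pow_Suc_eq_ac[of 0] by (simp add: l2_pow_0)
  have "ac c g \<bullet> l2_const 1 + l2_pow 1 \<bullet> g = pval y 1"
    using integration_by_parts_l2[of c g "l2_const 1" 0] by (simp add: x y prim_l2_const)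
  moreover have "g \<bullet> l2_const 1 = pval y 1 - pval y 0" by (simp add: y prim_at_1)
  ultimately show "pval y 0 = left_value (coords (y, z, u, \<xi>, \<eta>))" "pval y 1 = right_value (coords (y, z, u, \<xi>, \<eta>))"
    by (simp_all add: left_value_def right_value_def coords_def y inner_diff_right inner_commute)
qed

lemma norm_y_of_le: "norm (y_of v) \<le> norm v"
  and norm_dy_of_le: "norm (dy_of v) \<le> norm v"
  using norm_fst_le[of "fst v" "snd v"] norm_snd_le[of "snd v" "fst v"] norm_fst_le[of "dy_of v" "snd (snd v)"]
  by auto

lemma abs_left_value_le: "\<bar>left_value v\<bar> \<le> 3 * norm v"
proof -
  have "\<bar>y_of v \<bullet> l2_const 1\<bar> \<le> norm (y_of v) * norm (l2_const 1)" by (rule Cauchy_Schwarz_ineq2)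
  also have "\<dots> \<le> norm v * 1" by (intro mult_mono norm_y_of_le norm_l2_const_1) auto
  finally have 1: "\<bar>y_of v \<bullet> l2_const 1\<bar> \<le> norm v" by simp
  have "\<bar>dy_of v \<bullet> (l2_const 1 - l2_pow 1)\<bar> \<le> norm (dy_of v) * norm (l2_const 1 - l2_pow 1)"
    by (rule Cauchy_Schwarz_ineq2)
  also have "norm (l2_const 1 - l2_pow 1) \<le> 1 + 1"
    by (rule order_trans[OF norm_triangle_ineq4 add_mono[OF norm_l2_const_1 norm_l2_pow_le]])
  also have "norm (dy_of v) \<le> norm v" by (rule norm_dy_of_le)
  finally have "\<bar>dy_of v \<bullet> (l2_const 1 - l2_pow 1)\<bar> \<le> norm v * 2" by (simp add: mult_left_mono mult_right_mono)
  then show ?thesis using 1 unfolding left_value_def by linarith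
qed

lemmas projection_intros = bounded_linear_fst_comp bounded_linear_snd_comp bounded_linear_ident

lemma bounded_linear_left_value: "bounded_linear left_value"
  unfolding left_value_def[abs_def]
  by (intro bounded_linear_sub bounded_linear_inner_left_comp projection_intros)

lemma bounded_linear_right_value: "bounded_linear right_value"
  unfolding right_value_def[abs_def]
  by (intro bounded_linear_add bounded_linear_inner_left_comp projection_intros)

lemmas bounded_bilinear_inner_comp = bounded_bilinear.comp[OF bounded_bilinear_inner]
lemmas bounded_bilinear_mult_comp = bounded_bilinear.comp[OF bounded_bilinear_mult[where 'a = real]]

section \<open>The Lyapunov functional of the overhead crane\<close>

text \<open>The real inequality behind the dissipation of the correction form. Here \<open>r\<close>, \<open>s\<close>, \<open>g\<close>, \<open>un\<close> stand
  for the norms of the state, of \<open>z\<close>, of \<open>y\<^sub>x\<close> and of \<open>u\<close>; \<open>v\<close> is \<open>u(1)\<close>, \<open>Y\<close> the elastic energy, and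
  \<open>zy\<close>, \<open>xz\<close>, \<open>q\<close>, \<open>pg\<close>, \<open>w1\<close> are the inner products that occur, with \<open>\<epsilon>\<close> the norm of the power \<open>x\<^sup>k\<close>.
  Every cross term has one of \<open>s\<close>, \<open>\<xi>\<close>, \<open>v\<close> as a factor and is split by Young's inequality, except
  \<open>w1 * pg\<close>, which is absorbed into half of \<open>Y\<close> because \<open>\<epsilon>\<close> is small.\<close>

lemma correction_estimate:
  fixes r s g un \<xi> \<eta> v :: real
  assumes r: "0 \<le> r" and s: "0 \<le> s" "s \<le> r" and g: "0 \<le> g" "g \<le> r" and \<eta>: "\<bar>\<eta>\<bar> \<le> r"
    and zy: "\<bar>zy\<bar> \<le> s * r" and y0: "\<bar>y0\<bar> \<le> 3 * r" and xz: "\<bar>xz\<bar> \<le> s" and q: "\<bar>q\<bar> \<le> s"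
    and pg: "\<bar>pg\<bar> \<le> \<epsilon> * g" and w1: "\<bar>w1\<bar> \<le> A * g" and \<epsilon>: "0 \<le> \<epsilon>" "\<epsilon> \<le> 1" "3 * A * \<epsilon> \<le> a\<^sub>0 / 2"
    and Y: "a\<^sub>0 * g\<^sup>2 \<le> Y"
    and energy: "c * r\<^sup>2 \<le> H * (g\<^sup>2 + s\<^sup>2 + un\<^sup>2 + \<xi>\<^sup>2 + \<eta>\<^sup>2)"
    and pos: "c > 0" "H > 0" "m > 0" "M > 0" "\<alpha> > 0" "\<beta> > 0" "\<sigma> > 0" "a\<^sub>0 > 0" "k \<ge> 0" "A > 0"
  defines "\<mu> \<equiv> min 1 (min (2 * M) (a\<^sub>0 / 2))"
  defines "\<kappa> \<equiv> \<mu> * c / H" and "L \<equiv> 4 * \<sigma> + 3 * M * k + 3 + 3 * \<alpha> + 3 * \<beta>"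
  shows "- (un\<^sup>2 + v\<^sup>2 - 2 * \<xi>\<^sup>2) + (s\<^sup>2 + m * \<xi>\<^sup>2 + M * \<eta>\<^sup>2 - Y - \<sigma> * zy + (\<alpha> * v - \<beta> * \<xi>) * y0)
      - 3 * ((M * \<eta> + xz) * (\<eta> - k * q) - (w1 + \<sigma> * xz) * pg)
    \<le> - (\<kappa> / 2) * r\<^sup>2 + (3 + m + 3 * k + \<mu> + 3 * L\<^sup>2 / (2 * \<kappa>)) * (s\<^sup>2 + \<xi>\<^sup>2 + v\<^sup>2)"
proof -
  define P where "P = s\<^sup>2 + \<xi>\<^sup>2 + v\<^sup>2"
  define t where "t = s + \<bar>\<xi>\<bar> + \<bar>v\<bar>"
  have \<mu>: "\<mu> > 0" "\<mu> \<le> 1" "\<mu> \<le> 2 * M" "\<mu> \<le> a\<^sub>0 / 2" using pos by (auto simp: \<mu>_def)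
  have \<kappa>: "\<kappa> > 0" using \<mu> pos by (simp add: \<kappa>_def)
  have prod_le: "x * y \<le> b * d" if "\<bar>x\<bar> \<le> b" "\<bar>y\<bar> \<le> d" for x y b d :: real
    using mult_mono[OF that order_trans[OF abs_ge_zero that(1)] abs_ge_zero] abs_ge_self[of "x * y"]
    by (simp add: abs_mult)
  have T1: "- (\<sigma> * zy) \<le> \<sigma> * (s * r)"
    using zy pos by (metis abs_le_iff less_imp_le mult_left_mono mult_minus_right)
  have T2: "(\<alpha> * v - \<beta> * \<xi>) * y0 \<le> (\<alpha> * \<bar>v\<bar> + \<beta> * \<bar>\<xi>\<bar>) * (3 * r)"
    by (rule prod_le[OF _ y0], rule order_trans[OF abs_triangle_ineq4]) (use pos in \<open>simp add: abs_mult\<close>)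
  have T3: "- ((M * \<eta> + xz) * (\<eta> - k * q)) \<le> - (M * \<eta>\<^sup>2) + M * k * (r * s) + s * r + k * (s * s)"
  proof -
    have "M * k * (\<eta> * q) \<le> M * k * (r * s)" using pos by (intro mult_left_mono prod_le \<eta> q) auto
    moreover have "(- xz) * \<eta> \<le> s * r" by (rule prod_le) (use xz \<eta> in auto)
    moreover have "k * (xz * q) \<le> k * (s * s)" using pos by (intro mult_left_mono prod_le xz q) auto
    ultimately show ?thesis by (simp add: algebra_simps power2_eq_square)
  qed
  have T4: "3 * ((w1 + \<sigma> * xz) * pg) \<le> a\<^sub>0 / 2 * g\<^sup>2 + 3 * \<sigma> * (s * r)"
  proof -
    have "(w1 + \<sigma> * xz) * pg \<le> (A * g + \<sigma> * s) * (\<epsilon> * g)"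
    proof (rule prod_le[OF _ pg])
      have "\<bar>\<sigma> * xz\<bar> \<le> \<sigma> * s" using xz pos by (simp add: abs_mult)
      then show "\<bar>w1 + \<sigma> * xz\<bar> \<le> A * g + \<sigma> * s" using w1 by linarith
    qed
    also have "\<dots> = A * \<epsilon> * g\<^sup>2 + \<sigma> * (s * (\<epsilon> * g))" by (simp add: algebra_simps power2_eq_square)
    finally have "3 * ((w1 + \<sigma> * xz) * pg) \<le> 3 * A * \<epsilon> * g\<^sup>2 + 3 * \<sigma> * (s * (\<epsilon> * g))" by simp
    also have "\<dots> \<le> a\<^sub>0 / 2 * g\<^sup>2 + 3 * \<sigma> * (s * r)"
    proof (intro add_mono mult_right_mono mult_left_mono)
      show "\<epsilon> * g \<le> r" using mult_left_le_one_le[OF g(1) \<epsilon>(1,2)] g by linarith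
    qed (use \<epsilon> s pos in auto)
    finally show ?thesis .
  qed
  have T5: "\<kappa> * r\<^sup>2 \<le> \<mu> * (g\<^sup>2 + s\<^sup>2 + un\<^sup>2 + \<xi>\<^sup>2 + \<eta>\<^sup>2)"
    using mult_left_mono[OF energy, of "\<mu> / H"] \<mu> pos by (simp add: \<kappa>_def)
  have T6: "\<mu> * un\<^sup>2 \<le> un\<^sup>2" "\<mu> * \<eta>\<^sup>2 \<le> 2 * M * \<eta>\<^sup>2" "\<mu> * g\<^sup>2 \<le> a\<^sub>0 / 2 * g\<^sup>2"
    using mult_right_mono[OF \<mu>(2), of "un\<^sup>2"] mult_right_mono[OF \<mu>(3), of "\<eta>\<^sup>2"]
      mult_right_mono[OF \<mu>(4), of "g\<^sup>2"] by auto
  have T7: "L * (t * r) \<le> \<kappa> / 2 * r\<^sup>2 + 3 * L\<^sup>2 / (2 * \<kappa>) * P"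
  proof -
    have "0 \<le> (\<kappa> * r - L * t)\<^sup>2 / (2 * \<kappa>)" using \<kappa> by simp
    also have "\<dots> = \<kappa> / 2 * r\<^sup>2 - L * (t * r) + L\<^sup>2 / (2 * \<kappa>) * t\<^sup>2"
      using \<kappa> by (simp add: power2_eq_square field_simps)
    finally have "L * (t * r) \<le> \<kappa> / 2 * r\<^sup>2 + L\<^sup>2 / (2 * \<kappa>) * t\<^sup>2" by simp
    also have "L\<^sup>2 / (2 * \<kappa>) * t\<^sup>2 \<le> L\<^sup>2 / (2 * \<kappa>) * (3 * P)"
    proof (rule mult_left_mono)
      have "2 * s * \<bar>\<xi>\<bar> \<le> s\<^sup>2 + \<xi>\<^sup>2" "2 * s * \<bar>v\<bar> \<le> s\<^sup>2 + v\<^sup>2" "2 * \<bar>\<xi>\<bar> * \<bar>v\<bar> \<le> \<xi>\<^sup>2 + v\<^sup>2"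
        using sum_squares_bound[of s "\<bar>\<xi>\<bar>"] sum_squares_bound[of s "\<bar>v\<bar>"] sum_squares_bound[of "\<bar>\<xi>\<bar>" "\<bar>v\<bar>"]
        by (simp_all only: power2_abs)
      then show "t\<^sup>2 \<le> 3 * P"
        unfolding t_def P_def power2_eq_square[of "s + \<bar>\<xi>\<bar> + \<bar>v\<bar>"]
        by (simp add: algebra_simps power2_eq_square)
    qed (use \<kappa> in simp)
    finally show ?thesis by simp
  qed
  have T8: "(4 * \<sigma> + 3 * M * k + 3) * (s * r) + (\<alpha> * \<bar>v\<bar> + \<beta> * \<bar>\<xi>\<bar>) * (3 * r) \<le> L * (t * r)"
  proof -
    have nn: "0 \<le> s * r" "0 \<le> \<bar>\<xi>\<bar> * r" "0 \<le> \<bar>v\<bar> * r" "0 \<le> M * k" using s r pos by auto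
    have "(4 * \<sigma> + 3 * M * k + 3) * (s * r) \<le> L * (s * r)" "3 * \<alpha> * (\<bar>v\<bar> * r) \<le> L * (\<bar>v\<bar> * r)"
      "3 * \<beta> * (\<bar>\<xi>\<bar> * r) \<le> L * (\<bar>\<xi>\<bar> * r)"
      using pos nn by (auto simp: L_def intro!: mult_right_mono)
    then show ?thesis by (simp add: t_def algebra_simps)
  qed
  have T9: "(1 + 3 * k + \<mu>) * s\<^sup>2 + (2 + m + \<mu>) * \<xi>\<^sup>2 - v\<^sup>2 \<le> (3 + m + 3 * k + \<mu>) * P"
  proof -
    have "(1 + 3 * k + \<mu>) * s\<^sup>2 \<le> (3 + m + 3 * k + \<mu>) * s\<^sup>2"
      "(2 + m + \<mu>) * \<xi>\<^sup>2 \<le> (3 + m + 3 * k + \<mu>) * \<xi>\<^sup>2" "0 \<le> (3 + m + 3 * k + \<mu>) * v\<^sup>2"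
      using pos \<mu> by (auto intro!: mult_right_mono mult_nonneg_nonneg)
    then show ?thesis unfolding P_def distrib_left using zero_le_power2[of v] by linarith
  qed
  have "- (un\<^sup>2 + v\<^sup>2 - 2 * \<xi>\<^sup>2) + (s\<^sup>2 + m * \<xi>\<^sup>2 + M * \<eta>\<^sup>2 - Y - \<sigma> * zy + (\<alpha> * v - \<beta> * \<xi>) * y0)
      - 3 * ((M * \<eta> + xz) * (\<eta> - k * q) - (w1 + \<sigma> * xz) * pg)
    \<le> - un\<^sup>2 - v\<^sup>2 + 2 * \<xi>\<^sup>2 + s\<^sup>2 + m * \<xi>\<^sup>2 + M * \<eta>\<^sup>2 - a\<^sub>0 * g\<^sup>2 + \<sigma> * (s * r)
      + (\<alpha> * \<bar>v\<bar> + \<beta> * \<bar>\<xi>\<bar>) * (3 * r)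
      + 3 * (- (M * \<eta>\<^sup>2) + M * k * (r * s) + s * r + k * (s * s)) + (a\<^sub>0 / 2 * g\<^sup>2 + 3 * \<sigma> * (s * r))"
  proof -
    have "p + (q - Y - x5 + x3) - 3 * (x1 - x2) \<le> p + q - a\<^sub>0 * g\<^sup>2 + r5 + r3 + 3 * r1 + r2"
      if "- x5 \<le> r5" "x3 \<le> r3" "- x1 \<le> r1" "3 * x2 \<le> r2" for p q x1 x2 x3 x5 r1 r2 r3 r5
      using that Y by (simp add: algebra_simps)
    from this[OF T1 T2 T3 T4, of "- (un\<^sup>2 + v\<^sup>2 - 2 * \<xi>\<^sup>2)" "s\<^sup>2 + m * \<xi>\<^sup>2 + M * \<eta>\<^sup>2"]
    show ?thesis by (simp only: minus_diff_eq minus_add_distrib diff_conv_add_uminus add.assoc minus_minus)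
  qed
  also have "\<dots> = - un\<^sup>2 - 2 * M * \<eta>\<^sup>2 - a\<^sub>0 / 2 * g\<^sup>2 + (1 + 3 * k) * s\<^sup>2 + (2 + m) * \<xi>\<^sup>2 - v\<^sup>2
      + ((4 * \<sigma> + 3 * M * k + 3) * (s * r) + (\<alpha> * \<bar>v\<bar> + \<beta> * \<bar>\<xi>\<bar>) * (3 * r))"
    by (simp add: algebra_simps power2_eq_square)
  also have "\<dots> \<le> - \<mu> * un\<^sup>2 - \<mu> * \<eta>\<^sup>2 - \<mu> * g\<^sup>2 + (1 + 3 * k) * s\<^sup>2 + (2 + m) * \<xi>\<^sup>2 - v\<^sup>2 + L * (t * r)"
    using T6 T8 by linarith
  also have "\<dots> = - (\<mu> * (g\<^sup>2 + s\<^sup>2 + un\<^sup>2 + \<xi>\<^sup>2 + \<eta>\<^sup>2)) + ((1 + 3 * k + \<mu>) * s\<^sup>2 + (2 + m + \<mu>) * \<xi>\<^sup>2 - v\<^sup>2) + L * (t * r)"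
    by (simp add: algebra_simps)
  also have "\<dots> \<le> - (\<kappa> * r\<^sup>2) + (3 + m + 3 * k + \<mu>) * P + (\<kappa> / 2 * r\<^sup>2 + 3 * L\<^sup>2 / (2 * \<kappa>) * P)"
    using T5 T7 T9 by linarith
  also have "\<dots> = - (\<kappa> / 2) * r\<^sup>2 + (3 + m + 3 * k + \<mu> + 3 * L\<^sup>2 / (2 * \<kappa>)) * P"
    by (simp add: algebra_simps)
  finally show ?thesis by (simp only: P_def)
qed

locale overhead_crane =
  fixes m M \<alpha> \<beta> \<sigma> \<tau> K varpi a\<^sub>0 :: real and a :: l2
  assumes pos: "m > 0" "M > 0" "\<alpha> > 0" "\<beta> > 0" "\<sigma> > 0" "\<tau> > 0" "a\<^sub>0 > 0"
    and a: "a \<in> H1" "\<forall>x\<in>{0..1}. pval a x \<ge> a\<^sub>0"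
    and params: "\<alpha> < \<beta>" "\<alpha> < K" "K < 2 * \<beta> - \<alpha>"
    and equiv: "equivalent_norms_on crane_space (crane_norm m M \<alpha> \<beta> \<sigma> \<tau> K varpi a) product_norm"
begin

definition J :: "coord_space \<Rightarrow> real" where
  "J v = \<sigma> * (y_of v \<bullet> l2_const 1) + z_of v \<bullet> l2_const 1 + m * xi_of v + M * eta_of v
     + (\<beta> - \<alpha>) * left_value v + \<tau> * \<alpha> * (u_of v \<bullet> l2_const 1)"

text \<open>The inner product of the state space in coordinates.\<close>

definition energy_form :: "coord_space \<Rightarrow> coord_space \<Rightarrow> real" where
  "energy_form v w = (a \<odot> dy_of v) \<bullet> dy_of w + z_of v \<bullet> z_of w + K * \<tau> * (u_of v \<bullet> u_of w) + m * (xi_of v * xi_of w)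
     + M * (eta_of v * eta_of w) + varpi * (J v * J w)"

text \<open>The bilinear forms of the three correction terms: the weighted transport term, the equipartition
  term, and the product of \<open>M\<eta> + \<integral>x z\<close> with \<open>- \<integral>x\<^bsup>n+1\<^esup> y\<^sub>x\<close>. The second term contributes \<open>M\<eta>\<^sup>2\<close> to the
  derivative and the third \<open>- M\<eta>\<^sup>2\<close> for every unit of its coefficient, so the coefficient \<open>3\<close> leaves
  \<open>- 2M\<eta>\<^sup>2\<close>.\<close>

definition correction_form :: "nat \<Rightarrow> coord_space \<Rightarrow> coord_space \<Rightarrow> real" where
  "correction_form n v w = \<tau> * ((l2_weight \<odot> u_of v) \<bullet> u_of w)
     + (z_of v \<bullet> y_of w + m * (xi_of v * left_value w) + M * (eta_of v * right_value w))
     + (- 3) * ((M * eta_of v + z_of v \<bullet> l2_pow 1) * (dy_of w \<bullet> l2_pow (Suc n)))"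

lemma crane_J_eq:
  assumes "\<Phi> \<in> crane_space" shows "crane_J m M \<alpha> \<beta> \<sigma> \<tau> \<Phi> = J (coords \<Phi>)"
proof (cases \<Phi>)
  case (fields y z u \<xi> \<eta>)
  then have "left_value (y, wderiv y, z, u, \<xi>, \<eta>) = pval y 0"
    using assms end_values(1)[of y z u \<xi> \<eta>] by (simp add: crane_space_def coords_def)
  then show ?thesis
    by (simp add: fields crane_J_def J_def l2_integral_eq_inner inner_add_left coords_def)
qed

lemma crane_norm_eq:
  "\<Phi> \<in> crane_space \<Longrightarrow> crane_norm m M \<alpha> \<beta> \<sigma> \<tau> K varpi a \<Phi> = sqrt (energy_form (coords \<Phi>) (coords \<Phi>))"
  using crane_J_eq[of \<Phi>]
  by (cases \<Phi>) (simp add: crane_norm_def crane_inner_def energy_form_def, simp add: coords_def ac_simps)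

lemma bounded_linear_J: "bounded_linear J"
  unfolding J_def[abs_def]
  by (intro bounded_linear_add bounded_linear_const_mult bounded_linear_inner_left_comp
      bounded_linear_left_value projection_intros)

lemma obtain_a_bound: obtains A where "ess_bounded a A" "A > 0"
proof -
  obtain B where "ess_bounded a B" "B \<ge> 0" using H1_ess_bounded[OF a(1)] .
  moreover from this have "ess_bounded a (B + 1)" unfolding ess_bounded_def by (auto elim!: AE_mp)
  ultimately show ?thesis using that[of "B + 1"] by simp
qed

lemma a_lower_bound: "AE x in leb01. a\<^sub>0 \<le> rep_l2 a x"
proof -
  obtain c g where ac: "a = ac c g" using a(1) by (rule H1_cases)
  show ?thesis using rep_ac[of c g] AE_space
  proof eventually_elim
    case (elim x)
    then show ?case using bspec[OF a(2), of x] by (simp add: ac)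
  qed
qed

lemma bounded_bilinear_energy_form: "bounded_bilinear energy_form"
proof -
  obtain A where A: "ess_bounded a A" "A > 0" by (rule obtain_a_bound)
  have "bounded_linear (\<lambda>v::coord_space. a \<odot> dy_of v)"
    by (rule bounded_linear_compose[OF bounded_linear_l2_times[OF A(1)]])
      (use A in simp, intro projection_intros)
  then show ?thesis
    unfolding energy_form_def[abs_def]
    by (intro bounded_bilinear_add bounded_bilinear_cmult bounded_bilinear_inner_comp
      bounded_bilinear_mult_comp bounded_linear_J projection_intros)
qed

lemma bounded_bilinear_correction_form: "bounded_bilinear (correction_form n)"
proof -
  have "bounded_linear (\<lambda>v::coord_space. l2_weight \<odot> u_of v)"
    unfolding l2_weight_def
    by (rule bounded_linear_compose[OF bounded_linear_l2_times[OF ess_bounded_ac]])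
      (simp, intro projection_intros)
  then show ?thesis
    unfolding correction_form_def[abs_def]
    by (intro bounded_bilinear_add bounded_bilinear_cmult bounded_bilinear_inner_comp
      bounded_bilinear_mult_comp bounded_linear_left_value bounded_linear_right_value
      bounded_linear_add bounded_linear_const_mult bounded_linear_inner_left_comp projection_intros)
qed

abbreviation "X\<^sub>0 \<equiv> crane_space0 m M \<alpha> \<beta> \<sigma> \<tau>"
abbreviation "D\<^sub>0 \<equiv> crane_dom0 m M \<alpha> \<beta> \<sigma> \<tau>"
abbreviation "A\<^sub>0 \<equiv> crane_op m M \<alpha> \<beta> \<sigma> \<tau> a"
abbreviation "N\<^sub>0 \<equiv> crane_norm m M \<alpha> \<beta> \<sigma> \<tau> K varpi a"

lemma X0_iff: "\<Phi> \<in> X\<^sub>0 \<longleftrightarrow> \<Phi> \<in> crane_space \<and> J (coords \<Phi>) = 0"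
  unfolding crane_space0_def using crane_J_eq[of \<Phi>] by (cases "\<Phi> \<in> crane_space") simp_all

lemma subspace_X0: "subspace X\<^sub>0"
proof -
  interpret J: bounded_linear J by (rule bounded_linear_J)
  show ?thesis
    using subspace_crane_space coords_scaleR[of 0 0]
    by (auto simp: subspace_def X0_iff coords_add coords_scaleR J.add J.scaleR J.zero)
qed

lemma D0_subset_X0: "D\<^sub>0 \<subseteq> X\<^sub>0"
  by (auto simp: crane_dom0_def)

lemma D0_cases:
  assumes "\<Phi> \<in> D\<^sub>0"
  obtains y z u where "\<Phi> = (y, z, u, pval z 0, pval z 1)" "y \<in> H1" "wderiv y \<in> H1" "z \<in> H1" "u \<in> H1"
    "pval u 0 = pval z 0" "J (coords (y, z, u, pval z 0, pval z 1)) = 0"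
  using assms by (cases \<Phi>) (auto simp: crane_dom0_def crane_dom_def H2_def X0_iff)

text \<open>The part of the state whose dissipation the energy itself provides.\<close>

definition observed :: "state \<Rightarrow> real" where
  "observed = (\<lambda>(y, z, u, \<xi>, \<eta>). (norm z)\<^sup>2 + \<xi>\<^sup>2 + (pval u 1)\<^sup>2)"

text \<open>The boundary values of \<open>w\<close> cancel between the string, the trolley and the load. The delayed term is
  split symmetrically between \<open>\<xi>\<^sup>2\<close> and \<open>u(1)\<^sup>2\<close>, which leaves the positive coefficients \<open>2\<beta> - K - \<alpha>\<close> and
  \<open>K - \<alpha>\<close>.\<close>

lemma energy_dissipation:
  assumes "\<Phi> \<in> D\<^sub>0"
  shows "energy_form (coords \<Phi>) (coords (A\<^sub>0 \<Phi>)) + energy_form (coords (A\<^sub>0 \<Phi>)) (coords \<Phi>)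
    \<le> - min (2 * \<sigma>) (min (2 * \<beta> - K - \<alpha>) (K - \<alpha>)) * observed \<Phi>"
proof -
  obtain y z u where \<Phi>: "\<Phi> = (y, z, u, pval z 0, pval z 1)" and H: "y \<in> H1" "wderiv y \<in> H1" "z \<in> H1" "u \<in> H1"
    and u0: "pval u 0 = pval z 0" and J0: "J (coords (y, z, u, pval z 0, pval z 1)) = 0"
    using D0_cases[OF assms] .
  obtain A where A: "ess_bounded a A" "A > 0" by (rule obtain_a_bound)
  define w where "w = a \<odot> wderiv y"
  have wH: "w \<in> H1" unfolding w_def by (rule H1_times[OF a(1) H(2)])
  define \<xi> where "\<xi> = pval z 0"
  define \<eta> where "\<eta> = pval z 1"
  define v where "v = pval u 1"
  have ibp: "w \<bullet> wderiv z + wderiv w \<bullet> z = pval w 1 * \<eta> - pval w 0 * \<xi>"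
    unfolding \<xi>_def \<eta>_def by (rule H1_integration_by_parts[OF wH H(3)])
  have ibu: "2 * (u \<bullet> wderiv u) = v\<^sup>2 - \<xi>\<^sup>2"
    using H1_integration_by_parts[OF H(4) H(4)] by (simp add: v_def \<xi>_def u0 inner_commute power2_eq_square)
  have sa: "(a \<odot> wderiv z) \<bullet> wderiv y = w \<bullet> wderiv z"
    unfolding w_def by (rule l2_times_selfadjoint[OF A(1)])
  have coords\<Phi>: "coords \<Phi> = (y, wderiv y, z, u, \<xi>, \<eta>)" by (simp add: coords_def \<Phi> \<xi>_def \<eta>_def)
  have coordsA: "coords (A\<^sub>0 \<Phi>) = (z, wderiv z, wderiv w - \<sigma> *\<^sub>R z, - (1 / \<tau>) *\<^sub>R wderiv u,
      (1 / m) * (pval w 0 - \<beta> * \<xi> + \<alpha> * v), - pval w 1 / M)"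
    by (simp add: coords_def crane_op_def \<Phi> w_def \<xi>_def v_def)
  have J0': "J (coords \<Phi>) = 0" using J0 by (simp add: \<Phi>)
  have "energy_form (coords \<Phi>) (coords (A\<^sub>0 \<Phi>)) + energy_form (coords (A\<^sub>0 \<Phi>)) (coords \<Phi>)
     = 2 * (w \<bullet> wderiv z + wderiv w \<bullet> z - \<sigma> * (z \<bullet> z) - K * (u \<bullet> wderiv u)
        + \<xi> * (pval w 0 - \<beta> * \<xi> + \<alpha> * v) - \<eta> * pval w 1)"
  proof -
    have "energy_form (coords \<Phi>) (coords (A\<^sub>0 \<Phi>)) = w \<bullet> wderiv z + (wderiv w \<bullet> z - \<sigma> * (z \<bullet> z))
        - K * (u \<bullet> wderiv u) + \<xi> * (pval w 0 - \<beta> * \<xi> + \<alpha> * v) - \<eta> * pval w 1"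
      using pos unfolding energy_form_def J0' unfolding coords\<Phi> coordsA
      by (simp add: w_def[symmetric] inner_diff_right inner_commute[of z "wderiv w"])
    moreover have "energy_form (coords (A\<^sub>0 \<Phi>)) (coords \<Phi>) = w \<bullet> wderiv z + (wderiv w \<bullet> z - \<sigma> * (z \<bullet> z))
        - K * (u \<bullet> wderiv u) + \<xi> * (pval w 0 - \<beta> * \<xi> + \<alpha> * v) - \<eta> * pval w 1"
      using pos unfolding energy_form_def J0' unfolding coords\<Phi> coordsA
      by (simp add: sa inner_diff_left inner_commute[of "wderiv u" u])
    ultimately show ?thesis by simp
  qed
  also have "\<dots> = - (2 * \<sigma> * (norm z)\<^sup>2 + (2 * \<beta> - K) * \<xi>\<^sup>2 - 2 * \<alpha> * (\<xi> * v) + K * v\<^sup>2)"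
  proof -
    have "2 * (K * (u \<bullet> wderiv u)) = K * (v\<^sup>2 - \<xi>\<^sup>2)" unfolding ibu[symmetric] by simp
    then show ?thesis unfolding ibp power2_norm_eq_inner by (simp add: algebra_simps power2_eq_square)
  qed
  also have "\<dots> \<le> - min (2 * \<sigma>) (min (2 * \<beta> - K - \<alpha>) (K - \<alpha>)) * observed \<Phi>"
    (is "_ \<le> - ?k * _")
  proof -
    have "2 * \<alpha> * (\<xi> * v) \<le> \<alpha> * (\<xi>\<^sup>2 + v\<^sup>2)"
      using mult_left_mono[OF sum_squares_bound[of \<xi> v], of \<alpha>] pos by (simp add: algebra_simps)
    moreover have "?k * (norm z)\<^sup>2 \<le> 2 * \<sigma> * (norm z)\<^sup>2" by (intro mult_right_mono) auto
    moreover have "?k * \<xi>\<^sup>2 \<le> (2 * \<beta> - K - \<alpha>) * \<xi>\<^sup>2" by (intro mult_right_mono) auto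
    moreover have "?k * v\<^sup>2 \<le> (K - \<alpha>) * v\<^sup>2" by (intro mult_right_mono) auto
    moreover have "observed \<Phi> = (norm z)\<^sup>2 + \<xi>\<^sup>2 + v\<^sup>2" by (simp add: observed_def \<Phi> \<xi>_def v_def)
    ultimately show ?thesis by (simp add: algebra_simps)
  qed
  finally show ?thesis .
qed

text \<open>Integration by parts, once for each of the pairs \<open>(w, y)\<close>, \<open>(z, x\<^bsup>n+1\<^esup>)\<close> and \<open>(w, x)\<close>, and the weighted
  identity for \<open>u\<close>. The multiplier \<open>x\<close> vanishes at \<open>0\<close> and is \<open>1\<close> at \<open>1\<close>, so the boundary value \<open>w(1)\<close> from
  \<open>M\<eta>'\<close> cancels.\<close>

lemma correction_identity:
  assumes "y \<in> H1" "wderiv y \<in> H1" "z \<in> H1" "u \<in> H1" "pval u 0 = pval z 0"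
  defines "w \<equiv> a \<odot> wderiv y" and "\<xi> \<equiv> pval z 0" and "\<eta> \<equiv> pval z 1" and "v \<equiv> pval u 1"
  defines "\<Phi> \<equiv> (y, z, u, \<xi>, \<eta>)"
  shows "correction_form n (coords \<Phi>) (coords (A\<^sub>0 \<Phi>)) + correction_form n (coords (A\<^sub>0 \<Phi>)) (coords \<Phi>)
    = - ((norm u)\<^sup>2 + v\<^sup>2 - 2 * \<xi>\<^sup>2)
      + ((norm z)\<^sup>2 + m * \<xi>\<^sup>2 + M * \<eta>\<^sup>2 - w \<bullet> wderiv y - \<sigma> * (z \<bullet> y) + (\<alpha> * v - \<beta> * \<xi>) * pval y 0)
      - 3 * ((M * \<eta> + z \<bullet> l2_pow 1) * (\<eta> - real (Suc n) * (z \<bullet> l2_pow n))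
          - (w \<bullet> l2_const 1 + \<sigma> * (z \<bullet> l2_pow 1)) * (wderiv y \<bullet> l2_pow (Suc n)))"
proof -
  have wH: "w \<in> H1" unfolding w_def by (rule H1_times[OF a(1) assms(2)])
  have bW: "ess_bounded l2_weight (\<bar>2\<bar> + norm (l2_const (-1)))" unfolding l2_weight_def by (rule ess_bounded_ac)
  have sa: "(l2_weight \<odot> - ((1 / \<tau>) *\<^sub>R wderiv u)) \<bullet> u = - (1 / \<tau>) * ((l2_weight \<odot> u) \<bullet> wderiv u)"
    using l2_times_selfadjoint[OF bW, of "- ((1 / \<tau>) *\<^sub>R wderiv u)" u] by simp
  have wt: "2 * ((l2_weight \<odot> u) \<bullet> wderiv u) = (norm u)\<^sup>2 + v\<^sup>2 - 2 * \<xi>\<^sup>2"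
    using l2_weight_identity[OF assms(4)] by (simp add: v_def \<xi>_def assms(5))
  have ib1: "w \<bullet> wderiv y + wderiv w \<bullet> y = pval w 1 * pval y 1 - pval w 0 * pval y 0"
    by (rule H1_integration_by_parts[OF wH assms(1)])
  have dpow: "wderiv (l2_pow (Suc k)) = real (Suc k) *\<^sub>R l2_pow k" for k
    by (simp only: l2_pow_Suc_eq_ac wderiv_ac)
  have ib2: "real (Suc n) * (z \<bullet> l2_pow n) + wderiv z \<bullet> l2_pow (Suc n) = \<eta>"
    using H1_integration_by_parts[OF assms(3) l2_pow_Suc_H1(1)[of n]]
    by (simp add: dpow l2_pow_Suc_H1 \<eta>_def del: of_nat_Suc)
  have ib3: "w \<bullet> l2_const 1 + wderiv w \<bullet> l2_pow 1 = pval w 1"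
    using H1_integration_by_parts[OF wH l2_pow_Suc_H1(1)[of 0]] l2_pow_Suc_H1(2,3)[of 0] dpow[of 0]
    by (simp add: l2_pow_0)
  have coords\<Phi>: "coords \<Phi> = (y, wderiv y, z, u, \<xi>, \<eta>)" by (simp add: coords_def \<Phi>_def)
  have coordsA: "coords (A\<^sub>0 \<Phi>) = (z, wderiv z, wderiv w - \<sigma> *\<^sub>R z, - (1 / \<tau>) *\<^sub>R wderiv u,
      (1 / m) * (pval w 0 - \<beta> * \<xi> + \<alpha> * v), - pval w 1 / M)"
    by (simp add: coords_def crane_op_def \<Phi>_def w_def v_def)
  have lv: "left_value (coords \<Phi>) = pval y 0" "right_value (coords \<Phi>) = pval y 1"
    using end_values[OF assms(1)] by (simp_all add: \<Phi>_def)
  have lvA: "left_value (coords (A\<^sub>0 \<Phi>)) = \<xi>" "right_value (coords (A\<^sub>0 \<Phi>)) = \<eta>"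
    using end_values[OF assms(3)] by (simp_all add: \<Phi>_def \<xi>_def \<eta>_def crane_op_def)
  have c1: "correction_form n (coords \<Phi>) (coords (A\<^sub>0 \<Phi>))
    = - ((l2_weight \<odot> u) \<bullet> wderiv u) + (z \<bullet> z + m * (\<xi> * \<xi>) + M * (\<eta> * \<eta>))
      - 3 * ((M * \<eta> + z \<bullet> l2_pow 1) * (wderiv z \<bullet> l2_pow (Suc n)))"
    unfolding correction_form_def lvA unfolding coords\<Phi> coordsA using pos by simp
  have c2: "correction_form n (coords (A\<^sub>0 \<Phi>)) (coords \<Phi>)
    = - ((l2_weight \<odot> u) \<bullet> wderiv u)
      + (wderiv w \<bullet> y - \<sigma> * (z \<bullet> y) + (pval w 0 - \<beta> * \<xi> + \<alpha> * v) * pval y 0 - pval w 1 * pval y 1)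
      - 3 * ((- pval w 1 + wderiv w \<bullet> l2_pow 1 - \<sigma> * (z \<bullet> l2_pow 1)) * (wderiv y \<bullet> l2_pow (Suc n)))"
    unfolding correction_form_def lv unfolding coords\<Phi> coordsA using pos
    by (simp add: sa inner_diff_left algebra_simps)
  have e1: "wderiv z \<bullet> l2_pow (Suc n) = \<eta> - real (Suc n) * (z \<bullet> l2_pow n)" using ib2 by linarith
  have e2: "- pval w 1 + wderiv w \<bullet> l2_pow 1 = - (w \<bullet> l2_const 1)" using ib3 by linarith
  have e3: "wderiv w \<bullet> y = pval w 1 * pval y 1 - pval w 0 * pval y 0 - w \<bullet> wderiv y" using ib1 by linarith
  show ?thesis
    unfolding c1 c2 e1 e2 e3 wt[symmetric] power2_norm_eq_inner[of z]
    by (simp add: algebra_simps power2_eq_square)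
qed

lemma energy_coercive:
  "\<exists>c>0. \<forall>\<Phi>\<in>crane_space. c * (norm (coords \<Phi>))\<^sup>2 \<le> energy_form (coords \<Phi>) (coords \<Phi>)"
proof -
  obtain c d where c: "c > 0" and le: "\<And>\<Phi>. \<Phi> \<in> crane_space \<Longrightarrow> c * product_norm \<Phi> \<le> N\<^sub>0 \<Phi>"
    using equiv unfolding equivalent_norms_on_def by blast
  have "c\<^sup>2 * (norm (coords \<Phi>))\<^sup>2 \<le> energy_form (coords \<Phi>) (coords \<Phi>)" if "\<Phi> \<in> crane_space" for \<Phi>
  proof -
    have "\<bar>c * norm (coords \<Phi>)\<bar> \<le> sqrt (energy_form (coords \<Phi>) (coords \<Phi>))"
      using le[OF that] c by (simp add: norm_coords crane_norm_eq[OF that] flip: norm_coords)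
    then have "(c * norm (coords \<Phi>))\<^sup>2 \<le> energy_form (coords \<Phi>) (coords \<Phi>)" by (rule sqrt_ge_absD)
    then show ?thesis by (simp add: power_mult_distrib)
  qed
  then show ?thesis using c by (intro exI[of _ "c\<^sup>2"]) simp
qed

lemma correction_dissipation:
  "\<exists>n \<kappa> R. \<kappa> > 0 \<and> (\<forall>\<Phi>\<in>D\<^sub>0.
    correction_form n (coords \<Phi>) (coords (A\<^sub>0 \<Phi>)) + correction_form n (coords (A\<^sub>0 \<Phi>)) (coords \<Phi>)
      \<le> - \<kappa> * (norm (coords \<Phi>))\<^sup>2 + R * observed \<Phi>)"
proof -
  obtain A where A: "ess_bounded a A" "A > 0" by (rule obtain_a_bound)
  obtain c where c: "c > 0" "\<And>\<Phi>. \<Phi> \<in> crane_space \<Longrightarrow> c * (norm (coords \<Phi>))\<^sup>2 \<le> energy_form (coords \<Phi>) (coords \<Phi>)"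
    using energy_coercive by blast
  \<comment> \<open>The exponent is chosen such that the error of the third correction term stays below half of the
    elastic energy.\<close>
  have "a\<^sub>0 / (6 * A) > 0" using pos A by simp
  then obtain n where n: "norm (l2_pow (Suc n)) < a\<^sub>0 / (6 * A)"
    using LIMSEQ_D[OF LIMSEQ_Suc[OF l2_pow_tendsto_0]] by force
  define H where "H = A + 1 + K * \<tau> + m + M"
  have K: "K > 0" using params pos by linarith
  have H: "H > 0" using A K pos by (simp add: H_def add_pos_pos)
  define k where "k = real (Suc n)"
  define \<mu> where "\<mu> = min 1 (min (2 * M) (a\<^sub>0 / 2))"
  define \<kappa> where "\<kappa> = \<mu> * c / H"
  define L where "L = 4 * \<sigma> + 3 * M * k + 3 + 3 * \<alpha> + 3 * \<beta>"
  have \<kappa>: "\<kappa> > 0" using pos c H by (simp add: \<kappa>_def \<mu>_def)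
  have CS: "\<bar>x \<bullet> y\<bar> \<le> b * d" if "norm x \<le> b" "norm y \<le> d" for x y :: l2 and b d
    using Cauchy_Schwarz_ineq2[of x y] mult_mono[OF that] that norm_ge_zero[of x] norm_ge_zero[of y] by linarith
  have "correction_form n (coords \<Phi>) (coords (A\<^sub>0 \<Phi>)) + correction_form n (coords (A\<^sub>0 \<Phi>)) (coords \<Phi>)
      \<le> - (\<kappa> / 2) * (norm (coords \<Phi>))\<^sup>2 + (3 + m + 3 * k + \<mu> + 3 * L\<^sup>2 / (2 * \<kappa>)) * observed \<Phi>"
    if \<Phi>D: "\<Phi> \<in> D\<^sub>0" for \<Phi>
  proof -
    obtain y z u where \<Phi>: "\<Phi> = (y, z, u, pval z 0, pval z 1)" and h: "y \<in> H1" "wderiv y \<in> H1" "z \<in> H1" "u \<in> H1"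
      and u0: "pval u 0 = pval z 0" and J0: "J (coords (y, z, u, pval z 0, pval z 1)) = 0"
      using D0_cases[OF \<Phi>D] .
    define r where "r = norm (coords \<Phi>)"
    define w where "w = a \<odot> wderiv y"
    have r2: "r\<^sup>2 = (norm y)\<^sup>2 + (norm (wderiv y))\<^sup>2 + (norm z)\<^sup>2 + (norm u)\<^sup>2 + (pval z 0)\<^sup>2 + (pval z 1)\<^sup>2"
      unfolding r_def \<Phi> by (rule norm_coords_sq)
    have r0: "0 \<le> r" by (simp add: r_def)
    have le_r: "x \<le> r" if "x\<^sup>2 \<le> r\<^sup>2" for x using that r0 by (rule power2_le_imp_le)
    have y: "norm y \<le> r" and g: "norm (wderiv y) \<le> r" and z: "norm z \<le> r" and \<eta>: "\<bar>pval z 1\<bar> \<le> r"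
      by (rule le_r, simp add: r2)+
    have wg: "norm w \<le> A * norm (wderiv y)" unfolding w_def using A by (intro norm_l2_times_le) auto
    have wy_upper: "w \<bullet> wderiv y \<le> A * (norm (wderiv y))\<^sup>2"
      using CS[OF wg order_refl, of "wderiv y"] by (simp add: power2_eq_square)
    have energy: "c * r\<^sup>2 \<le> H * ((norm (wderiv y))\<^sup>2 + (norm z)\<^sup>2 + (norm u)\<^sup>2 + (pval z 0)\<^sup>2 + (pval z 1)\<^sup>2)"
    proof -
      have "\<Phi> \<in> crane_space" using \<Phi>D D0_subset_X0 X0_iff by blast
      then have "c * r\<^sup>2 \<le> energy_form (coords \<Phi>) (coords \<Phi>)" unfolding r_def by (rule c(2))
      also have "\<dots> = w \<bullet> wderiv y + (norm z)\<^sup>2 + K * \<tau> * (norm u)\<^sup>2 + m * (pval z 0)\<^sup>2 + M * (pval z 1)\<^sup>2"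
        unfolding energy_form_def using J0 unfolding \<Phi> power2_norm_eq_inner
        by (simp add: coords_def w_def power2_eq_square)
      also have "\<dots> \<le> H * (norm (wderiv y))\<^sup>2 + H * (norm z)\<^sup>2 + H * (norm u)\<^sup>2 + H * (pval z 0)\<^sup>2 + H * (pval z 1)\<^sup>2"
      proof (intro add_mono)
        have "A \<le> H" using K pos A by (simp add: H_def)
        then show "w \<bullet> wderiv y \<le> H * (norm (wderiv y))\<^sup>2"
          using wy_upper mult_right_mono[of A H "(norm (wderiv y))\<^sup>2"] by simp
        have "1 \<le> H" using K pos A by (simp add: H_def)
        then show "(norm z)\<^sup>2 \<le> H * (norm z)\<^sup>2" using mult_right_mono[of 1 H "(norm z)\<^sup>2"] by simp
        have "0 < K * \<tau>" using K pos by simp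
        then show "K * \<tau> * (norm u)\<^sup>2 \<le> H * (norm u)\<^sup>2" "m * (pval z 0)\<^sup>2 \<le> H * (pval z 0)\<^sup>2"
          "M * (pval z 1)\<^sup>2 \<le> H * (pval z 1)\<^sup>2"
          using pos A by (auto simp: H_def intro!: mult_right_mono)
      qed
      finally show ?thesis by (simp add: algebra_simps)
    qed
    have id: "correction_form n (coords \<Phi>) (coords (A\<^sub>0 \<Phi>)) + correction_form n (coords (A\<^sub>0 \<Phi>)) (coords \<Phi>)
      = - ((norm u)\<^sup>2 + (pval u 1)\<^sup>2 - 2 * (pval z 0)\<^sup>2)
      + ((norm z)\<^sup>2 + m * (pval z 0)\<^sup>2 + M * (pval z 1)\<^sup>2 - w \<bullet> wderiv y - \<sigma> * (z \<bullet> y) + (\<alpha> * pval u 1 - \<beta> * pval z 0) * pval y 0)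
      - 3 * ((M * pval z 1 + z \<bullet> l2_pow 1) * (pval z 1 - k * (z \<bullet> l2_pow n))
          - (w \<bullet> l2_const 1 + \<sigma> * (z \<bullet> l2_pow 1)) * (wderiv y \<bullet> l2_pow (Suc n)))"
      unfolding \<Phi> w_def k_def by (rule correction_identity[OF h u0])
    have obs: "observed \<Phi> = (norm z)\<^sup>2 + (pval z 0)\<^sup>2 + (pval u 1)\<^sup>2" by (simp add: observed_def \<Phi>)
    show ?thesis
      unfolding id obs r_def[symmetric] L_def \<kappa>_def \<mu>_def
    proof (rule correction_estimate[where \<epsilon> = "norm (l2_pow (Suc n))" and A = A and g = "norm (wderiv y)"])
      show "\<bar>z \<bullet> y\<bar> \<le> norm z * r" by (rule CS[OF order_refl y])
      show "\<bar>pval y 0\<bar> \<le> 3 * r"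
        using abs_left_value_le[of "coords \<Phi>"] end_values(1)[OF h(1)] by (simp add: r_def \<Phi>)
      show "\<bar>z \<bullet> l2_pow 1\<bar> \<le> norm z" "\<bar>z \<bullet> l2_pow n\<bar> \<le> norm z"
        using CS[OF order_refl norm_l2_pow_le, of z] by simp_all
      show "\<bar>wderiv y \<bullet> l2_pow (Suc n)\<bar> \<le> norm (l2_pow (Suc n)) * norm (wderiv y)"
        using CS[OF order_refl order_refl, of "wderiv y" "l2_pow (Suc n)"] by (simp add: mult.commute)
      show "\<bar>w \<bullet> l2_const 1\<bar> \<le> A * norm (wderiv y)"
        using CS[OF wg norm_l2_const_1] by simp
      show "3 * A * norm (l2_pow (Suc n)) \<le> a\<^sub>0 / 2"
        using n A by (simp add: pos_less_divide_eq ac_simps)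
      show "a\<^sub>0 * (norm (wderiv y))\<^sup>2 \<le> w \<bullet> wderiv y"
        unfolding w_def by (rule l2_times_coercive[OF A(1) a_lower_bound])
    qed (use r0 z g \<eta> norm_l2_pow_le energy c H pos A in \<open>auto simp: k_def\<close>)
  qed
  moreover have "\<kappa> / 2 > 0" using \<kappa> by simp
  ultimately show ?thesis by blast
qed

text \<open>The components are approximated independently, with the coupled boundary values prescribed. The
  functional \<open>J\<close> of the approximation is then restored to zero by shifting \<open>y\<close> by a constant \<open>k\<close>, which is
  possible because \<open>J\<close> takes the nonzero value \<open>\<sigma> + \<beta> - \<alpha>\<close> at \<open>y = 1\<close>.\<close>

lemma D0_dense:
  assumes \<Phi>: "\<Phi> \<in> X\<^sub>0" and \<epsilon>: "\<epsilon> > 0"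
  shows "\<exists>\<Psi>\<in>D\<^sub>0. norm (coords (\<Phi> - \<Psi>)) < \<epsilon>"
proof -
  interpret J: bounded_linear J by (rule bounded_linear_J)
  obtain C where C: "\<And>v. \<bar>J v\<bar> \<le> norm v * C" "C > 0" using J.pos_bounded by auto
  obtain y z u \<xi> \<eta> where \<Phi>_eq: "\<Phi> = (y, z, u, \<xi>, \<eta>)" by (cases \<Phi>)
  have yH: "y \<in> H1" and J0: "J (coords \<Phi>) = 0" using \<Phi> by (auto simp: X0_iff \<Phi>_eq crane_space_def)
  define s where "s = \<sigma> + \<beta> - \<alpha>"
  have s: "s > 0" using pos params by (simp add: s_def)
  define \<delta> where "\<delta> = \<epsilon> / (4 * (1 + C / s) + 1)"
  have den: "4 * (1 + C / s) + 1 > 0" using C s by (simp add: add_pos_pos)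
  have \<delta>: "\<delta> > 0" using den \<epsilon> by (simp add: \<delta>_def)
  obtain g where g: "g \<in> H1" "norm (wderiv y - g) < \<delta>"
    using H1_dense_with_boundary_values[OF \<delta>, of 0 0 "wderiv y"] by blast
  obtain z' where z': "z' \<in> H1" "pval z' 0 = \<xi>" "pval z' 1 = \<eta>" "norm (z - z') < \<delta>"
    using H1_dense_with_boundary_values[OF \<delta>, of \<xi> \<eta> z] by blast
  obtain u' where u': "u' \<in> H1" "pval u' 0 = \<xi>" "norm (u - u') < \<delta>"
    using H1_dense_with_boundary_values[OF \<delta>, of \<xi> 0 u] by blast
  define d :: coord_space where "d = (ac 0 (wderiv y - g), wderiv y - g, z - z', u - u', 0, 0)"
  define e :: coord_space where "e = (l2_const 1, 0, 0, 0, 0, 0)"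
  have norm_d: "norm d \<le> 4 * \<delta>"
  proof -
    have "norm d \<le> norm (ac 0 (wderiv y - g)) + (norm (wderiv y - g) + (norm (z - z') + (norm (u - u') + 0)))"
      unfolding d_def by (intro order_trans[OF norm_Pair_le] add_mono order_refl) simp
    then show ?thesis using norm_ac_le[of 0 "wderiv y - g"] g z' u' by simp
  qed
  have norm_e: "norm e \<le> 1" using norm_l2_const_1 by (simp add: e_def norm_Pair)
  have Je: "J e = s"
  proof -
    have "e = coords (l2_const 1, 0, 0, 0, 0)" by (simp add: e_def coords_def l2_const_eq_ac)
    moreover have "left_value (coords (l2_const 1, 0, 0, 0, 0)) = 1"
      by (subst end_values(1)[symmetric]) (simp_all add: l2_const_eq_ac prim_zero)
    moreover have "l2_const 1 \<bullet> l2_const 1 = 1"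
      using prim_l2_const[of 1] by (simp add: prim_at_1)
    ultimately show ?thesis by (simp add: J_def s_def) (simp add: coords_def s_def)
  qed
  define k where "k = J d / s"
  define y' where "y' = ac (pval y 0 + k) g"
  define \<Psi> where "\<Psi> = (y', z', u', \<xi>, \<eta>)"
  have y_eq: "y = ac (pval y 0) (wderiv y)" by (rule H1_eq_ac[OF yH])
  have diff: "coords (\<Phi> - \<Psi>) = d - k *\<^sub>R e"
  proof -
    have yd: "y - y' = ac (- k) (wderiv y - g)"
      by (subst y_eq) (simp add: y'_def ac_diff)
    have "wderiv (y - y') = wderiv y - g" unfolding yd by (rule wderiv_ac)
    moreover have "y - y' = ac 0 (wderiv y - g) - k *\<^sub>R l2_const 1"
      unfolding yd by (simp add: l2_const_eq_ac ac_scaleR ac_diff)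
    ultimately show ?thesis by (simp add: coords_def \<Phi>_eq \<Psi>_def d_def e_def)
  qed
  have space: "\<Phi> \<in> crane_space" "\<Psi> \<in> crane_space"
    using yH by (simp_all add: crane_space_def \<Phi>_eq \<Psi>_def y'_def)
  have "J (coords (\<Phi> - \<Psi>)) = 0"
    using s unfolding diff by (simp add: J.diff J.scaleR Je k_def)
  moreover have "coords (\<Phi> - \<Psi>) = coords \<Phi> - coords \<Psi>"
    using coords_add[OF space(1), of "(-1) *\<^sub>R \<Psi>"] coords_scaleR[OF space(2), of "-1"]
      subspace_scale[OF subspace_crane_space space(2), of "-1"] by simp
  ultimately have "J (coords \<Psi>) = 0" using J0 by (simp add: J.diff)
  then have "\<Psi> \<in> D\<^sub>0"
    using space(2) g(1) z' u' by (simp add: crane_dom0_def crane_dom_def X0_iff \<Psi>_def y'_def H2_def)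
  moreover have "norm (coords (\<Phi> - \<Psi>)) < \<epsilon>"
  proof -
    have "\<bar>k\<bar> \<le> norm d * C / s" using C(1)[of d] s by (simp add: k_def abs_divide divide_right_mono)
    moreover have "norm (k *\<^sub>R e) \<le> \<bar>k\<bar>" using norm_e by (simp add: mult_left_le)
    ultimately have "norm (d - k *\<^sub>R e) \<le> norm d + norm d * C / s"
      using norm_triangle_ineq4[of d "k *\<^sub>R e"] by linarith
    also have "\<dots> = norm d * (1 + C / s)" by (simp add: algebra_simps)
    also have "\<dots> \<le> 4 * \<delta> * (1 + C / s)"
      using norm_d C s by (intro mult_right_mono) (auto simp: add_nonneg_nonneg)
    also have "\<dots> < \<delta> * (4 * (1 + C / s) + 1)" using \<delta> by (simp add: algebra_simps)
    also have "\<dots> = \<epsilon>" using den by (simp add: \<delta>_def)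
    finally show ?thesis by (simp add: diff)
  qed
  ultimately show ?thesis by blast
qed

theorem semigroup_exponentially_stable:
  assumes gen: "generates_contraction_semigroup X\<^sub>0 N\<^sub>0 D\<^sub>0 A\<^sub>0 T"
  shows "\<exists>C>0. \<exists>\<omega>>0. \<forall>t>0. onorm_on X\<^sub>0 N\<^sub>0 (T t) \<le> C * exp (- \<omega> * t)"
proof -
  obtain c where c: "c > 0" "\<And>\<Phi>. \<Phi> \<in> crane_space \<Longrightarrow> c * (norm (coords \<Phi>))\<^sup>2 \<le> energy_form (coords \<Phi>) (coords \<Phi>)"
    using energy_coercive by blast
  obtain n \<kappa> R where \<kappa>: "\<kappa> > 0" and corr: "\<And>\<Phi>. \<Phi> \<in> D\<^sub>0 \<Longrightarrow>
    correction_form n (coords \<Phi>) (coords (A\<^sub>0 \<Phi>)) + correction_form n (coords (A\<^sub>0 \<Phi>)) (coords \<Phi>)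
      \<le> - \<kappa> * (norm (coords \<Phi>))\<^sup>2 + R * observed \<Phi>"
    using correction_dissipation by blast
  have X0: "\<Phi> \<in> crane_space" if "\<Phi> \<in> X\<^sub>0" for \<Phi> using that X0_iff by blast
  show ?thesis
  proof (rule contraction_semigroup_exponential_decay_perturbed[OF gen subspace_X0 _ _ _ D0_subset_X0
        bounded_bilinear_energy_form bounded_bilinear_correction_form _ c(1) energy_dissipation corr _ _ \<kappa> D0_dense])
    show "equivalent_norms_on X\<^sub>0 N\<^sub>0 (\<lambda>\<Phi>. norm (coords \<Phi>))"
      using equiv X0 unfolding equivalent_norms_on_def norm_coords by blast
    show "0 \<le> observed \<Phi>" for \<Phi> by (cases \<Phi>) (simp add: observed_def)
    show "0 < min (2 * \<sigma>) (min (2 * \<beta> - K - \<alpha>) (K - \<alpha>))" using pos params by simp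
  qed (use X0 coords_add coords_scaleR c(2) in auto)
qed

end

theorem theorem8:
  fixes m M \<alpha> \<beta> \<sigma> \<tau> K varpi a\<^sub>0 :: real
    and a :: l2
    and T :: "real \<Rightarrow> state \<Rightarrow> state"
  assumes "m > 0" "M > 0" "\<alpha> > 0" "\<beta> > 0" "\<sigma> > 0" "\<tau> > 0"
    and "a \<in> H1" "a\<^sub>0 > 0" "\<forall>x\<in>{0..1}. pval a x \<ge> a\<^sub>0"
    and "\<alpha> < \<beta>" "\<alpha> < K" "K < 2 * \<beta> - \<alpha>"
    and "varpi > 0"
    and "equivalent_norms_on crane_space (crane_norm m M \<alpha> \<beta> \<sigma> \<tau> K varpi a) product_norm"
    and "generates_contraction_semigroup
           (crane_space0 m M \<alpha> \<beta> \<sigma> \<tau>) (crane_norm m M \<alpha> \<beta> \<sigma> \<tau> K varpi a)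
           (crane_dom0 m M \<alpha> \<beta> \<sigma> \<tau>) (crane_op m M \<alpha> \<beta> \<sigma> \<tau> a) T"
  shows "\<exists>C>0. \<exists>\<omega>>0. \<forall>t>0.
    onorm_on (crane_space0 m M \<alpha> \<beta> \<sigma> \<tau>) (crane_norm m M \<alpha> \<beta> \<sigma> \<tau> K varpi a) (T t)
      \<le> C * exp (- \<omega> * t)"
proof -
  interpret overhead_crane m M \<alpha> \<beta> \<sigma> \<tau> K varpi a\<^sub>0 a
    by unfold_locales (fact assms)+
  show ?thesis by (rule semigroup_exponentially_stable) fact
qed

end
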